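(* Let $k$ be a positive integer, let $\beta>0$ with $\beta\neq 1$, and let $p(n)=n^{-\beta}$. For $G\in G(n,p(n))$ write $\gamma_\ell=\gamma_\ell(\mathcal{P}_G)$. Then: (1) (subcritical regime) if $\beta>1$, then asymptotically almost surely $\gamma_\ell=0$ for all $\ell\geq 1$; (2) (supercritical regime) if $0<\beta<1$, then asymptotically almost surely $\gamma_\ell\in\Theta(n^{(2-\beta)\ell})$ for every $0<\ell\leq k$.
   Context: $G(n,p)$ is the Erdős–Rényi model of random graphs on vertex set $[n]$, where each of the $\binom n2$ possible edges is present independently with probability $p=p(n)$. A property holds asymptotically almost surely if the probability that $G\in G(n,p(n))$ has it tends to $1$ as $n\to\infty$. The statement "asymptotically almost surely $\gamma_\ell\in\Theta(g_\ell(n))$ for all $\ell$ in a finite range" means: there are constants $0<c<C$ such that $\lim_{n\to\infty}\mathbb{P}(c\,g_\ell(n)\le\gamma_\ell\le C\,g_\ell(n)\text{ for all such }\ell)=1$. For a finite simple graph $G=([n],E)$, the symmetric edge polytope is $\mathcal{P}_G=\mathrm{conv}(\pm(e_i-e_j) : ij\in E)\subset\mathbb{R}^n$ (if $E=\emptyset$, it is understood to be the single point $0$, with $\gamma$-vector $(1)$). It is a lattice polytope; let $d=\dim\mathcal{P}_G$. Its $h^*$-vector $(h_0^*,\dots,h_d^* )$ is defined by $|m\mathcal{P}_G\cap\mathbb{Z}^n|=\sum_{j=0}^d h_j^*\binom{m+d-j}{d}$ for all integers $m\ge 0$. It is known that $\mathcal{P}_G$ is reflexive, so $h_j^*=h_{d-j}^*$,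 and the $\gamma$-vector $(\gamma_0(\mathcal{P}_G),\dots,\gamma_{\lfloor d/2\rfloor}(\mathcal{P}_G))$ is defined by $\sum_{i=0}^{\lfloor d/2\rfloor}\gamma_i t^i(1+t)^{d-2i}=\sum_{j=0}^d h_j^*t^j$. We set $\gamma_i(\mathcal{P}_G)=0$ for $i>\lfloor d/2\rfloor$. *)

theory Defs
  imports
    "HOL-Probability.Probability"
    "HOL-Analysis.Finite_Function_Topology"
    "HOL-Computational_Algebra.Polynomial"
begin

text \<open>
  Since the dimension \<open>n\<close> tends to infinity, all spaces \<open>\<real>\<^sup>n\<close> are regarded as subspaces
  (supported on \<open>{1..n}\<close>) of the real vector space \<open>nat \<Rightarrow>\<^sub>0 real\<close> of finitely supported
  sequences. Only the linear and convex structure of this space is used.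
  A simple graph on \<open>{1..n}\<close> is given by its edge set, a set of two-element subsets of \<open>{1..n}\<close>.
\<close>

definition possible_edges :: "nat \<Rightarrow> nat set set" where
  "possible_edges n = {e. e \<subseteq> {1..n} \<and> card e = 2}"

definition erdos_renyi :: "nat \<Rightarrow> real \<Rightarrow> nat set set pmf" where
  "erdos_renyi n p =
     map_pmf (\<lambda>f. {e \<in> possible_edges n. f e})
       (Pi_pmf (possible_edges n) False (\<lambda>_. bernoulli_pmf p))"

definition asymptotically_almost_surely :: "(nat \<Rightarrow> 'a pmf) \<Rightarrow> (nat \<Rightarrow> 'a \<Rightarrow> bool) \<Rightarrow> bool" where
  "asymptotically_almost_surely M P \<longleftrightarrow>
     (\<lambda>n. measure_pmf.prob (M n) {x. P n x}) \<longlonglongrightarrow> 1"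

text \<open>
  Both orders of the endpoints of an edge are covered by \<open>{i, j} \<in> E\<close>, which yields both signs.
\<close>

definition symmetric_edge_polytope :: "nat set set \<Rightarrow> (nat \<Rightarrow>\<^sub>0 real) set" where
  "symmetric_edge_polytope E =
     (if E = {} then {0}
      else convex hull {Poly_Mapping.single i 1 - Poly_Mapping.single j 1 | i j. {i, j} \<in> E})"

text \<open>
  The library's \<open>aff_dim\<close> is restricted to Euclidean spaces; the dimension is instead taken as that
  of the linear space parallel to the affine hull.
\<close>

definition polytope_dim :: "(nat \<Rightarrow>\<^sub>0 real) set \<Rightarrow> nat" where
  "polytope_dim P = dim {x - y | x y. x \<in> P \<and> y \<in> P}"

definition integer_lattice :: "(nat \<Rightarrow>\<^sub>0 real) set" where
  "integer_lattice = {x. \<forall>i. Poly_Mapping.lookup x i \<in> \<int>}"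

text \<open>
  In the next two definitions the defining equations determine the entries up to index \<open>d\<close> and
  \<open>d div 2\<close>, respectively; the remaining entries are set to zero.
\<close>

definition h_star :: "(nat \<Rightarrow>\<^sub>0 real) set \<Rightarrow> nat \<Rightarrow> int" where
  "h_star P =
     (let d = polytope_dim P in
      THE h. (\<forall>j>d. h j = 0) \<and>
        (\<forall>m. int (card ((\<lambda>x. real m *\<^sub>R x) ` P \<inter> integer_lattice)) =
             (\<Sum>j\<le>d. h j * int ((m + d - j) choose d))))"

definition gamma_vector :: "(nat \<Rightarrow>\<^sub>0 real) set \<Rightarrow> nat \<Rightarrow> int" where
  "gamma_vector P =
     (let d = polytope_dim P in
      THE g. (\<forall>i>d div 2. g i = 0) \<and>
        (\<Sum>i\<le>d div 2. monom (g i) i * [:1, 1:] ^ (d - 2 * i)) =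
        (\<Sum>j\<le>d. monom (h_star P j) j))"

end

theory Submission
  imports Defs "HOL-Real_Asymp.Real_Asymp"
begin

text \<open>
  Replace every edge of \<open>G\<close> by its two orientations, called arcs. The lattice points of the dilate
  \<open>m P\<close> are the boundaries of the nonnegative integer flows of total value at most \<open>m\<close> on these arcs
  (\<open>lattice_points_dilate\<close>). In order to count every boundary once, put a generic weight on the
  arcs; then every lattice point has a unique cheapest flow. The supports of the cheapest flows form
  a simplicial complex, the complex of faces, which is a unimodular triangulation of the boundary of
  the polytope. The properties of cheapest flows rest on a single tool, the decomposition of a
  circulation into closed trails (\<open>conformal_circulation_functional\<close>).

  A generic direction \<open>v\<close> cuts the fan over this complex into half-open cones, one for each facet
  (\<open>facet_in_direction\<close>). Hence \<open>h\<^sub>j\<^sup>*\<close> is the number of facets in which exactly \<open>j\<close> coordinates of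
  \<open>v\<close> are negative (\<open>h_star_eq_h_count\<close>), and passing to \<open>-v\<close> yields the symmetry of the h-star vector
  (\<open>h_count_palindromic\<close>), so that the gamma-vector exists. The transformations between face numbers,
  h-vector and gamma-vector are triangular. They show that \<open>\<gamma>\<^sub>l\<close> equals the number of faces with \<open>l\<close>
  arcs up to terms in which at least one factor, the number of arcs, is replaced by the dimension
  (\<open>gamma_from_h_bounds\<close>).

  If \<open>\<beta> < 1\<close>, the number of arcs is of order \<open>n\<^sup>2\<^sup>-\<^sup>\<beta>\<close>, which is much larger than the dimension, and
  \<open>\<gamma>\<^sub>l\<close> is governed by the number of faces with \<open>l\<close> arcs. Trivially, this is at most the \<open>l\<close>-th power of
  the number of arcs. In the other direction, every induced matching is a face
  (\<open>induced_matching_face\<close>), and since \<open>p\<close> tends to zero, almost all \<open>l\<close>-tuples of edges are induced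
  matchings. The number of edges and the number of adjacent pairs of edges are controlled by their
  second and first moments.

  If \<open>\<beta> > 1\<close>, then \<open>n p\<close> tends to zero and asymptotically almost surely there is no closed trail. The
  polytope of a forest is a cross-polytope, the h-star polynomial is \<open>(1 + t)\<^sup>d\<close> and the gamma-vector
  is \<open>(1, 0, 0, \<dots>)\<close>.
\<close>

section \<open>Circulations and their decomposition into cycles\<close>

definition arc_vec :: "nat \<times> nat \<Rightarrow> nat \<Rightarrow>\<^sub>0 real" where
  "arc_vec e = Poly_Mapping.single (fst e) 1 - Poly_Mapping.single (snd e) 1"

lemma lookup_scaleR: "Poly_Mapping.lookup (r *\<^sub>R x) v = r * Poly_Mapping.lookup x v"
  for x :: "'b \<Rightarrow>\<^sub>0 real"
proof -
  have "finite {i. r * Poly_Mapping.lookup x i \<noteq> 0}"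
    by (rule finite_subset[OF _ finite_lookup[of x]]) auto
  then show ?thesis by (simp add: scaleR_poly_mapping_def)
qed

lemma lookup_sum_scaleR:
  "Poly_Mapping.lookup (\<Sum>e\<in>A. r e *\<^sub>R f e) v = (\<Sum>e\<in>A. r e * Poly_Mapping.lookup (f e) v)"
  for f :: "'a \<Rightarrow> 'b \<Rightarrow>\<^sub>0 real"
  by (simp add: lookup_sum lookup_scaleR)

lemma lookup_arc_vec:
  "Poly_Mapping.lookup (arc_vec e) v = (if fst e = v then 1 else 0) - (if snd e = v then 1 else 0)"
  by (simp add: arc_vec_def lookup_minus lookup_single when_def)

lemma arc_vec_swap: "arc_vec (prod.swap e) = - arc_vec e"
  by (simp add: arc_vec_def)

lemma inj_on_arc_vec: "inj_on arc_vec {e. fst e \<noteq> snd e}"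
proof (rule inj_onI)
  fix e f :: "nat \<times> nat"
  assume e: "e \<in> {e. fst e \<noteq> snd e}" and eq: "arc_vec e = arc_vec f"
  show "e = f"
    using e arg_cong[OF eq, of "\<lambda>x. Poly_Mapping.lookup x (fst e)"]
      arg_cong[OF eq, of "\<lambda>x. Poly_Mapping.lookup x (snd e)"]
    by (cases e; cases f; auto simp: lookup_arc_vec split: if_splits)
qed

text \<open>
  Following a successor arc again and again in a finite set of arcs must eventually repeat an arc.
  The segment between two repetitions at minimal distance is a closed trail.
\<close>

lemma closed_trail_exists:
  fixes head tail :: "'a \<Rightarrow> 'v"
  assumes "finite A" "A \<noteq> {}" and succ: "\<And>a. a \<in> A \<Longrightarrow> \<exists>b\<in>A. tail b = head a"
  obtains as where "as \<noteq> []" "distinct as" "set as \<subseteq> A" "map tail (rotate1 as) = map head as"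
proof -
  obtain f where f: "\<And>a. a \<in> A \<Longrightarrow> f a \<in> A \<and> tail (f a) = head a"
    using succ by metis
  obtain a0 where a0: "a0 \<in> A" using assms by blast
  have inA: "(f ^^ i) a \<in> A" if "a \<in> A" for i a
    using that by (induction i) (auto dest: f)
  have "\<not> inj (\<lambda>i. (f ^^ i) a0)"
  proof
    assume "inj (\<lambda>i. (f ^^ i) a0)"
    moreover have "range (\<lambda>i. (f ^^ i) a0) \<subseteq> A" using inA a0 by auto
    ultimately show False using \<open>finite A\<close> by (meson finite_subset finite_imageD infinite_UNIV_nat)
  qed
  then obtain i j where "i < j" and ij: "(f ^^ i) a0 = (f ^^ j) a0"
    unfolding inj_def by (metis linorder_neqE_nat)
  define a where "a = (f ^^ i) a0"
  have aA: "a \<in> A" using inA a0 by (simp add: a_def)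
  have "(f ^^ (j - i)) a = (f ^^ (j - i + i)) a0"
    unfolding a_def by (simp only: funpow_add o_apply)
  hence "(f ^^ (j - i)) a = a" using ij \<open>i < j\<close> by (simp add: a_def)
  hence ex: "\<exists>k. k > 0 \<and> (f ^^ k) a = a" using \<open>i < j\<close> by (metis zero_less_diff)
  define k where "k = (LEAST k. k > 0 \<and> (f ^^ k) a = a)"
  have k: "k > 0" "(f ^^ k) a = a" using LeastI_ex[OF ex] by (simp_all add: k_def)
  have least: "\<not> (m > 0 \<and> (f ^^ m) a = a)" if "m < k" for m
    using not_less_Least that unfolding k_def by blast
  define as where "as = map (\<lambda>i. (f ^^ i) a) [0..<k]"
  have dist: "(f ^^ p) a \<noteq> (f ^^ q) a" if "p < q" "q < k" for p q
  proof
    assume eq: "(f ^^ p) a = (f ^^ q) a"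
    have "(f ^^ (k - q + p)) a = (f ^^ (k - q + q)) a"
      using eq by (simp only: funpow_add o_apply)
    also have "\<dots> = a" using that k by simp
    finally have "(f ^^ (k - q + p)) a = a" .
    moreover have "k - q + p < k" "k - q + p > 0" using that by arith+
    ultimately show False using least by blast
  qed
  have "distinct as" unfolding as_def distinct_map
  proof (intro conjI inj_onI)
    fix x y assume "x \<in> set [0..<k]" "y \<in> set [0..<k]" "(f ^^ x) a = (f ^^ y) a"
    then show "x = y" using dist[of x y] dist[of y x] by (cases x y rule: linorder_cases) auto
  qed simp
  moreover have "rotate1 as = map f as"
  proof -
    have "as = a # map (\<lambda>i. (f ^^ i) a) [1..<k]"
      unfolding as_def using k by (subst upt_conv_Cons) auto
    hence "rotate1 as = map (\<lambda>i. (f ^^ i) a) [1..<k] @ [(f ^^ k) a]" using k by simp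
    also have "\<dots> = map (\<lambda>i. (f ^^ i) a) [1..<Suc k]" using k by simp
    also have "\<dots> = map (\<lambda>i. (f ^^ Suc i) a) [0..<k]"
      by (simp add: map_Suc_upt[symmetric] comp_def del: upt_Suc)
    finally show ?thesis by (simp add: as_def comp_def)
  qed
  moreover have "set as \<subseteq> A" using inA aA by (auto simp: as_def)
  ultimately show ?thesis
    using that[of as] k f by (auto simp: as_def)
qed

lemma sum_list_map_rotate1: "sum_list (map f (rotate1 xs)) = sum_list (map f xs)"
  for f :: "'a \<Rightarrow> 'b::comm_monoid_add"
  by (cases xs) (auto simp: add.commute)

lemma sum_lookup_arc_vec:
  fixes g :: "nat \<Rightarrow> 'b::real_vector"
  assumes "finite U" "fst e \<in> U" "snd e \<in> U"
  shows "(\<Sum>v\<in>U. Poly_Mapping.lookup (arc_vec e) v *\<^sub>R g v) = g (fst e) - g (snd e)"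
proof -
  have "(\<Sum>v\<in>U. Poly_Mapping.lookup (arc_vec e) v *\<^sub>R g v) =
      (\<Sum>v\<in>U. if fst e = v then g v else 0) - (\<Sum>v\<in>U. if snd e = v then g v else 0)"
    unfolding sum_subtractf[symmetric] by (rule sum.cong[OF refl]) (simp add: lookup_arc_vec)
  then show ?thesis using assms by (simp add: sum.delta')
qed

locale arc_system =
  fixes D :: "(nat \<times> nat) set"
  assumes finite_D: "finite D" and loop_free: "e \<in> D \<Longrightarrow> fst e \<noteq> snd e"
begin

definition bd :: "(nat \<times> nat \<Rightarrow> real) \<Rightarrow> nat \<Rightarrow>\<^sub>0 real" where
  "bd r = (\<Sum>e\<in>D. r e *\<^sub>R arc_vec e)"

definition unit_circulation :: "(nat \<times> nat \<Rightarrow> real) \<Rightarrow> bool" where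
  "unit_circulation u \<longleftrightarrow> (\<forall>e\<in>D. u e \<in> {-1, 0, 1}) \<and> bd u = 0"

lemma bd_add: "bd (\<lambda>e. r e + s e) = bd r + bd s"
  by (simp add: bd_def scaleR_add_left sum.distrib)

lemma bd_diff: "bd (\<lambda>e. r e - s e) = bd r - bd s"
  by (simp add: bd_def scaleR_diff_left sum_subtractf)

lemma bd_scale: "bd (\<lambda>e. c * r e) = c *\<^sub>R bd r"
  by (simp add: bd_def scaleR_sum_right)

lemma bd_minus: "bd (\<lambda>e. - r e) = - bd r"
  by (simp add: bd_def sum_negf)

lemma bd_zero: "bd (\<lambda>e. 0) = 0"
  by (simp add: bd_def)

lemma bd_cong: "(\<And>e. e \<in> D \<Longrightarrow> r e = s e) \<Longrightarrow> bd r = bd s"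
  by (simp add: bd_def)

lemma bd_restrict:
  assumes "F \<subseteq> D" "\<And>e. e \<in> D - F \<Longrightarrow> r e = 0"
  shows "bd r = (\<Sum>e\<in>F. r e *\<^sub>R arc_vec e)"
  unfolding bd_def by (rule sum.mono_neutral_right) (use assms finite_D in auto)

text \<open>
  Summation by parts: a circulation is orthogonal to all potential differences.
\<close>

lemma circulation_potential:
  fixes \<phi> :: "nat \<Rightarrow> real"
  assumes "bd u = 0"
  shows "(\<Sum>e\<in>D. u e * (\<phi> (fst e) - \<phi> (snd e))) = 0"
proof -
  define U where "U = fst ` D \<union> snd ` D"
  have U: "finite U" using finite_D by (simp add: U_def)
  have arc: "(\<Sum>v\<in>U. \<phi> v * Poly_Mapping.lookup (arc_vec e) v) = \<phi> (fst e) - \<phi> (snd e)" if "e \<in> D" for e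
  proof -
    have "fst e \<in> U" "snd e \<in> U" using that by (simp_all add: U_def)
    from sum_lookup_arc_vec[OF U this, of \<phi>] show ?thesis by (simp only: real_scaleR_def mult.commute)
  qed
  have "0 = (\<Sum>v\<in>U. \<phi> v * Poly_Mapping.lookup (bd u) v)" by (simp add: assms)
  also have "\<dots> = (\<Sum>v\<in>U. \<Sum>e\<in>D. u e * (\<phi> v * Poly_Mapping.lookup (arc_vec e) v))"
    unfolding bd_def lookup_sum_scaleR sum_distrib_left by (simp only: mult.left_commute)
  also have "\<dots> = (\<Sum>e\<in>D. \<Sum>v\<in>U. u e * (\<phi> v * Poly_Mapping.lookup (arc_vec e) v))"
    by (rule sum.swap)
  also have "\<dots> = (\<Sum>e\<in>D. u e * (\<phi> (fst e) - \<phi> (snd e)))"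
    unfolding sum_distrib_left[symmetric] by (rule sum.cong[OF refl]) (simp add: arc)
  finally show ?thesis by simp
qed

text \<open>
  Orient every arc of the support of a circulation along the sign of its value. Conservation of flow
  gives each arc a successor, so the support contains a closed trail, whose signed indicator is a
  circulation again. This is where the total unimodularity of the arc vectors comes from.
\<close>

lemma conformal_trail:
  assumes "bd z = 0" "e0 \<in> D" "z e0 \<noteq> 0"
  obtains as where "as \<noteq> []" "distinct as" "set as \<subseteq> {e \<in> D. z e \<noteq> 0}"
    "map (\<lambda>e. if z e > 0 then fst e else snd e) (rotate1 as) =
       map (\<lambda>e. if z e > 0 then snd e else fst e) as"
proof -
  let ?t = "\<lambda>e. if z e > 0 then fst e else snd e"
  let ?h = "\<lambda>e. if z e > 0 then snd e else fst e"
  let ?A = "{e \<in> D. z e \<noteq> 0}"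
  have "\<exists>b\<in>?A. ?t b = ?h a" if a: "a \<in> ?A" for a
  proof (rule ccontr)
    assume no: "\<not> (\<exists>b\<in>?A. ?t b = ?h a)"
    define v where "v = ?h a"
    have 0: "(\<Sum>e\<in>D. z e * Poly_Mapping.lookup (arc_vec e) v) = 0"
      using arg_cong[OF \<open>bd z = 0\<close>, of "\<lambda>x. Poly_Mapping.lookup x v"]
      by (simp add: bd_def lookup_sum_scaleR)
    have le: "z e * Poly_Mapping.lookup (arc_vec e) v \<le> 0" if "e \<in> D" for e
    proof (cases "z e = 0")
      case False
      hence "?t e \<noteq> v" using no that v_def by blast
      then show ?thesis by (cases "z e > 0") (simp_all add: lookup_arc_vec mult_le_0_iff)
    qed simp
    have "z a * Poly_Mapping.lookup (arc_vec a) v < 0"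
      using a loop_free[of a] by (auto simp: lookup_arc_vec v_def mult_less_0_iff)
    hence "(\<Sum>e\<in>D. z e * Poly_Mapping.lookup (arc_vec e) v) < (\<Sum>e\<in>D. 0)"
      using a le by (intro sum_strict_mono_ex1) (use finite_D in auto)
    then show False using 0 by simp
  qed
  moreover have "finite ?A" "?A \<noteq> {}" using finite_D assms(2,3) by (simp, blast)
  ultimately show ?thesis
    using closed_trail_exists[of ?A ?t ?h] that by blast
qed

lemma conformal_circulation:
  assumes "bd z = 0" "e0 \<in> D" "z e0 \<noteq> 0"
  obtains u where "unit_circulation u" "\<And>e. e \<in> D \<Longrightarrow> u e \<noteq> 0 \<Longrightarrow> u e * z e > 0"
    "\<exists>e\<in>D. u e \<noteq> 0"
proof -
  obtain as where as: "as \<noteq> []" "distinct as" "set as \<subseteq> {e \<in> D. z e \<noteq> 0}"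
    and rot: "map (\<lambda>e. if z e > 0 then fst e else snd e) (rotate1 as) =
       map (\<lambda>e. if z e > 0 then snd e else fst e) as" (is "map ?t _ = map ?h _")
    using conformal_trail[OF assms] by blast
  define u where "u e = (if e \<in> set as then sgn (z e) else 0)" for e
  define s :: "nat \<Rightarrow> nat \<Rightarrow>\<^sub>0 real" where "s v = Poly_Mapping.single v 1" for v
  have "bd u = (\<Sum>e\<in>set as. u e *\<^sub>R arc_vec e)"
    by (rule bd_restrict) (use as in \<open>auto simp: u_def\<close>)
  also have "\<dots> = (\<Sum>e\<in>set as. s (?t e) - s (?h e))"
    by (rule sum.cong) (use as in \<open>auto simp: u_def sgn_if arc_vec_def s_def\<close>)
  also have "\<dots> = (\<Sum>e\<in>set as. s (?t e)) - (\<Sum>e\<in>set as. s (?h e))"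
    by (rule sum_subtractf)
  also have "(\<Sum>e\<in>set as. s (?h e)) = sum_list (map s (map ?h as))"
    using as(2) by (simp add: sum_list_distinct_conv_sum_set comp_def)
  also have "map ?h as = map ?t (rotate1 as)" by (rule rot[symmetric])
  also have "sum_list (map s (map ?t (rotate1 as))) = sum_list (map (\<lambda>e. s (?t e)) as)"
    by (simp only: map_map sum_list_map_rotate1 comp_def)
  also have "\<dots> = (\<Sum>e\<in>set as. s (?t e))"
    using as(2) by (simp add: sum_list_distinct_conv_sum_set)
  finally have "bd u = 0" by simp
  moreover have "\<exists>e\<in>D. u e \<noteq> 0"
    using as(1,3) by (intro bexI[of _ "hd as"]) (auto simp: u_def sgn_if dest!: hd_in_set)
  ultimately show ?thesis
    by (intro that[of u]) (auto simp: unit_circulation_def u_def sgn_if split: if_splits)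
qed

text \<open>
  Subtracting the largest conformal multiple of a trail shrinks the support, so a circulation is a
  nonnegative combination of conformal unit circulations. One of them therefore inherits the sign
  of any given linear functional.
\<close>

lemma conformal_circulation_functional:
  assumes "bd z = 0" "(\<Sum>e\<in>D. l e * z e) > 0"
  obtains u where "unit_circulation u" "\<And>e. e \<in> D \<Longrightarrow> u e \<noteq> 0 \<Longrightarrow> u e * z e > 0"
    "(\<Sum>e\<in>D. l e * u e) > 0"
proof -
  have "\<exists>u. unit_circulation u \<and> (\<forall>e\<in>D. u e \<noteq> 0 \<longrightarrow> u e * z e > 0) \<and> (\<Sum>e\<in>D. l e * u e) > 0"
    using assms
  proof (induction "card {e \<in> D. z e \<noteq> 0}" arbitrary: z rule: less_induct)
    case less
    obtain e0 where e0: "e0 \<in> D" "z e0 \<noteq> 0"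
      using less.prems(2) by (metis (no_types, lifting) mult_eq_0_iff order_less_irrefl sum.neutral)
    obtain u where u: "unit_circulation u" "\<And>e. e \<in> D \<Longrightarrow> u e \<noteq> 0 \<Longrightarrow> u e * z e > 0"
      "\<exists>e\<in>D. u e \<noteq> 0"
      using conformal_circulation[OF less.prems(1) e0] by blast
    have u1: "\<bar>u e\<bar> = 1" if "e \<in> D" "u e \<noteq> 0" for e
      using u(1) that by (auto simp: unit_circulation_def)
    show ?case
    proof (cases "(\<Sum>e\<in>D. l e * u e) > 0")
      case True
      then show ?thesis using u by blast
    next
      case False
      let ?S = "{e \<in> D. u e \<noteq> 0}"
      have S: "finite ?S" "?S \<noteq> {}" using finite_D u by auto
      \<comment> \<open>The largest multiple of u that can be subtracted from z without changing a sign.\<close>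
      define m where "m = Min ((\<lambda>e. \<bar>z e\<bar>) ` ?S)"
      have m_le: "m \<le> \<bar>z e\<bar>" if "e \<in> ?S" for e
        unfolding m_def by (rule Min_le) (use S that in auto)
      have "m \<in> (\<lambda>e. \<bar>z e\<bar>) ` ?S" unfolding m_def by (rule Min_in) (use S in auto)
      then obtain e1 where e1: "e1 \<in> D" "u e1 \<noteq> 0" "m = \<bar>z e1\<bar>" by auto
      have "m > 0" using e1 u(2)[of e1] by auto
      define z' where "z' e = z e - m * u e" for e
      have conf: "z' e = 0 \<or> z' e * z e > 0" if "e \<in> D" "z e \<noteq> 0" for e
      proof (cases "u e = 0")
        case True
        then show ?thesis using that by (simp add: z'_def flip: power2_eq_square)
      next
        case False
        from u1[OF that(1) False] consider "u e = 1" | "u e = -1" by linarith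
        then show ?thesis
        proof cases
          case 1
          hence "z e > 0" "m \<le> z e" using u(2)[OF that(1) False] m_le[of e] that False by auto
          then show ?thesis using 1 by (cases "z e = m") (auto simp: z'_def)
        next
          case 2
          hence "z e < 0" "m \<le> - z e" using u(2)[OF that(1) False] m_le[of e] that False by auto
          then show ?thesis using 2 by (cases "z e = - m") (auto simp: z'_def mult_neg_neg)
        qed
      qed
      have z0: "z' e = 0" if "e \<in> D" "z e = 0" for e
        using u(2)[OF that(1)] that by (auto simp: z'_def)
      have "z' e1 = 0"
        using u1[OF e1(1,2)] u(2)[OF e1(1,2)] e1(3) by (cases "u e1 = 1") (auto simp: z'_def abs_if split: if_splits)
      have "{e \<in> D. z' e \<noteq> 0} \<subset> {e \<in> D. z e \<noteq> 0}"
        using z0 e1 u(2)[OF e1(1,2)] \<open>z' e1 = 0\<close> by auto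
      hence "card {e \<in> D. z' e \<noteq> 0} < card {e \<in> D. z e \<noteq> 0}"
        by (intro psubset_card_mono) (use finite_D in auto)
      moreover have "bd z' = 0"
        using less.prems(1) u(1) by (simp add: z'_def[abs_def] bd_diff bd_scale unit_circulation_def)
      moreover have "(\<Sum>e\<in>D. l e * z' e) > 0"
      proof -
        have "(\<Sum>e\<in>D. l e * z' e) = (\<Sum>e\<in>D. l e * z e) - m * (\<Sum>e\<in>D. l e * u e)"
          by (simp add: z'_def algebra_simps sum_subtractf sum_distrib_left)
        moreover have "m * (\<Sum>e\<in>D. l e * u e) \<le> 0"
          using False \<open>m > 0\<close> by (simp add: mult_le_0_iff)
        ultimately show ?thesis using less.prems(2) by linarith
      qed
      ultimately obtain u' where u': "unit_circulation u'"
        "\<forall>e\<in>D. u' e \<noteq> 0 \<longrightarrow> u' e * z' e > 0" "(\<Sum>e\<in>D. l e * u' e) > 0"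
        using less.hyps by blast
      have "u' e * z e > 0" if "e \<in> D" "u' e \<noteq> 0" for e
      proof -
        have *: "u' e * z' e > 0" using u' that by blast
        hence "z' e \<noteq> 0" by auto
        hence "z' e * z e > 0" using conf[of e] z0[of e] that by auto
        then show ?thesis using * by (auto simp: zero_less_mult_iff)
      qed
      then show ?thesis using u' by blast
    qed
  qed
  then show ?thesis using that by blast
qed

end

section \<open>A unimodular fan on the arc vectors\<close>

text \<open>
  Powers growing faster than their partial sums separate all vectors with entries in
  \<open>{-1, 0, 1}\<close>; adding a large constant makes the number of arcs the dominating term.
\<close>

lemma separating_weights:
  assumes "finite D"
  shows "\<exists>t :: 'a \<Rightarrow> nat. \<forall>u :: 'a \<Rightarrow> real.
    (\<forall>e\<in>D. u e \<in> {-1, 0, 1}) \<longrightarrow> (\<exists>e\<in>D. u e \<noteq> 0) \<longrightarrow> (\<Sum>e\<in>D. real (t e) * u e) \<noteq> 0"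
  using assms
proof (induction D)
  case (insert x D)
  then obtain t :: "'a \<Rightarrow> nat" where t: "\<And>u :: 'a \<Rightarrow> real. (\<forall>e\<in>D. u e \<in> {-1, 0, 1}) \<Longrightarrow>
      (\<exists>e\<in>D. u e \<noteq> 0) \<Longrightarrow> (\<Sum>e\<in>D. real (t e) * u e) \<noteq> 0" by blast
  define t' where "t' = t(x := 1 + (\<Sum>e\<in>D. t e))"
  have "(\<Sum>e\<in>insert x D. real (t' e) * u e) \<noteq> 0"
    if u: "\<forall>e\<in>insert x D. u e \<in> {-1, 0, 1}" and ex: "\<exists>e\<in>insert x D. u e \<noteq> 0" for u :: "'a \<Rightarrow> real"
  proof -
    have "(\<Sum>e\<in>D. real (t' e) * u e) = (\<Sum>e\<in>D. real (t e) * u e)"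
      by (rule sum.cong) (use insert.hyps in \<open>auto simp: t'_def\<close>)
    hence eq: "(\<Sum>e\<in>insert x D. real (t' e) * u e) =
        (1 + (\<Sum>e\<in>D. real (t e))) * u x + (\<Sum>e\<in>D. real (t e) * u e)"
      using insert.hyps by (simp add: t'_def)
    have "\<bar>\<Sum>e\<in>D. real (t e) * u e\<bar> \<le> (\<Sum>e\<in>D. \<bar>real (t e) * u e\<bar>)" by (rule sum_abs)
    also have "\<dots> \<le> (\<Sum>e\<in>D. real (t e))"
      by (rule sum_mono) (use u in auto)
    finally have bound: "\<bar>\<Sum>e\<in>D. real (t e) * u e\<bar> \<le> (\<Sum>e\<in>D. real (t e))" .
    consider "u x = 0" | "u x = 1" | "u x = -1" using u by auto
    then show ?thesis
    proof cases
      case 1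
      then show ?thesis using eq t[of u] u ex by simp
    next
      case 2
      then show ?thesis using eq bound by (simp add: abs_le_iff)
    next
      case 3
      then show ?thesis using eq bound by (simp add: abs_le_iff)
    qed
  qed
  then show ?case by blast
qed simp

lemma length_dominated_separating_weights:
  assumes "finite D"
  shows "\<exists>w :: 'a \<Rightarrow> nat. \<forall>u :: 'a \<Rightarrow> real. (\<forall>e\<in>D. u e \<in> {-1, 0, 1}) \<longrightarrow>
    ((\<exists>e\<in>D. u e \<noteq> 0) \<longrightarrow> (\<Sum>e\<in>D. real (w e) * u e) \<noteq> 0) \<and>
    ((\<Sum>e\<in>D. u e) > 0 \<longrightarrow> (\<Sum>e\<in>D. real (w e) * u e) > 0)"
proof -
  obtain t :: "'a \<Rightarrow> nat" where t: "\<And>u :: 'a \<Rightarrow> real. (\<forall>e\<in>D. u e \<in> {-1, 0, 1}) \<Longrightarrow>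
      (\<exists>e\<in>D. u e \<noteq> 0) \<Longrightarrow> (\<Sum>e\<in>D. real (t e) * u e) \<noteq> 0"
    using separating_weights[OF assms] by blast
  \<comment> \<open>Larger than every possible absolute value of the sum over t, so the number of arcs decides
    the sign unless it is zero.\<close>
  define B where "B = 1 + (\<Sum>e\<in>D. t e)"
  define w where "w e = B + t e" for e
  have main: "((\<exists>e\<in>D. u e \<noteq> 0) \<longrightarrow> (\<Sum>e\<in>D. real (w e) * u e) \<noteq> 0) \<and>
    ((\<Sum>e\<in>D. u e) > 0 \<longrightarrow> (\<Sum>e\<in>D. real (w e) * u e) > 0)"
    if u: "\<forall>e\<in>D. u e \<in> {-1, 0, 1}" for u :: "'a \<Rightarrow> real"
  proof -
    have eq: "(\<Sum>e\<in>D. real (w e) * u e) = real B * (\<Sum>e\<in>D. u e) + (\<Sum>e\<in>D. real (t e) * u e)"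
      by (simp add: w_def algebra_simps sum.distrib sum_distrib_left)
    have "\<bar>\<Sum>e\<in>D. real (t e) * u e\<bar> \<le> (\<Sum>e\<in>D. \<bar>real (t e) * u e\<bar>)" by (rule sum_abs)
    also have "\<dots> \<le> (\<Sum>e\<in>D. real (t e))"
      by (rule sum_mono) (use u in auto)
    also have "\<dots> < real B" by (simp add: B_def)
    finally have bound: "\<bar>\<Sum>e\<in>D. real (t e) * u e\<bar> < real B" .
    have "(\<Sum>e\<in>D. u e) \<in> \<int>" by (rule Ints_sum) (use u in auto)
    then obtain k where k: "(\<Sum>e\<in>D. u e) = of_int k" by (auto elim: Ints_cases)
    have "k = 0 \<or> k \<ge> 1 \<or> k \<le> -1" by linarith
    hence "real_of_int k = 0 \<or> real_of_int k \<ge> 1 \<or> real_of_int k \<le> real_of_int (-1)"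
      by (simp only: of_int_eq_0_iff of_int_1_le_iff of_int_le_iff)
    then consider "(\<Sum>e\<in>D. u e) = 0" | "(\<Sum>e\<in>D. u e) \<ge> 1" | "(\<Sum>e\<in>D. u e) \<le> -1"
      unfolding k by auto
    then show ?thesis
    proof cases
      case 1
      show ?thesis unfolding eq 1 using t[OF u] by simp
    next
      case 2
      have "real B * 1 \<le> real B * (\<Sum>e\<in>D. u e)" by (rule mult_left_mono[OF 2]) simp
      hence "(\<Sum>e\<in>D. real (w e) * u e) > 0" using bound eq by linarith
      then show ?thesis by linarith
    next
      case 3
      have "real B * (\<Sum>e\<in>D. u e) \<le> real B * (-1)" by (rule mult_left_mono[OF 3]) simp
      hence "(\<Sum>e\<in>D. real (w e) * u e) < 0" using bound eq by linarith
      then show ?thesis using 3 by linarith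
    qed
  qed
  then show ?thesis by (intro exI[of _ w] allI impI) (rule main)
qed

lemma independent_card_le_dim_finite:
  fixes S T :: "'b::real_vector set"
  assumes "finite S" "T \<subseteq> span S" "independent T"
  shows "card T \<le> dim S"
proof -
  obtain B where B: "B \<subseteq> S" "independent B" "S \<subseteq> span B" "card B = dim S"
    using basis_exists[of S] by blast
  have "span S \<subseteq> span B" using B(3) by (simp add: span_minimal)
  then show ?thesis
    using independent_span_bound[of B T] B assms finite_subset by (metis order_trans)
qed

locale weighted_arc_system = arc_system +
  fixes w :: "nat \<times> nat \<Rightarrow> nat"
  assumes weight_nonzero:
      "unit_circulation u \<Longrightarrow> e \<in> D \<Longrightarrow> u e \<noteq> 0 \<Longrightarrow> (\<Sum>e\<in>D. real (w e) * u e) \<noteq> 0"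
    and weight_length:
      "unit_circulation u \<Longrightarrow> (\<Sum>e\<in>D. u e) > 0 \<Longrightarrow> (\<Sum>e\<in>D. real (w e) * u e) > 0"
begin

abbreviation weight :: "(nat \<times> nat \<Rightarrow> real) \<Rightarrow> real" where
  "weight u \<equiv> \<Sum>e\<in>D. real (w e) * u e"

text \<open>
  A unit circulation of positive weight describes an exchange that makes a representation cheaper:
  remove its positive arcs, insert its negative ones. A face is a set of arcs that offers no such
  exchange. In terms of toric ideals, the faces form the
  initial complex of the weight order, and it suffices to test unit circulations because the initial
  ideal is squarefree.
\<close>

definition face :: "(nat \<times> nat) set \<Rightarrow> bool" where
  "face F \<longleftrightarrow> F \<subseteq> D \<and>
     (\<forall>u. unit_circulation u \<longrightarrow> (\<forall>e\<in>D. u e = 1 \<longrightarrow> e \<in> F) \<longrightarrow> weight u \<le> 0)"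

lemma face_in_D: "face F \<Longrightarrow> F \<subseteq> D"
  by (simp add: face_def)

lemma face_subset: "face F \<Longrightarrow> G \<subseteq> F \<Longrightarrow> face G"
  unfolding face_def by (meson subset_iff subset_trans)

lemma finite_face: "face F \<Longrightarrow> finite F"
  using finite_D finite_subset by (auto simp: face_def)

lemma finite_faces: "finite {F. face F}"
  by (rule finite_subset[of _ "Pow D"]) (auto simp: face_def finite_D)

text \<open>
  The difference of two representations is a circulation. If it did not vanish, a conformal unit
  circulation of nonzero weight would be an exchange that is permitted by one of the two faces and
  makes the representation on this face cheaper.
\<close>

lemma face_rep_unique:
  assumes "face F" "face F'" "bd c = bd c'"
    and c: "\<And>e. e \<in> D \<Longrightarrow> c e \<ge> 0" "\<And>e. e \<in> D \<Longrightarrow> c e \<noteq> 0 \<Longrightarrow> e \<in> F"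
    and c': "\<And>e. e \<in> D \<Longrightarrow> c' e \<ge> 0" "\<And>e. e \<in> D \<Longrightarrow> c' e \<noteq> 0 \<Longrightarrow> e \<in> F'"
    and "e \<in> D"
  shows "c e = c' e"
proof (rule ccontr)
  assume ne: "c e \<noteq> c' e"
  have "bd (\<lambda>e. c e - c' e) = 0" using assms(3) by (simp add: bd_diff)
  then obtain u where u: "unit_circulation u" and conf: "\<And>e. e \<in> D \<Longrightarrow> u e \<noteq> 0 \<Longrightarrow> u e * (c e - c' e) > 0"
    and nz: "\<exists>e\<in>D. u e \<noteq> 0"
    using conformal_circulation[of "\<lambda>e. c e - c' e" e] ne \<open>e \<in> D\<close> by auto
  have "weight u \<noteq> 0" using weight_nonzero u nz by blast
  then consider "weight u > 0" | "weight u < 0" by linarith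
  then show False
  proof cases
    case 1
    have "f \<in> F" if "f \<in> D" "u f = 1" for f
      using conf[of f] c(2)[of f] c'(1)[of f] that by force
    with 1 u \<open>face F\<close> show False by (auto simp: face_def)
  next
    case 2
    have "f \<in> F'" if "f \<in> D" "u f = -1" for f
      using conf[of f] c'(2)[of f] c(1)[of f] that by force
    hence "\<forall>e\<in>D. - u e = 1 \<longrightarrow> e \<in> F'" by (auto simp: minus_equation_iff[of _ 1])
    moreover have "unit_circulation (\<lambda>e. - u e)"
      using u by (auto simp: unit_circulation_def bd_minus)
    ultimately have "weight (\<lambda>e. - u e) \<le> 0"
      using \<open>face F'\<close> unfolding face_def by blast
    then show False using 2 by (simp add: sum_negf)
  qed
qed

text \<open>
  Real competitors are allowed, so the integral representation of a lattice point can be compared with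
  the real one that witnesses membership in a dilate. Shortness holds because the weights give
  priority to the number of arcs.
\<close>

lemma face_rep_shortest:
  assumes "face F" "bd r = bd c"
    and c: "\<And>e. e \<in> D \<Longrightarrow> c e \<noteq> 0 \<Longrightarrow> e \<in> F" and r: "\<And>e. e \<in> D \<Longrightarrow> r e \<ge> 0"
  shows "(\<Sum>e\<in>D. c e) \<le> (\<Sum>e\<in>D. r e)"
proof (rule ccontr)
  assume "\<not> ?thesis"
  hence pos0: "(\<Sum>e\<in>D. 1 * (c e - r e)) > 0" by (simp add: sum_subtractf)
  have bd0: "bd (\<lambda>e. c e - r e) = 0" using assms(2) by (simp add: bd_diff)
  obtain u where u: "unit_circulation u"
    and conf: "\<And>e. e \<in> D \<Longrightarrow> u e \<noteq> 0 \<Longrightarrow> u e * (c e - r e) > 0"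
    and pos: "(\<Sum>e\<in>D. 1 * u e) > 0"
    using conformal_circulation_functional[OF bd0 pos0] by blast
  have "weight u > 0" using weight_length[OF u] pos by simp
  moreover have "f \<in> F" if "f \<in> D" "u f = 1" for f
    using conf[of f] c[of f] r[of f] that by force
  ultimately show False using u \<open>face F\<close> by (auto simp: face_def)
qed

definition arc_lattice :: "(nat \<Rightarrow>\<^sub>0 real) set" where
  "arc_lattice = range (\<lambda>c :: nat \<times> nat \<Rightarrow> nat. bd (\<lambda>e. real (c e)))"

definition standard_reps :: "(nat \<times> nat \<Rightarrow> nat) set" where
  "standard_reps = {c. (\<forall>e. e \<notin> D \<longrightarrow> c e = 0) \<and> face {e \<in> D. c e \<noteq> 0}}"

lemma standard_repsD:
  assumes "c \<in> standard_reps"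
  shows "face {e \<in> D. c e \<noteq> 0}" "e \<notin> D \<Longrightarrow> c e = 0"
proof -
  have *: "(\<forall>e. e \<notin> D \<longrightarrow> c e = 0) \<and> face {e \<in> D. c e \<noteq> 0}"
    using assms unfolding standard_reps_def mem_Collect_eq .
  show "face {e \<in> D. c e \<noteq> 0}" by (rule conjunct2[OF *])
  show "e \<notin> D \<Longrightarrow> c e = 0" using conjunct1[OF *] by metis
qed

text \<open>
  A representation of least weight is standard, since any exchange permitted by its support would
  reduce the weight further.
\<close>

lemma standard_rep_exists:
  assumes "x \<in> arc_lattice"
  obtains c where "c \<in> standard_reps" "bd (\<lambda>e. real (c e)) = x"
proof -
  define P where "P c \<longleftrightarrow> bd (\<lambda>e. real (c e)) = x" for c :: "nat \<times> nat \<Rightarrow> nat"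
  define m where "m c = (\<Sum>e\<in>D. w e * c e)" for c
  obtain c0 where "P c0" using assms by (auto simp: arc_lattice_def P_def)
  then obtain c where c: "P c" and least: "\<And>c'. P c' \<Longrightarrow> m c \<le> m c'"
    using ex_has_least_nat[of P c0 m] by blast
  have "face {e \<in> D. c e \<noteq> 0}" unfolding face_def
  proof (intro conjI allI impI)
    fix u assume u: "unit_circulation u" and sub: "\<forall>e\<in>D. u e = 1 \<longrightarrow> e \<in> {e \<in> D. c e \<noteq> 0}"
    define c' where "c' e = (if u e = 1 then c e - 1 else if u e = -1 then c e + 1 else c e)" for e
    have c': "real (c' e) = real (c e) - u e" if "e \<in> D" for e
    proof -
      have "u e \<in> {-1, 0, 1}" using u that by (simp add: unit_circulation_def)
      moreover have "c e \<ge> 1" if "u e = 1" using sub that \<open>e \<in> D\<close> by (auto simp: Suc_le_eq)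
      ultimately show ?thesis by (auto simp: c'_def of_nat_diff)
    qed
    have "bd (\<lambda>e. real (c' e)) = bd (\<lambda>e. real (c e) - u e)" by (rule bd_cong) (rule c')
    hence "P c'" using c u by (simp add: P_def bd_diff unit_circulation_def)
    hence "real (m c) \<le> real (m c')" using least by simp
    also have "real (m c') = real (m c) - weight u"
      by (simp add: m_def c' algebra_simps sum_subtractf)
    finally show "weight u \<le> 0" by simp
  qed auto
  moreover define c2 where "c2 e = (if e \<in> D then c e else 0)" for e
  have "{e \<in> D. c2 e \<noteq> 0} = {e \<in> D. c e \<noteq> 0}" by (auto simp: c2_def)
  moreover have "bd (\<lambda>e. real (c2 e)) = bd (\<lambda>e. real (c e))"
    by (rule bd_cong) (simp add: c2_def)
  ultimately show ?thesis using that[of c2] c by (simp add: standard_reps_def P_def c2_def)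
qed

lemma inj_on_bd_standard_reps: "inj_on (\<lambda>c. bd (\<lambda>e. real (c e))) standard_reps"
proof (rule inj_onI)
  fix c c' assume c: "c \<in> standard_reps" "c' \<in> standard_reps"
    and eq: "bd (\<lambda>e. real (c e)) = bd (\<lambda>e. real (c' e))"
  have "c e = c' e" for e
  proof (cases "e \<in> D")
    case True
    have "real (c e) = real (c' e)"
      by (rule face_rep_unique[of "{e \<in> D. c e \<noteq> 0}" "{e \<in> D. c' e \<noteq> 0}", OF _ _ eq])
        (use c True in \<open>auto simp: standard_reps_def\<close>)
    then show ?thesis by simp
  next
    case False
    have "\<forall>e. e \<notin> D \<longrightarrow> c e = 0" "\<forall>e. e \<notin> D \<longrightarrow> c' e = 0"
      using c unfolding standard_reps_def by blast+
    then show ?thesis using False by metis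
  qed
  then show "c = c'" by blast
qed

lemma face_coords_unique:
  assumes "face F" "bd a = bd b" "\<And>e. e \<notin> F \<Longrightarrow> a e = 0" "\<And>e. e \<notin> F \<Longrightarrow> b e = 0"
  shows "a = b"
proof (rule ext)
  fix e
  define z where "z e = a e - b e" for e
  show "a e = b e"
  proof (cases "e \<in> F")
    case True
    hence "e \<in> D" using face_in_D[OF assms(1)] by blast
    have "bd (\<lambda>e. max (z e) 0) - bd (\<lambda>e. max (- z e) 0) = bd z"
      unfolding bd_diff[symmetric] by (rule bd_cong) auto
    also have "\<dots> = 0" using assms(2) by (simp add: z_def[abs_def] bd_diff)
    finally have "bd (\<lambda>e. max (z e) 0) = bd (\<lambda>e. max (- z e) 0)" by simp
    moreover have "e \<in> F" if "z e \<noteq> 0" for e using assms(3)[of e] assms(4)[of e] that by (cases "e \<in> F") (simp_all add: z_def)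
    ultimately have "max (z e) 0 = max (- z e) 0"
      by (intro face_rep_unique[OF \<open>face F\<close> \<open>face F\<close>, of "\<lambda>e. max (z e) 0" "\<lambda>e. max (- z e) 0"])
        (auto simp: \<open>e \<in> D\<close> max_def split: if_splits)
    then show ?thesis by (auto simp: z_def max_def split: if_splits)
  qed (use assms in auto)
qed

lemma inj_on_arc_vec_D: "F \<subseteq> D \<Longrightarrow> inj_on arc_vec F"
  by (rule inj_on_subset[OF inj_on_arc_vec]) (use loop_free in auto)

lemma bd_in_span:
  assumes "F \<subseteq> D" "\<And>e. e \<in> D - F \<Longrightarrow> a e = 0"
  shows "bd a \<in> span (arc_vec ` F)"
proof -
  have "bd a = (\<Sum>e\<in>F. a e *\<^sub>R arc_vec e)" by (rule bd_restrict) (use assms in auto)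
  then show ?thesis by (simp add: span_sum span_scale span_base)
qed

lemma span_arc_vecD:
  assumes "F \<subseteq> D" "x \<in> span (arc_vec ` F)"
  obtains a where "\<And>e. e \<notin> F \<Longrightarrow> a e = 0" "bd a = x"
proof -
  have fin: "finite F" using assms finite_D finite_subset by blast
  obtain u where u: "x = (\<Sum>v\<in>arc_vec ` F. u v *\<^sub>R v)"
    using assms(2) fin by (auto simp: span_finite)
  define a where "a e = (if e \<in> F then u (arc_vec e) else 0)" for e
  have "bd a = (\<Sum>e\<in>F. a e *\<^sub>R arc_vec e)"
    by (rule bd_restrict) (use assms in \<open>auto simp: a_def\<close>)
  also have "\<dots> = x"
    unfolding u using assms(1) by (subst sum.reindex[OF inj_on_arc_vec_D]) (auto simp: a_def)
  finally show ?thesis using that[of a] by (simp add: a_def)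
qed

definition rank :: nat where "rank = dim (arc_vec ` D)"

text \<open>
  A linear relation between the arcs of a face splits into its positive and its negative part, which
  are two representations of the same point on this face.
\<close>

lemma face_independent: "face F \<Longrightarrow> independent (arc_vec ` F)"
proof
  assume F: "face F" and "dependent (arc_vec ` F)"
  have sub: "F \<subseteq> D" using F by (simp add: face_def)
  obtain v where v: "v \<in> F" "arc_vec v \<in> span (arc_vec ` F - {arc_vec v})"
    using \<open>dependent (arc_vec ` F)\<close> unfolding dependent_def by blast
  have "arc_vec ` F - {arc_vec v} \<subseteq> arc_vec ` (F - {v})" by auto
  hence "arc_vec v \<in> span (arc_vec ` (F - {v}))" using v span_mono by blast
  then obtain a where a: "\<And>e. e \<notin> F - {v} \<Longrightarrow> a e = 0" "bd a = arc_vec v"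
    by (rule span_arc_vecD[rotated]) (use sub in auto)
  define b where "b e = (if e = v then 1 else 0 :: real)" for e
  have "bd b = (\<Sum>e\<in>{v}. b e *\<^sub>R arc_vec e)"
    by (rule bd_restrict) (use v sub in \<open>auto simp: b_def\<close>)
  hence "bd a = bd b" using a by (simp add: b_def)
  hence "a = b" by (rule face_coords_unique[OF F]) (use a v in \<open>auto simp: b_def\<close>)
  then show False using a(1)[of v] by (simp add: b_def)
qed

lemma card_face_le_rank: "face F \<Longrightarrow> card F \<le> rank"
  using independent_card_le_dim_finite[of "arc_vec ` D" "arc_vec ` F"] face_independent[of F]
    inj_on_arc_vec_D[of F] finite_D
  by (auto simp: rank_def card_image face_def intro!: span_base)

lemma facet_span:
  assumes "face F" "card F = rank"
  shows "span (arc_vec ` F) = span (arc_vec ` D)"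
proof (rule ccontr)
  assume ne: "\<not> ?thesis"
  have sub: "F \<subseteq> D" using assms by (simp add: face_def)
  hence "\<exists>e\<in>D. arc_vec e \<notin> span (arc_vec ` F)"
  proof -
    have "span (arc_vec ` F) \<subseteq> span (arc_vec ` D)" using sub by (intro span_mono) auto
    hence "\<not> span (arc_vec ` D) \<subseteq> span (arc_vec ` F)" using ne by blast
    hence "\<not> arc_vec ` D \<subseteq> span (arc_vec ` F)" using span_minimal[of "arc_vec ` D"] subspace_span by blast
    then show ?thesis by blast
  qed
  then obtain e where e: "e \<in> D" "arc_vec e \<notin> span (arc_vec ` F)" by blast
  hence "independent (insert (arc_vec e) (arc_vec ` F))"
    using face_independent[OF assms(1)] by (simp add: independent_insert)
  moreover have "insert (arc_vec e) (arc_vec ` F) \<subseteq> span (arc_vec ` D)"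
    using sub e(1) by (auto intro!: span_base)
  ultimately have "card (insert (arc_vec e) (arc_vec ` F)) \<le> rank"
    unfolding rank_def by (intro independent_card_le_dim_finite) (use finite_D in auto)
  moreover have "arc_vec e \<notin> arc_vec ` F" using e(2) span_base[of "arc_vec e" "arc_vec ` F"] by metis
  moreover have "card (arc_vec ` F) = rank"
    using card_image[OF inj_on_arc_vec_D[OF sub]] assms(2) by simp
  ultimately show False using finite_face[OF assms(1)] by simp
qed

end

section \<open>Half-open decomposition of the fan\<close>

text \<open>
  If \<open>v\<close> avoids all the subspaces but the last one, move it by a vector \<open>u\<close> outside of the last one: the
  points \<open>u + k v\<close> stay outside of it, and each of the others contains at most one of them.
\<close>

lemma avoid_subspaces:
  fixes M :: "'b::real_vector set"
  assumes "finite \<V>" "\<And>V. V \<in> \<V> \<Longrightarrow> subspace V" "\<And>V. V \<in> \<V> \<Longrightarrow> \<exists>y\<in>M. y \<notin> V"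
    and "x0 \<in> M" and closed: "\<And>x y k. x \<in> M \<Longrightarrow> y \<in> M \<Longrightarrow> x + real k *\<^sub>R y \<in> M"
  shows "\<exists>v\<in>M. \<forall>V\<in>\<V>. v \<notin> V"
  using assms(1-3)
proof (induction \<V>)
  case empty
  then show ?case using assms(4) by blast
next
  case (insert V \<V>)
  then obtain v where v: "v \<in> M" "\<forall>V\<in>\<V>. v \<notin> V" by auto
  obtain u where u: "u \<in> M" "u \<notin> V" using insert.prems(2)[of V] by auto
  have subV: "subspace V" using insert.prems(1)[of V] by simp
  show ?case
  proof (cases "v \<in> V")
    case False
    then show ?thesis using v by auto
  next
    case True
    have "finite (\<Union>V'\<in>\<V>. {k :: nat. u + real k *\<^sub>R v \<in> V'})"
    proof (rule finite_UN_I[OF insert.hyps(1)])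
      fix V' assume V': "V' \<in> \<V>"
      have sub: "subspace V'" using insert.prems(1)[of V'] V' by simp
      have "k = l" if "u + real k *\<^sub>R v \<in> V'" "u + real l *\<^sub>R v \<in> V'" for k l :: nat
      proof (rule ccontr)
        assume "k \<noteq> l"
        have "(u + real k *\<^sub>R v) - (u + real l *\<^sub>R v) \<in> V'"
          by (rule subspace_diff[OF sub that])
        hence "(real k - real l) *\<^sub>R v \<in> V'" by (simp add: algebra_simps)
        hence "inverse (real k - real l) *\<^sub>R (real k - real l) *\<^sub>R v \<in> V'"
          by (rule subspace_scale[OF sub])
        then show False using v(2) V' \<open>k \<noteq> l\<close> by simp
      qed
      then show "finite {k :: nat. u + real k *\<^sub>R v \<in> V'}"
        unfolding finite_nat_set_iff_bounded_le by (metis order_refl mem_Collect_eq)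
    qed
    then obtain k :: nat where k: "k \<notin> (\<Union>V'\<in>\<V>. {k. u + real k *\<^sub>R v \<in> V'})"
      using ex_new_if_finite infinite_UNIV_nat by blast
    have "u + real k *\<^sub>R v \<notin> V"
    proof
      assume "u + real k *\<^sub>R v \<in> V"
      hence "(u + real k *\<^sub>R v) - real k *\<^sub>R v \<in> V"
        by (rule subspace_diff[OF subV _ subspace_scale[OF subV True]])
      then show False using u by simp
    qed
    then show ?thesis using k closed[OF u(1) v(1), of k] by auto
  qed
qed

context weighted_arc_system
begin

text \<open>
  Lattice points outside of the spans of all lower-dimensional faces. Such a point has no zero
  coordinate with respect to any facet.
\<close>

definition generic :: "(nat \<Rightarrow>\<^sub>0 real) \<Rightarrow> bool" where
  "generic v \<longleftrightarrow> v \<in> arc_lattice \<and>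
     (\<forall>F. face F \<longrightarrow> card F < rank \<longrightarrow> v \<notin> span (arc_vec ` F))"

lemma arc_lattice_combination:
  assumes "x \<in> arc_lattice" "y \<in> arc_lattice"
  shows "x + real k *\<^sub>R y \<in> arc_lattice"
proof -
  obtain c c' where "x = bd (\<lambda>e. real (c e))" "y = bd (\<lambda>e. real (c' e))"
    using assms by (auto simp: arc_lattice_def)
  hence "x + real k *\<^sub>R y = bd (\<lambda>e. real (c e + k * c' e))"
    by (simp add: bd_add bd_scale)
  then show ?thesis unfolding arc_lattice_def
    by (intro range_eqI[where x = "\<lambda>e. c e + k * c' e"]) simp
qed

lemma indicator_in_arc_lattice: "bd (indicator H) \<in> arc_lattice"
proof -
  have "bd (indicator H) = bd (\<lambda>e. real (indicator H e))"
    by (rule bd_cong) (simp add: indicator_def)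
  then show ?thesis unfolding arc_lattice_def by blast
qed

lemma bd_indicator_singleton: "e \<in> D \<Longrightarrow> bd (indicator {e}) = arc_vec e"
  by (subst bd_restrict[of "{e}"]) (auto simp: indicator_def)

lemma generic_exists: "\<exists>v. generic v"
proof -
  let ?\<V> = "(\<lambda>F. span (arc_vec ` F)) ` {F. face F \<and> card F < rank}"
  have "\<exists>v\<in>arc_lattice. \<forall>V\<in>?\<V>. v \<notin> V"
  proof (rule avoid_subspaces[OF _ _ _ indicator_in_arc_lattice])
    show "finite ?\<V>" using finite_subset[OF _ finite_faces] by auto
    show "subspace V" if "V \<in> ?\<V>" for V using that by auto
    show "\<exists>y\<in>arc_lattice. y \<notin> V" if V: "V \<in> ?\<V>" for V
    proof -
      obtain F where F: "face F" "card F < rank" "V = span (arc_vec ` F)" using V by blast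
      have "\<not> arc_vec ` D \<subseteq> span (arc_vec ` F)"
      proof
        assume "arc_vec ` D \<subseteq> span (arc_vec ` F)"
        hence "rank \<le> card (arc_vec ` F)" unfolding rank_def
          by (rule dim_le_card) (use finite_face F in auto)
        also have "\<dots> \<le> card F" by (rule card_image_le) (use finite_face F in auto)
        finally show False using F by simp
      qed
      then obtain e where "e \<in> D" "arc_vec e \<notin> V" using F by blast
      then show ?thesis using indicator_in_arc_lattice[of "{e}"] bd_indicator_singleton[of e] by metis
    qed
  qed (rule arc_lattice_combination)
  then show ?thesis unfolding generic_def by auto
qed

definition facets :: "(nat \<times> nat) set set" where
  "facets = {F. face F \<and> card F = rank}"

definition coords :: "(nat \<times> nat) set \<Rightarrow> (nat \<Rightarrow>\<^sub>0 real) \<Rightarrow> nat \<times> nat \<Rightarrow> real" where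
  "coords F x = (SOME a. (\<forall>e. e \<notin> F \<longrightarrow> a e = 0) \<and> bd a = x)"

text \<open>
  Moving a little from a point of the cone over \<open>F\<close> into direction \<open>v\<close> stays in this cone exactly if
  all the arcs of \<open>F\<close> along which \<open>v\<close> decreases are used at the point.
\<close>

definition restriction :: "(nat \<Rightarrow>\<^sub>0 real) \<Rightarrow> (nat \<times> nat) set \<Rightarrow> (nat \<times> nat) set" where
  "restriction v F = {e \<in> F. coords F v e < 0}"

lemma facetD: "F \<in> facets \<Longrightarrow> face F" "F \<in> facets \<Longrightarrow> card F = rank" "F \<in> facets \<Longrightarrow> F \<subseteq> D"
  "F \<in> facets \<Longrightarrow> finite F"
  by (auto simp: facets_def dest: face_in_D finite_face)

lemma finite_facets: "finite facets"
  by (rule finite_subset[OF _ finite_faces]) (auto simp: facets_def)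

lemma arc_lattice_span: "x \<in> arc_lattice \<Longrightarrow> x \<in> span (arc_vec ` D)"
  unfolding arc_lattice_def using bd_in_span[of D] by auto

lemma coords:
  assumes "F \<in> facets" "x \<in> span (arc_vec ` D)"
  shows "e \<notin> F \<Longrightarrow> coords F x e = 0" and "bd (coords F x) = x"
proof -
  have "x \<in> span (arc_vec ` F)" using assms facet_span facetD by metis
  then obtain a where "\<And>e. e \<notin> F \<Longrightarrow> a e = 0" "bd a = x"
    using span_arc_vecD[of F x] facetD assms by metis
  hence "\<exists>a. (\<forall>e. e \<notin> F \<longrightarrow> a e = 0) \<and> bd a = x" by blast
  from someI_ex[OF this]
  show "e \<notin> F \<Longrightarrow> coords F x e = 0" and "bd (coords F x) = x" unfolding coords_def by blast+
qed

lemma coords_eqI: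
  assumes "F \<in> facets" "\<And>e. e \<notin> F \<Longrightarrow> a e = 0" "bd a = x"
  shows "coords F x = a"
proof (rule face_coords_unique[OF facetD(1)[OF assms(1)]])
  have "x \<in> span (arc_vec ` D)" using bd_in_span[of D a] assms(3) by auto
  from coords[OF assms(1) this] show "bd (coords F x) = bd a" "e \<notin> F \<Longrightarrow> coords F x e = 0" for e
    using assms(3) by simp_all
qed (rule assms(2))

lemma coords_generic_nonzero:
  assumes "generic v" "F \<in> facets" "e \<in> F"
  shows "coords F v e \<noteq> 0"
proof
  assume z: "coords F v e = 0"
  have v: "v \<in> span (arc_vec ` D)" using assms(1) arc_lattice_span by (simp add: generic_def)
  have "bd (coords F v) \<in> span (arc_vec ` (F - {e}))"
  proof (rule bd_in_span)
    show "F - {e} \<subseteq> D" using facetD(3)[OF assms(2)] by blast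
    show "coords F v f = 0" if "f \<in> D - (F - {e})" for f
      using z coords(1)[OF assms(2) v, of f] that by blast
  qed
  moreover have "face (F - {e})" by (rule face_subset[OF facetD(1)[OF assms(2)]]) blast
  moreover have "card (F - {e}) < card F"
    by (rule card_Diff1_less[OF facetD(4)[OF assms(2)] assms(3)])
  hence "card (F - {e}) < rank" unfolding facetD(2)[OF assms(2)] .
  ultimately show False using assms(1) coords(2)[OF assms(2) v] by (simp add: generic_def)
qed

text \<open>
  For a lattice point \<open>x\<close> in the relative interior of the cone over \<open>H\<close>, the standard
  representations of \<open>N x + v\<close> use the same set \<open>F\<close> of arcs for infinitely many \<open>N\<close>. This set is the
  facet entered from \<open>x\<close> in direction \<open>v\<close>.
\<close>

lemma facet_in_direction:
  assumes v: "generic v" and H: "face H"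
  shows "\<exists>F\<in>facets. restriction v F \<subseteq> H \<and> H \<subseteq> F"
proof -
  \<comment> \<open>The sum of the arcs of H is a point in the relative interior of the cone over H.\<close>
  define x where "x = bd (indicator H)"
  have xL: "x \<in> arc_lattice" unfolding x_def by (rule indicator_in_arc_lattice)
  have vL: "v \<in> arc_lattice" using v by (simp add: generic_def)
  have "\<exists>c. c \<in> standard_reps \<and> bd (\<lambda>e. real (c e)) = v + real N *\<^sub>R x" for N
    using standard_rep_exists[OF arc_lattice_combination[OF vL xL]] by metis
  then obtain c where c: "\<And>N. c N \<in> standard_reps" "\<And>N. bd (\<lambda>e. real (c N e)) = v + real N *\<^sub>R x"
    by metis
  define f where "f N = {e \<in> D. c N e \<noteq> 0}" for N
  have f: "face (f N)" for N using standard_repsD(1)[OF c(1)] by (simp add: f_def)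
  have c0: "c N e = 0" if "e \<notin> f N" for N e
    using standard_repsD(2)[OF c(1), of e N] that by (cases "e \<in> D") (simp_all add: f_def)
  have "range f \<subseteq> {F. face F}" using f by blast
  hence "finite (range f)" using finite_faces finite_subset by metis
  from pigeonhole_infinite[OF infinite_UNIV_nat this]
  obtain N0 where inf: "infinite {N \<in> UNIV. f N = f N0}" by blast
  define F where "F = f N0"
  define I where "I = {N. f N = F}"
  have "infinite I" using inf by (simp add: I_def F_def)
  hence large: "\<exists>N\<in>I. N > m" for m by (meson infinite_nat_iff_unbounded)
  have FD: "F \<subseteq> D" using f face_in_D by (simp add: F_def)
  have in_span: "v + real N *\<^sub>R x \<in> span (arc_vec ` F)" if "N \<in> I" for N
    unfolding c(2)[symmetric] using that c0[of _ N] by (intro bd_in_span[OF FD]) (simp add: I_def)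
  obtain N1 where N1: "N1 \<in> I" using large by blast
  obtain N2 where N2: "N2 \<in> I" "N2 > N1" using large by blast
  have "(v + real N2 *\<^sub>R x) - (v + real N1 *\<^sub>R x) \<in> span (arc_vec ` F)"
    by (intro span_diff in_span N1 N2)
  hence "(real N2 - real N1) *\<^sub>R x \<in> span (arc_vec ` F)" by (simp add: algebra_simps)
  hence "inverse (real N2 - real N1) *\<^sub>R (real N2 - real N1) *\<^sub>R x \<in> span (arc_vec ` F)"
    by (rule span_scale)
  hence x_span: "x \<in> span (arc_vec ` F)" using N2 by simp
  have "(v + real N1 *\<^sub>R x) - real N1 *\<^sub>R x \<in> span (arc_vec ` F)"
    by (intro span_diff in_span N1 span_scale x_span)
  hence "v \<in> span (arc_vec ` F)" by simp
  hence "\<not> card F < rank" using v f by (auto simp: generic_def F_def)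
  hence facet: "F \<in> facets" using card_face_le_rank[of F] f[of N0] by (simp add: facets_def F_def)
  define a where "a = coords F v"
  define b where "b = coords F x"
  note coa = coords[OF facet arc_lattice_span[OF vL], folded a_def]
  note cob = coords[OF facet arc_lattice_span[OF xL], folded b_def]
  have ab: "real (c N e) = a e + real N * b e" if "N \<in> I" for N e
  proof -
    have "(\<lambda>e. real (c N e)) = (\<lambda>e. a e + real N * b e)"
    proof (rule face_coords_unique[OF facetD(1)[OF facet]])
      show "bd (\<lambda>e. real (c N e)) = bd (\<lambda>e. a e + real N * b e)"
        by (simp add: bd_add bd_scale c(2) coa(2) cob(2))
      show "real (c N e) = 0" if "e \<notin> F" for e using c0[of e N] that \<open>N \<in> I\<close> by (simp add: I_def)
    qed (use coa cob in auto)
    then show ?thesis by metis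
  qed
  \<comment> \<open>For large N the sign of a e + N * b e is decided by b e, unless b e = 0.\<close>
  have b_nonneg: "b e \<ge> 0" for e
  proof (rule ccontr)
    assume "\<not> b e \<ge> 0"
    hence neg: "b e < 0" by simp
    obtain m :: nat where m: "real m > a e / (- b e)" using reals_Archimedean2 by blast
    obtain N where N: "N \<in> I" "N > m" using large by blast
    hence "real N > a e / (- b e)" using m by linarith
    hence "real N * (- b e) > a e"
      using neg pos_divide_less_eq[of "- b e" "a e" "real N"] by linarith
    then show False using ab[OF N(1), of e] by (simp add: algebra_simps)
  qed
  have b: "b e = indicator H e" if "e \<in> D" for e
  proof (rule face_rep_unique[OF facetD(1)[OF facet] H])
    show "bd b = bd (indicator H)" by (simp add: cob(2) x_def)
    show "e \<in> F" if "b e \<noteq> 0" for e using cob(1)[of e] that by blast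
  qed (use b_nonneg that in \<open>auto simp: indicator_def split: if_splits\<close>)
  have "H \<subseteq> F"
  proof
    fix e assume e: "e \<in> H"
    hence "b e = 1" using b[OF subsetD[OF face_in_D[OF H] e]] by simp
    then show "e \<in> F" using cob(1)[of e] by force
  qed
  moreover have "restriction v F \<subseteq> H"
  proof
    fix e assume e: "e \<in> restriction v F"
    hence "a e < 0" "e \<in> F" by (simp_all add: restriction_def a_def)
    hence "e \<in> D" using FD by blast
    have "b e \<noteq> 0"
    proof
      assume "b e = 0"
      then show False using ab[OF N1, of e] \<open>a e < 0\<close> by simp
    qed
    then show "e \<in> H" unfolding b[OF \<open>e \<in> D\<close>] by (simp add: indicator_def split: if_splits)
  qed
  ultimately show ?thesis using facet by blast
qed

text \<open>
  If both facets contain the cone over \<open>H\<close> and both are entered in direction \<open>v\<close>, then a point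
  \<open>N x + v\<close> with large \<open>N\<close> has representations on both of them.
\<close>

lemma facet_in_direction_unique:
  assumes v: "generic v" and F: "F \<in> facets" "restriction v F \<subseteq> H" "H \<subseteq> F"
    and F': "F' \<in> facets" "restriction v F' \<subseteq> H" "H \<subseteq> F'"
  shows "F = F'"
proof -
  have vS: "v \<in> span (arc_vec ` D)" using v arc_lattice_span by (simp add: generic_def)
  note co = coords[OF F(1) vS] and co' = coords[OF F'(1) vS]
  obtain N :: nat where N: "\<And>e. e \<in> D \<Longrightarrow> \<bar>coords F v e\<bar> + \<bar>coords F' v e\<bar> \<le> real N"
  proof -
    obtain N :: nat where "(\<Sum>e\<in>D. \<bar>coords F v e\<bar> + \<bar>coords F' v e\<bar>) \<le> real N"
      using real_arch_simple by blast
    moreover have "\<bar>coords F v e\<bar> + \<bar>coords F' v e\<bar> \<le> (\<Sum>e\<in>D. \<bar>coords F v e\<bar> + \<bar>coords F' v e\<bar>)"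
      if "e \<in> D" for e
      using that finite_D by (intro member_le_sum) auto
    ultimately show ?thesis using that by (meson order_trans)
  qed
  have nonneg: "real N * indicator H e + coords G v e \<ge> 0"
    if "e \<in> D" "G = F \<or> G = F'" for e G
  proof (cases "e \<in> H")
    case True
    then show ?thesis using N[OF that(1)] that(2) by (auto simp: abs_if split: if_splits)
  next
    case False
    have "e \<notin> restriction v G" using False that(2) F(2) F'(2) by blast
    hence "e \<in> G \<Longrightarrow> coords G v e \<ge> 0" by (auto simp: restriction_def)
    moreover have "e \<notin> G \<Longrightarrow> coords G v e = 0" using that(2) co(1) co'(1) by blast
    ultimately show ?thesis using False by (cases "e \<in> G") auto
  qed
  have eq: "coords F v e = coords F' v e" if "e \<in> D" for e
  proof -
    have "real N * indicator H e + coords F v e = real N * indicator H e + coords F' v e"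
    proof (rule face_rep_unique[OF facetD(1)[OF F(1)] facetD(1)[OF F'(1)] _ _ _ _ _ that])
      show "bd (\<lambda>e. real N * indicator H e + coords F v e) = bd (\<lambda>e. real N * indicator H e + coords F' v e)"
        by (simp add: bd_add bd_scale co(2) co'(2))
      show "f \<in> F" if "real N * indicator H f + coords F v f \<noteq> 0" for f
        by (rule ccontr) (use that co(1)[of f] F(3) in \<open>auto simp: indicator_def split: if_splits\<close>)
      show "f \<in> F'" if "real N * indicator H f + coords F' v f \<noteq> 0" for f
        by (rule ccontr) (use that co'(1)[of f] F'(3) in \<open>auto simp: indicator_def split: if_splits\<close>)
    qed (use nonneg in auto)
    then show ?thesis by simp
  qed
  have inF: "e \<in> F \<longleftrightarrow> coords F v e \<noteq> 0" for e
    using coords_generic_nonzero[OF v F(1), of e] co(1)[of e] by blast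
  have inF': "e \<in> F' \<longleftrightarrow> coords F' v e \<noteq> 0" for e
    using coords_generic_nonzero[OF v F'(1), of e] co'(1)[of e] by blast
  show ?thesis
  proof (rule set_eqI)
    fix e
    show "e \<in> F \<longleftrightarrow> e \<in> F'"
    proof (cases "e \<in> D")
      case True
      then show ?thesis by (simp only: inF inF' eq)
    next
      case False
      then show ?thesis using subsetD[OF facetD(3)[OF F(1)]] subsetD[OF facetD(3)[OF F'(1)]] by metis
    qed
  qed
qed

definition h_count :: "(nat \<Rightarrow>\<^sub>0 real) \<Rightarrow> nat \<Rightarrow> nat" where
  "h_count v j = card {F \<in> facets. card (restriction v F) = j}"

lemma restriction_card_le: "F \<in> facets \<Longrightarrow> card (restriction v F) \<le> rank"
  using card_mono[OF facetD(4), of F "restriction v F"] facetD(2)[of F]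
  by (simp add: restriction_def subset_iff)

lemma h_count_above_rank: "j > rank \<Longrightarrow> h_count v j = 0"
proof -
  assume "j > rank"
  hence "{F \<in> facets. card (restriction v F) = j} = {}"
    using restriction_card_le[of _ v] by (auto simp: leD)
  then show ?thesis unfolding h_count_def by (simp only: card.empty)
qed

lemma sum_over_facets:
  "(\<Sum>F\<in>facets. g (card (restriction v F))) = (\<Sum>j\<le>rank. h_count v j * g j)" for g :: "nat \<Rightarrow> nat"
proof -
  have "(\<Sum>F\<in>facets. g (card (restriction v F))) =
      (\<Sum>j\<le>rank. \<Sum>F\<in>{F \<in> facets. card (restriction v F) = j}. g (card (restriction v F)))"
    by (rule sum.group[symmetric]) (use finite_facets restriction_card_le in auto)
  also have "\<dots> = (\<Sum>j\<le>rank. h_count v j * g j)"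
    by (simp add: h_count_def)
  finally show ?thesis .
qed

text \<open>In the opposite direction, the negative and the positive coordinates in every facet are exchanged.\<close>

lemma h_count_uminus:
  assumes "generic v" "generic (- v)" "j \<le> rank"
  shows "h_count (- v) j = h_count v (rank - j)"
proof -
  have vS: "v \<in> span (arc_vec ` D)" using assms arc_lattice_span by (simp add: generic_def)
  have R: "restriction (- v) F = F - restriction v F" if F: "F \<in> facets" for F
  proof -
    have "coords F (- v) = (\<lambda>e. - coords F v e)"
      using coords[OF F vS] by (intro coords_eqI[OF F]) (auto simp: bd_minus)
    then show ?thesis using coords_generic_nonzero[OF assms(1) F]
      by (force simp: restriction_def)
  qed
  have "card (restriction (- v) F) = j \<longleftrightarrow> card (restriction v F) = rank - j" if F: "F \<in> facets" for F
  proof -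
    have "restriction v F \<subseteq> F" by (auto simp: restriction_def)
    hence "card (restriction (- v) F) = rank - card (restriction v F)"
      using R[OF F] facetD(2,4)[OF F] card_Diff_subset[of "restriction v F" F] finite_subset by metis
    then show ?thesis using restriction_card_le[OF F, of v] assms(3) by linarith
  qed
  then show ?thesis unfolding h_count_def by (metis (mono_tags, lifting) Collect_cong)
qed

end

section \<open>Counting lattice points and faces\<close>

text \<open>
  The functions that vanish at a new point and those that are positive there are counted by the two
  terms of Pascal's recurrence.
\<close>

lemma card_functions_sum_le:
  assumes "finite F"
  shows "finite {c :: 'a \<Rightarrow> nat. (\<forall>x. x \<notin> F \<longrightarrow> c x = 0) \<and> sum c F \<le> m} \<and>
    card {c :: 'a \<Rightarrow> nat. (\<forall>x. x \<notin> F \<longrightarrow> c x = 0) \<and> sum c F \<le> m} = (m + card F) choose card F"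
    (is "finite (?S F m) \<and> card (?S F m) = _")
  using assms
proof (induction F arbitrary: m)
  case empty
  have "?S {} m = {\<lambda>_. 0}" by auto
  then show ?case by simp
next
  case (insert x F)
  show ?case
  proof (induction m)
    case 0
    have "?S (insert x F) 0 = {\<lambda>_. 0}" using insert.hyps by (auto simp: fun_eq_iff) metis
    then show ?case using insert.hyps by simp
  next
    case (Suc m)
    let ?up = "\<lambda>c :: 'a \<Rightarrow> nat. c(x := Suc (c x))"
    have sum_F: "sum (c(x := k)) F = sum c F" for c :: "'a \<Rightarrow> nat" and k
      by (rule sum.cong) (use insert.hyps(2) in auto)
    have sum_insert: "sum c (insert x F) = c x + sum c F" for c :: "'a \<Rightarrow> nat"
      using insert.hyps by (rule sum.insert)
    have eq: "?S (insert x F) (Suc m) = ?S F (Suc m) \<union> ?up ` ?S (insert x F) m"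
    proof (intro equalityI subsetI)
      fix c assume c: "c \<in> ?S (insert x F) (Suc m)"
      show "c \<in> ?S F (Suc m) \<union> ?up ` ?S (insert x F) m"
      proof (cases "c x")
        case 0
        hence "c \<in> ?S F (Suc m)" using c sum_insert[of c] by (auto) (metis)
        then show ?thesis by (rule UnI1)
      next
        case (Suc k)
        hence "c = ?up (c(x := k))" by auto
        moreover have "c(x := k) \<in> ?S (insert x F) m"
          using c Suc unfolding mem_Collect_eq sum_insert sum_F by simp
        ultimately have "c \<in> ?up ` ?S (insert x F) m" by (rule image_eqI)
        then show ?thesis by (rule UnI2)
      qed
    next
      fix c assume "c \<in> ?S F (Suc m) \<union> ?up ` ?S (insert x F) m"
      then show "c \<in> ?S (insert x F) (Suc m)"
      proof
        assume "c \<in> ?S F (Suc m)"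
        then show ?thesis unfolding mem_Collect_eq sum_insert using insert.hyps(2) by simp
      next
        assume "c \<in> ?up ` ?S (insert x F) m"
        then obtain c' where "c = ?up c'" "c' \<in> ?S (insert x F) m" by (rule imageE)
        then show ?thesis unfolding mem_Collect_eq sum_insert by (simp only: sum_F) simp
      qed
    qed
    have disj: "?S F (Suc m) \<inter> ?up ` ?S (insert x F) m = {}"
    proof (rule equals0I)
      fix c assume c: "c \<in> ?S F (Suc m) \<inter> ?up ` ?S (insert x F) m"
      have "c x = 0" using c insert.hyps(2) by simp
      moreover have "c x \<noteq> 0" using c by auto
      ultimately show False by simp
    qed
    have inj: "inj_on ?up (?S (insert x F) m)"
    proof (rule inj_onI)
      fix c c' :: "'a \<Rightarrow> nat" assume "?up c = ?up c'"
      hence "(?up c) y = (?up c') y" for y by simp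
      hence "c y = c' y" for y by (metis fun_upd_apply nat.inject)
      then show "c = c'" by blast
    qed
    have fin: "finite (?S F (Suc m))" "finite (?up ` ?S (insert x F) m)"
      by (rule conjunct1[OF insert.IH], rule finite_imageI[OF conjunct1[OF Suc.IH]])
    have "card (?S (insert x F) (Suc m)) = card (?S F (Suc m)) + card (?up ` ?S (insert x F) m)"
      unfolding eq by (rule card_Un_disjoint[OF fin disj])
    also have "\<dots> = ((Suc m + card F) choose card F) + ((m + card (insert x F)) choose card (insert x F))"
      by (simp only: card_image[OF inj] conjunct2[OF Suc.IH] conjunct2[OF insert.IH])
    also have "\<dots> = (Suc m + card (insert x F)) choose card (insert x F)"
      using insert.hyps by simp
    finally have "card (?S (insert x F) (Suc m)) = (Suc m + card (insert x F)) choose card (insert x F)" .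
    moreover have "finite (?S (insert x F) (Suc m))" unfolding eq using fin by (rule finite_UnI)
    ultimately show ?case by (rule conjI[rotated])
  qed
qed

lemma card_half_open_sum_le:
  assumes "finite F" "R \<subseteq> F"
  shows "finite {c :: 'a \<Rightarrow> nat. (\<forall>x. x \<notin> F \<longrightarrow> c x = 0) \<and> (\<forall>x\<in>R. 1 \<le> c x) \<and> sum c F \<le> m}"
    (is "finite ?T")
    and "card {c :: 'a \<Rightarrow> nat. (\<forall>x. x \<notin> F \<longrightarrow> c x = 0) \<and> (\<forall>x\<in>R. 1 \<le> c x) \<and> sum c F \<le> m} =
      (m + card F - card R) choose card F"
proof -
  let ?S = "\<lambda>m. {c :: 'a \<Rightarrow> nat. (\<forall>x. x \<notin> F \<longrightarrow> c x = 0) \<and> sum c F \<le> m}"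
  show "finite ?T"
    by (rule finite_subset[of _ "?S m"]) (use card_functions_sum_le[OF assms(1)] in auto)
  have R: "card R \<le> card F" using assms card_mono by blast
  have sumR: "(\<Sum>x\<in>F. if x \<in> R then 1 else 0 :: nat) = card R"
    using assms by (simp add: sum.If_cases Int_absorb1)
  show "card ?T = (m + card F - card R) choose card F"
  proof (cases "card R \<le> m")
    case True
    let ?up = "\<lambda>(c :: 'a \<Rightarrow> nat) x. c x + (if x \<in> R then 1 else 0)"
    have "?T = ?up ` ?S (m - card R)"
    proof (intro equalityI subsetI)
      fix c assume c: "c \<in> ?T"
      define c' where "c' x = c x - (if x \<in> R then 1 else 0)" for x
      have up: "c = ?up c'" using c by (fastforce simp: c'_def)
      have "sum c F = sum c' F + card R"
        by (subst up) (simp only: sum.distrib sumR)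
      hence "c' \<in> ?S (m - card R)" using c True by (auto simp: c'_def)
      then show "c \<in> ?up ` ?S (m - card R)" using up by blast
    next
      fix c assume "c \<in> ?up ` ?S (m - card R)"
      then obtain c' where c': "c' \<in> ?S (m - card R)" "c = ?up c'" by blast
      have "sum c F = sum c' F + card R"
        by (subst c'(2)) (simp only: sum.distrib sumR)
      then show "c \<in> ?T" using c' True assms(2) by auto
    qed
    moreover have "inj ?up" by (rule injI) (simp add: fun_eq_iff)
    ultimately have "card ?T = card (?S (m - card R))"
      by (simp add: card_image inj_on_subset)
    then show ?thesis using card_functions_sum_le[OF assms(1), of "m - card R"] True by simp
  next
    case False
    have empty: "?T = {}"
    proof (rule equals0I)
      fix c assume "c \<in> ?T"
      hence c: "\<And>x. x \<in> R \<Longrightarrow> 1 \<le> c x" "sum c F \<le> m" by simp_all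
      have "card R = (\<Sum>x\<in>R. 1)" by simp
      also have "\<dots> \<le> sum c R" by (rule sum_mono) (rule c(1))
      also have "\<dots> \<le> sum c F" using assms by (intro sum_mono2) simp_all
      finally show False using c(2) False by (metis order_trans)
    qed
    have "card ?T = 0" unfolding empty by (rule card.empty)
    have "m < card R" using False by (rule not_le_imp_less)
    have "i < j \<Longrightarrow> j \<le> k \<Longrightarrow> i + k - j < k" for i j k :: nat by arith
    hence "m + card F - card R < card F" using \<open>m < card R\<close> R by metis
    then show ?thesis using \<open>card ?T = 0\<close> by (simp only: binomial_eq_0)
  qed
qed

lemma card_interval_subsets:
  assumes "finite F" "R \<subseteq> F"
  shows "card {H. R \<subseteq> H \<and> H \<subseteq> F \<and> card H = i} =
    (if card R \<le> i then (card F - card R) choose (i - card R) else 0)"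
proof (cases "card R \<le> i")
  case True
  have finR: "finite R" using assms finite_subset by blast
  have "bij_betw (\<lambda>B. R \<union> B) {B. B \<subseteq> F - R \<and> card B = i - card R} {H. R \<subseteq> H \<and> H \<subseteq> F \<and> card H = i}"
  proof (rule bij_betwI[where g = "\<lambda>H. H - R"])
    show "(\<lambda>B. R \<union> B) \<in> {B. B \<subseteq> F - R \<and> card B = i - card R} \<rightarrow> {H. R \<subseteq> H \<and> H \<subseteq> F \<and> card H = i}"
    proof
      fix B assume B: "B \<in> {B. B \<subseteq> F - R \<and> card B = i - card R}"
      hence "card (R \<union> B) = card R + card B"
        by (intro card_Un_disjoint finR finite_subset[of B F] assms(1)) auto
      then show "R \<union> B \<in> {H. R \<subseteq> H \<and> H \<subseteq> F \<and> card H = i}" using B True assms(2) by auto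
    qed
    show "(\<lambda>H. H - R) \<in> {H. R \<subseteq> H \<and> H \<subseteq> F \<and> card H = i} \<rightarrow> {B. B \<subseteq> F - R \<and> card B = i - card R}"
      using finR by (auto simp: card_Diff_subset)
  qed auto
  hence "card {H. R \<subseteq> H \<and> H \<subseteq> F \<and> card H = i} = card {B. B \<subseteq> F - R \<and> card B = i - card R}"
    using bij_betw_same_card by fastforce
  also have "\<dots> = (card F - card R) choose (i - card R)"
    using assms finR by (simp add: n_subsets card_Diff_subset)
  finally show ?thesis using True by simp
next
  case False
  have "{H. R \<subseteq> H \<and> H \<subseteq> F \<and> card H = i} = {}"
    using False card_mono[OF finite_subset[OF _ assms(1)]] by auto
  then show ?thesis using False by (simp only: card.empty if_False)
qed

context weighted_arc_system
begin

lemma restriction_subset: "restriction v F \<subseteq> F"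
  by (auto simp: restriction_def)

text \<open>
  The supports of the standard representations in the half-open cone of \<open>F\<close> lie between
  \<open>restriction v F\<close> and \<open>F\<close>. Every half-open cone contributes a single binomial
  coefficient.
\<close>

lemma card_standard_reps:
  assumes v: "generic v"
  shows "card {c \<in> standard_reps. sum c D \<le> m} =
    (\<Sum>j\<le>rank. h_count v j * ((m + rank - j) choose rank))"
proof -
  define A where "A F = {c :: nat \<times> nat \<Rightarrow> nat. (\<forall>e. e \<notin> F \<longrightarrow> c e = 0) \<and>
    (\<forall>e\<in>restriction v F. 1 \<le> c e) \<and> sum c F \<le> m}" for F
  have AD: "\<forall>e. e \<notin> F \<longrightarrow> c e = 0" "\<forall>e\<in>restriction v F. 1 \<le> c e" "sum c F \<le> m" if "c \<in> A F" for c F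
  proof -
    from that have *: "(\<forall>e. e \<notin> F \<longrightarrow> c e = 0) \<and> (\<forall>e\<in>restriction v F. 1 \<le> c e) \<and> sum c F \<le> m"
      unfolding A_def mem_Collect_eq .
    from * show "\<forall>e. e \<notin> F \<longrightarrow> c e = 0" by (rule conjunct1)
    from * show "\<forall>e\<in>restriction v F. 1 \<le> c e" by (elim conjE)
    from * show "sum c F \<le> m" by (elim conjE)
  qed
  have AI: "c \<in> A F" if "\<forall>e. e \<notin> F \<longrightarrow> c e = 0" "\<forall>e\<in>restriction v F. 1 \<le> c e" "sum c F \<le> m" for c F
    unfolding A_def mem_Collect_eq using that by (intro conjI)
  have sumD: "sum c D = sum c F" if "F \<in> facets" "\<forall>e. e \<notin> F \<longrightarrow> c e = 0" for c :: "nat \<times> nat \<Rightarrow> nat" and F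
    by (rule sum.mono_neutral_right[OF finite_D facetD(3)[OF that(1)]]) (use that(2) in blast)
  have supp: "restriction v F \<subseteq> {e \<in> D. c e \<noteq> 0} \<and> {e \<in> D. c e \<noteq> 0} \<subseteq> F"
    if "F \<in> facets" "c \<in> A F" for c F
  proof
    show "restriction v F \<subseteq> {e \<in> D. c e \<noteq> 0}"
    proof
      fix e assume e: "e \<in> restriction v F"
      hence "e \<in> D" using restriction_subset facetD(3)[OF that(1)] by blast
      moreover have "1 \<le> c e" using bspec[OF AD(2)[OF that(2)] e] .
      ultimately show "e \<in> {e \<in> D. c e \<noteq> 0}" by simp
    qed
    show "{e \<in> D. c e \<noteq> 0} \<subseteq> F"
    proof
      fix e assume "e \<in> {e \<in> D. c e \<noteq> 0}"
      then show "e \<in> F" using AD(1)[OF that(2)] by (metis (mono_tags, lifting) mem_Collect_eq)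
    qed
  qed
  have eq: "{c \<in> standard_reps. sum c D \<le> m} = (\<Union>F\<in>facets. A F)"
  proof (intro equalityI subsetI)
    fix c assume "c \<in> {c \<in> standard_reps. sum c D \<le> m}"
    hence c: "c \<in> standard_reps" "sum c D \<le> m" by auto
    obtain F where F: "F \<in> facets" "restriction v F \<subseteq> {e \<in> D. c e \<noteq> 0}" "{e \<in> D. c e \<noteq> 0} \<subseteq> F"
      using facet_in_direction[OF v standard_repsD(1)[OF c(1)]] by blast
    have off: "\<forall>e. e \<notin> F \<longrightarrow> c e = 0"
    proof (intro allI impI)
      fix e assume e: "e \<notin> F"
      show "c e = 0"
      proof (rule ccontr)
        assume ne: "c e \<noteq> 0"
        hence "e \<in> D" using standard_repsD(2)[OF c(1), of e] by metis
        then show False using ne e F(3) by (metis (mono_tags, lifting) mem_Collect_eq subsetD)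
      qed
    qed
    have "\<forall>e\<in>restriction v F. 1 \<le> c e" using F(2) by (auto simp: Suc_le_eq)
    hence "c \<in> A F" using c(2) sumD[OF F(1) off] by (intro AI off) simp_all
    then show "c \<in> (\<Union>F\<in>facets. A F)" by (rule UN_I[OF F(1)])
  next
    fix c assume "c \<in> (\<Union>F\<in>facets. A F)"
    then obtain F where F: "F \<in> facets" "c \<in> A F" by (rule UN_E)
    note off = AD(1)[OF F(2)] and le = AD(3)[OF F(2)]
    have "face {e \<in> D. c e \<noteq> 0}"
      by (rule face_subset[OF facetD(1)[OF F(1)] conjunct2[OF supp[OF F]]])
    moreover have "\<forall>e. e \<notin> D \<longrightarrow> c e = 0" using off subsetD[OF facetD(3)[OF F(1)]] by metis
    ultimately have "c \<in> standard_reps" unfolding standard_reps_def mem_Collect_eq by (intro conjI)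
    then show "c \<in> {c \<in> standard_reps. sum c D \<le> m}" using sumD[OF F(1) off] le by simp
  qed
  have disj: "A F \<inter> A F' = {}" if "F \<in> facets" "F' \<in> facets" "F \<noteq> F'" for F F'
  proof (rule ccontr)
    assume "A F \<inter> A F' \<noteq> {}"
    then obtain c where c: "c \<in> A F" "c \<in> A F'" by blast
    have "F = F'"
      by (rule facet_in_direction_unique[OF v, of _ "{e \<in> D. c e \<noteq> 0}"])
        (use supp[OF that(1) c(1)] supp[OF that(2) c(2)] that in metis)+
    then show False using that by blast
  qed
  have cardA: "finite (A F)" "card (A F) = (m + rank - card (restriction v F)) choose rank" if "F \<in> facets" for F
    using card_half_open_sum_le[OF facetD(4)[OF that] restriction_subset, of v m] facetD(2)[OF that]
    by (simp_all add: A_def)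
  have "card (\<Union>F\<in>facets. A F) = (\<Sum>F\<in>facets. card (A F))"
    by (rule card_UN_disjoint) (use finite_facets cardA disj in auto)
  also have "\<dots> = (\<Sum>F\<in>facets. (m + rank - card (restriction v F)) choose rank)"
    by (rule sum.cong) (use cardA in auto)
  also have "\<dots> = (\<Sum>j\<le>rank. h_count v j * ((m + rank - j) choose rank))"
    by (rule sum_over_facets)
  finally show ?thesis unfolding eq .
qed

definition f_count :: "nat \<Rightarrow> nat" where
  "f_count i = card {H. face H \<and> card H = i}"

lemma f_count_eq_h_count_sum:
  assumes v: "generic v"
  shows "f_count i = (\<Sum>j\<le>rank. h_count v j * (if j \<le> i then (rank - j) choose (i - j) else 0))"
proof -
  define A where "A F = {H. restriction v F \<subseteq> H \<and> H \<subseteq> F \<and> card H = i}" for F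
  have eq: "{H. face H \<and> card H = i} = (\<Union>F\<in>facets. A F)"
  proof (intro equalityI subsetI)
    fix H assume H: "H \<in> {H. face H \<and> card H = i}"
    then obtain F where "F \<in> facets" "restriction v F \<subseteq> H \<and> H \<subseteq> F"
      using facet_in_direction[OF v, of H] by blast
    then show "H \<in> (\<Union>F\<in>facets. A F)" using H by (auto simp: A_def)
  next
    fix H assume "H \<in> (\<Union>F\<in>facets. A F)"
    then obtain F where F: "F \<in> facets" "H \<subseteq> F" "card H = i" by (auto simp: A_def)
    then show "H \<in> {H. face H \<and> card H = i}" using face_subset[OF facetD(1)[OF F(1)]] by simp
  qed
  have disj: "A F \<inter> A F' = {}" if "F \<in> facets" "F' \<in> facets" "F \<noteq> F'" for F F'
  proof (rule ccontr)
    assume "A F \<inter> A F' \<noteq> {}"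
    then obtain H where H: "H \<in> A F" "H \<in> A F'" by blast
    have "F = F'"
      by (rule facet_in_direction_unique[OF v, of _ H]) (use H that in \<open>simp_all add: A_def\<close>)
    then show False using that by blast
  qed
  have "card (\<Union>F\<in>facets. A F) = (\<Sum>F\<in>facets. card (A F))"
  proof (rule card_UN_disjoint)
    show "\<forall>F\<in>facets. finite (A F)"
      using facetD(4) by (auto simp: A_def intro: finite_subset[of _ "Pow _"])
  qed (use finite_facets disj in auto)
  also have "\<dots> = (\<Sum>F\<in>facets. if card (restriction v F) \<le> i
      then (rank - card (restriction v F)) choose (i - card (restriction v F)) else 0)"
  proof (rule sum.cong)
    fix F assume F: "F \<in> facets"
    show "card (A F) = (if card (restriction v F) \<le> i
      then (rank - card (restriction v F)) choose (i - card (restriction v F)) else 0)"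
      unfolding A_def card_interval_subsets[OF facetD(4)[OF F] restriction_subset]
      by (simp only: facetD(2)[OF F])
  qed simp
  also have "\<dots> = (\<Sum>j\<le>rank. h_count v j * (if j \<le> i then (rank - j) choose (i - j) else 0))"
    by (rule sum_over_facets)
  finally show ?thesis unfolding f_count_def eq .
qed

end

section \<open>Uniqueness of h-star vectors and gamma-vectors\<close>

text \<open>
  Evaluating at \<open>m = 0, 1, \<dots>, d\<close> gives a triangular system with ones on the diagonal.
\<close>

lemma binomial_basis_unique:
  fixes h h' :: "nat \<Rightarrow> int"
  assumes "\<And>j. j > d \<Longrightarrow> h j = 0" "\<And>j. j > d \<Longrightarrow> h' j = 0"
    and eq: "\<And>m. (\<Sum>j\<le>d. h j * int ((m + d - j) choose d)) = (\<Sum>j\<le>d. h' j * int ((m + d - j) choose d))"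
  shows "h = h'"
proof
  fix j
  show "h j = h' j"
  proof (induction j rule: less_induct)
    case (less j)
    show ?case
    proof (cases "j \<le> d")
      case True
      have split: "(\<Sum>i\<le>d. g i * int ((j + d - i) choose d)) =
          g j + (\<Sum>i<j. g i * int ((j + d - i) choose d))" for g :: "nat \<Rightarrow> int"
      proof -
        have "(\<Sum>i\<le>d. g i * int ((j + d - i) choose d)) = (\<Sum>i\<le>j. g i * int ((j + d - i) choose d))"
        proof (rule sum.mono_neutral_right)
          show "\<forall>i\<in>{..d} - {..j}. g i * int ((j + d - i) choose d) = 0"
            by (auto intro!: binomial_eq_0)
        qed (use True in auto)
        then show ?thesis by (simp add: lessThan_Suc_atMost[symmetric])
      qed
      have "(\<Sum>i<j. h i * int ((j + d - i) choose d)) = (\<Sum>i<j. h' i * int ((j + d - i) choose d))"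
        by (rule sum.cong) (use less in auto)
      then show ?thesis using eq[of j] by (simp only: split)
    qed (use assms in auto)
  qed
qed

lemma coeff_one_plus_x_power: "coeff ([:1, 1:] ^ k :: int poly) j = int (k choose j)"
proof (cases "j \<le> k")
  case True
  then show ?thesis by (simp add: coeff_linear_poly_power)
next
  case False
  then show ?thesis by (simp add: coeff_eq_0 degree_linear_power binomial_eq_0)
qed

lemma coeff_gamma_expansion:
  fixes g :: "nat \<Rightarrow> int"
  shows "coeff (\<Sum>i\<le>d div 2. monom (g i) i * [:1, 1:] ^ (d - 2 * i)) l =
    (\<Sum>i\<le>d div 2. g i * (if i \<le> l then int ((d - 2 * i) choose (l - i)) else 0))"
  unfolding coeff_sum
proof (rule sum.cong[OF refl])
  fix i
  show "coeff (monom (g i) i * [:1, 1:] ^ (d - 2 * i)) l =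
      g i * (if i \<le> l then int ((d - 2 * i) choose (l - i)) else 0)"
    unfolding coeff_monom_mult coeff_one_plus_x_power by (cases "i \<le> l") simp_all
qed

lemma gamma_expansion_split:
  fixes g :: "nat \<Rightarrow> int"
  assumes "l \<le> d div 2"
  shows "(\<Sum>i\<le>d div 2. g i * (if i \<le> l then int ((d - 2 * i) choose (l - i)) else 0)) =
    g l + (\<Sum>i<l. g i * int ((d - 2 * i) choose (l - i)))"
proof -
  have "(\<Sum>i\<le>d div 2. g i * (if i \<le> l then int ((d - 2 * i) choose (l - i)) else 0)) =
      (\<Sum>i\<le>l. g i * int ((d - 2 * i) choose (l - i)))"
    by (rule sum.mono_neutral_cong_right) (use assms in auto)
  then show ?thesis by (simp add: lessThan_Suc_atMost[symmetric])
qed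

fun gamma_from_h :: "nat \<Rightarrow> (nat \<Rightarrow> int) \<Rightarrow> nat \<Rightarrow> int" where
  "gamma_from_h d h l = h l - (\<Sum>i<l. gamma_from_h d h i * int ((d - 2 * i) choose (l - i)))"

declare gamma_from_h.simps [simp del]

lemma coeff_sum_monom: "coeff (\<Sum>j\<le>d. monom (h j) j) l = (if l \<le> d then h l else 0)"
  for h :: "nat \<Rightarrow> int"
  by (simp add: coeff_sum coeff_monom)

text \<open>
  The coefficients up to index \<open>d div 2\<close> form a triangular system. Both sides of the defining
  equation are palindromic, which takes care of the other half of the coefficients.
\<close>

lemma gamma_expansion_palindromic:
  fixes h :: "nat \<Rightarrow> int"
  assumes pal: "\<And>j. j \<le> d \<Longrightarrow> h j = h (d - j)"
  shows "(\<forall>i>d div 2. g i = 0) \<and>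
    (\<Sum>i\<le>d div 2. monom (g i) i * [:1, 1:] ^ (d - 2 * i)) = (\<Sum>j\<le>d. monom (h j) j)
    \<longleftrightarrow> g = (\<lambda>i. if i \<le> d div 2 then gamma_from_h d h i else 0)"
    (is "?zero g \<and> ?lhs g = ?rhs \<longleftrightarrow> g = ?g")
proof
  assume *: "?zero g \<and> ?lhs g = ?rhs"
  show "g = ?g"
  proof
    fix l
    show "g l = ?g l"
    proof (induction l rule: less_induct)
      case (less l)
      show ?case
      proof (cases "l \<le> d div 2")
        case True
        have "coeff (?lhs g) l = h l" using * True by (simp add: coeff_sum_monom)
        hence "g l = h l - (\<Sum>i<l. g i * int ((d - 2 * i) choose (l - i)))"
          unfolding coeff_gamma_expansion gamma_expansion_split[OF True] by simp
        also have "(\<Sum>i<l. g i * int ((d - 2 * i) choose (l - i))) =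
            (\<Sum>i<l. gamma_from_h d h i * int ((d - 2 * i) choose (l - i)))"
          by (rule sum.cong) (use less True in auto)
        finally show ?thesis using True by (simp add: gamma_from_h.simps[of d h l])
      qed (use * in auto)
    qed
  qed
next
  assume g: "g = ?g"
  have low: "coeff (?lhs g) l = h l" if "l \<le> d div 2" for l
  proof -
    have "(\<Sum>i<l. g i * int ((d - 2 * i) choose (l - i))) =
        (\<Sum>i<l. gamma_from_h d h i * int ((d - 2 * i) choose (l - i)))"
      by (rule sum.cong) (use g that in auto)
    then show ?thesis
      unfolding coeff_gamma_expansion gamma_expansion_split[OF that]
      using g that by (simp add: gamma_from_h.simps[of d h l])
  qed
  have sym: "coeff (?lhs g) l = coeff (?lhs g) (d - l)" if "l \<le> d" for l
    unfolding coeff_gamma_expansion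
  proof (rule sum.cong)
    fix i assume i: "i \<in> {..d div 2}"
    consider "i \<le> l" "i \<le> d - l" | "i > l" | "i > d - l" by linarith
    then show "g i * (if i \<le> l then int ((d - 2 * i) choose (l - i)) else 0) =
        g i * (if i \<le> d - l then int ((d - 2 * i) choose (d - l - i)) else 0)"
    proof cases
      case 1
      have "(d - 2 * i) - (l - i) = d - l - i" "l - i \<le> d - 2 * i" using 1 i that by auto
      then show ?thesis using 1 binomial_symmetric[of "l - i" "d - 2 * i"] by simp
    next
      case 2
      hence "d - 2 * i < d - l - i" if "i \<le> d - l" using i that by auto
      then show ?thesis using 2 by (auto intro!: binomial_eq_0)
    next
      case 3
      hence "d - 2 * i < l - i" if "i \<le> l" using i that \<open>l \<le> d\<close> by auto
      then show ?thesis using 3 by (auto intro!: binomial_eq_0)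
    qed
  qed simp
  have "?lhs g = ?rhs"
  proof (rule poly_eqI)
    fix l
    consider "l \<le> d div 2" | "l > d div 2" "l \<le> d" | "l > d" by linarith
    then show "coeff (?lhs g) l = coeff ?rhs l"
    proof cases
      case 1
      then show ?thesis using low[OF 1] by (simp add: coeff_sum_monom)
    next
      case 2
      have half: "d - l \<le> d div 2" using 2 by linarith
      show ?thesis
        unfolding sym[OF 2(2)] low[OF half] coeff_sum_monom using pal[OF 2(2)] 2 by simp
    next
      case 3
      have "coeff (?lhs g) l = 0"
        unfolding coeff_gamma_expansion
        by (rule sum.neutral) (use 3 in \<open>auto intro!: binomial_eq_0\<close>)
      then show ?thesis unfolding coeff_sum_monom using 3 by simp
    qed
  qed
  then show "?zero g \<and> ?lhs g = ?rhs" using g by simp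
qed

section \<open>Face numbers dominate the gamma-vector\<close>

lemma binomial_le_power: "(n choose k) \<le> N ^ k" if "n \<le> N"
proof (cases "k \<le> n")
  case True
  have "(n choose k) \<le> n ^ k" by (rule binomial_le_pow[OF True])
  also have "\<dots> \<le> N ^ k" using that by (rule power_mono) simp
  finally show ?thesis .
next
  case False
  hence zero: "(n choose k) = 0" by (intro binomial_eq_0) simp
  show ?thesis unfolding zero by simp
qed

lemma mixed_power_le:
  fixes X d :: nat
  assumes "d \<le> X" "i < l"
  shows "X ^ i * d ^ (l - i) \<le> d * X ^ (l - 1)"
proof -
  have "d ^ (l - i) = d * d ^ (l - i - 1)"
    using assms(2) by (cases "l - i") auto
  also have "\<dots> \<le> d * X ^ (l - i - 1)"
    by (intro mult_left_mono power_mono) (use assms in auto)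
  finally have "X ^ i * d ^ (l - i) \<le> X ^ i * (d * X ^ (l - i - 1))" by (rule mult_left_mono) simp
  also have "\<dots> = d * X ^ (l - 1)"
    using assms(2) by (simp add: power_add[symmetric] ac_simps)
  finally show ?thesis .
qed

lemma sum_powers_two: "(\<Sum>i<l. 2 ^ i) \<le> (2::int) ^ l"
  by (induction l) auto

text \<open>
  Every term other than the leading one contains a factor \<open>d\<close> in place of a factor \<open>X\<close>. In the
  application \<open>X\<close> is the number of arcs and much larger than the dimension \<open>d\<close>.
\<close>

lemma gamma_from_h_bounds:
  fixes f h :: "nat \<Rightarrow> nat" and d X :: nat
  assumes f_h: "\<And>l. l \<le> d \<Longrightarrow> f l = (\<Sum>j\<le>l. h j * ((d - j) choose (l - j)))"
    and f_le: "\<And>l. f l \<le> X ^ l" and "d \<le> X" and l: "l \<le> d div 2"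
  shows "\<bar>gamma_from_h d (\<lambda>j. int (h j)) l\<bar> \<le> 2 ^ l * int X ^ l"
    and "l > 0 \<Longrightarrow> int (f l) - 2 ^ (2 * l) * int d * int X ^ (l - 1) \<le> gamma_from_h d (\<lambda>j. int (h j)) l"
proof -
  let ?g = "gamma_from_h d (\<lambda>j. int (h j))"
  have f_split: "f l = h l + (\<Sum>j<l. h j * ((d - j) choose (l - j)))" if "l \<le> d" for l
    using f_h[OF that] by (simp add: lessThan_Suc_atMost[symmetric])
  have h_le: "h l \<le> X ^ l" if "l \<le> d" for l
    using f_split[OF that] f_le[of l] by linarith
  have bound: "\<bar>?g l\<bar> \<le> 2 ^ l * int X ^ l" if "l \<le> d div 2" for l
    using that
  proof (induction l rule: less_induct)
    case (less l)
    have tm: "\<bar>?g i * int ((d - 2 * i) choose (l - i))\<bar> \<le> 2 ^ i * int X ^ l" if i: "i < l" for i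
    proof -
      have "int ((d - 2 * i) choose (l - i)) \<le> int (X ^ (l - i))"
        using binomial_le_power[of "d - 2 * i" X "l - i"] \<open>d \<le> X\<close> by (simp only: of_nat_le_iff)
      hence "\<bar>?g i\<bar> * int ((d - 2 * i) choose (l - i)) \<le> (2 ^ i * int X ^ i) * int X ^ (l - i)"
        using less.IH[OF i] less.prems i by (intro mult_mono) auto
      also have "\<dots> = 2 ^ i * int X ^ l" using i by (simp add: power_add[symmetric])
      finally show ?thesis by (simp add: abs_mult)
    qed
    have "\<bar>?g l\<bar> \<le> \<bar>int (h l)\<bar> + \<bar>\<Sum>i<l. ?g i * int ((d - 2 * i) choose (l - i))\<bar>"
      by (subst gamma_from_h.simps) (rule abs_triangle_ineq4)
    also have "\<dots> \<le> int X ^ l + (\<Sum>i<l. 2 ^ i * int X ^ l)"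
    proof (rule add_mono)
      have "h l \<le> X ^ l" using h_le less.prems by simp
      then show "\<bar>int (h l)\<bar> \<le> int X ^ l" by (simp flip: of_nat_power)
      have "\<bar>\<Sum>i<l. ?g i * int ((d - 2 * i) choose (l - i))\<bar> \<le>
          (\<Sum>i<l. \<bar>?g i * int ((d - 2 * i) choose (l - i))\<bar>)" by (rule sum_abs)
      also have "\<dots> \<le> (\<Sum>i<l. 2 ^ i * int X ^ l)" by (rule sum_mono) (use tm in auto)
      finally show "\<bar>\<Sum>i<l. ?g i * int ((d - 2 * i) choose (l - i))\<bar> \<le> (\<Sum>i<l. 2 ^ i * int X ^ l)" .
    qed
    also have "\<dots> = (1 + (\<Sum>i<l. 2 ^ i)) * int X ^ l"
      by (simp only: distrib_right mult_1_left sum_distrib_right)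
    also have "1 + (\<Sum>i<l. 2 ^ i) = (2 :: int) ^ l" by (induction l) auto
    finally show ?case .
  qed
  show "\<bar>?g l\<bar> \<le> 2 ^ l * int X ^ l" by (rule bound[OF l])
  assume "l > 0"
  have tm: "\<bar>?g i * int ((d - 2 * i) choose (l - i))\<bar> \<le> 2 ^ i * (int d * int X ^ (l - 1))" if i: "i < l" for i
  proof -
    have "int ((d - 2 * i) choose (l - i)) \<le> int (d ^ (l - i))"
      using binomial_le_power[of "d - 2 * i" d "l - i"] by (simp only: of_nat_le_iff)
    hence "\<bar>?g i\<bar> * int ((d - 2 * i) choose (l - i)) \<le> (2 ^ i * int X ^ i) * int (d ^ (l - i))"
      using bound[of i] l i by (intro mult_mono) auto
    also have "\<dots> = 2 ^ i * int (X ^ i * d ^ (l - i))" by simp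
    also have "\<dots> \<le> 2 ^ i * int (d * X ^ (l - 1))"
      using mixed_power_le[OF \<open>d \<le> X\<close> i] by (intro mult_left_mono) (simp_all only: of_nat_le_iff zero_le_power zero_le_numeral)
    finally show ?thesis by (simp add: abs_mult)
  qed
  have "\<bar>\<Sum>i<l. ?g i * int ((d - 2 * i) choose (l - i))\<bar> \<le>
      (\<Sum>i<l. \<bar>?g i * int ((d - 2 * i) choose (l - i))\<bar>)" by (rule sum_abs)
  also have "\<dots> \<le> (\<Sum>i<l. 2 ^ i * (int d * int X ^ (l - 1)))" by (rule sum_mono) (use tm in auto)
  also have "\<dots> = (\<Sum>i<l. 2 ^ i) * (int d * int X ^ (l - 1))" by (simp only: sum_distrib_right)
  also have "\<dots> \<le> 2 ^ l * (int d * int X ^ (l - 1))"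
    by (rule mult_right_mono[OF sum_powers_two]) simp
  finally have g_err: "\<bar>\<Sum>i<l. ?g i * int ((d - 2 * i) choose (l - i))\<bar> \<le> 2 ^ l * (int d * int X ^ (l - 1))" .
  have "(\<Sum>j<l. h j * ((d - j) choose (l - j))) \<le> (\<Sum>j<l. d * X ^ (l - 1))"
  proof (rule sum_mono)
    fix j assume "j \<in> {..<l}"
    hence j: "j < l" by simp
    have "h j * ((d - j) choose (l - j)) \<le> X ^ j * d ^ (l - j)"
      using h_le[of j] j l binomial_le_power[of "d - j" d "l - j"] by (intro mult_mono) auto
    also have "\<dots> \<le> d * X ^ (l - 1)" by (rule mixed_power_le[OF \<open>d \<le> X\<close> j])
    finally show "h j * ((d - j) choose (l - j)) \<le> d * X ^ (l - 1)" .
  qed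
  hence "f l \<le> h l + l * (d * X ^ (l - 1))" using f_split[of l] l by simp
  also have "\<dots> \<le> h l + 2 ^ l * (d * X ^ (l - 1))"
    by (rule add_left_mono[OF mult_right_mono[OF less_imp_le[OF less_exp]]]) simp
  finally have "int (f l) \<le> int (h l + 2 ^ l * (d * X ^ (l - 1)))" by (rule of_nat_mono)
  also have "\<dots> = int (h l) + 2 ^ l * (int d * int X ^ (l - 1))"
    by (simp only: of_nat_add of_nat_mult of_nat_power of_nat_numeral)
  finally have "int (f l) \<le> int (h l) + 2 ^ l * (int d * int X ^ (l - 1))" .
  moreover have "?g l = int (h l) - (\<Sum>i<l. ?g i * int ((d - 2 * i) choose (l - i)))"
    by (rule gamma_from_h.simps)
  moreover have "2 ^ l * (int d * int X ^ (l - 1)) + 2 ^ l * (int d * int X ^ (l - 1)) \<le>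
      2 ^ (2 * l) * int d * int X ^ (l - 1)"
  proof -
    have "(2 :: int) ^ l + 2 ^ l = 2 ^ (l + 1)" by simp
    also have "\<dots> \<le> 2 ^ (2 * l)" using \<open>l > 0\<close> by (intro power_increasing) auto
    finally have "(2 ^ l + 2 ^ l) * (int d * int X ^ (l - 1)) \<le> 2 ^ (2 * l) * (int d * int X ^ (l - 1))"
      by (rule mult_right_mono) simp
    then show ?thesis by (simp add: algebra_simps)
  qed
  ultimately show "int (f l) - 2 ^ (2 * l) * int d * int X ^ (l - 1) \<le> ?g l"
    using g_err by linarith
qed

section \<open>Symmetric edge polytopes\<close>

definition edge_arcs :: "nat set set \<Rightarrow> (nat \<times> nat) set" where
  "edge_arcs E = {(i, j). {i, j} \<in> E}"

locale edge_polytope = weighted_arc_system "edge_arcs E" w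
  for E :: "nat set set" and w +
  assumes edge_card: "e \<in> E \<Longrightarrow> card e = 2"
begin

abbreviation D :: "(nat \<times> nat) set" where "D \<equiv> edge_arcs E"
abbreviation P :: "(nat \<Rightarrow>\<^sub>0 real) set" where "P \<equiv> symmetric_edge_polytope E"

lemma swap_in_D: "e \<in> D \<Longrightarrow> prod.swap e \<in> D"
  by (cases e) (simp add: edge_arcs_def insert_commute)

lemma bd_swap: "bd (\<lambda>e. r (prod.swap e)) = - bd r"
proof -
  have "(\<Sum>e\<in>D. r (prod.swap e) *\<^sub>R arc_vec e) = (\<Sum>e\<in>D. r e *\<^sub>R arc_vec (prod.swap e))"
    by (rule sum.reindex_bij_witness[of _ prod.swap prod.swap]) (auto simp: swap_in_D)
  then show ?thesis by (simp add: bd_def arc_vec_swap sum_negf)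
qed

lemma arc_lattice_uminus: "x \<in> arc_lattice \<Longrightarrow> - x \<in> arc_lattice"
proof -
  assume "x \<in> arc_lattice"
  then obtain c :: "nat \<times> nat \<Rightarrow> nat" where "x = bd (\<lambda>e. real (c e))" by (auto simp: arc_lattice_def)
  hence "- x = bd (\<lambda>e. real (c (prod.swap e)))" using bd_swap[of "\<lambda>e. real (c e)"] by simp
  then show ?thesis unfolding arc_lattice_def
    by (intro range_eqI[where x = "\<lambda>e. c (prod.swap e)"])
qed

lemma generic_uminus: "generic v \<Longrightarrow> generic (- v)"
  using arc_lattice_uminus[of v] span_neg[of "- v"] by (auto simp: generic_def)

text \<open>
  Opposite arcs cancel, so the origin belongs to the polytope and total weights below \<open>1\<close> are harmless.
\<close>

lemma symmetric_edge_polytope_eq: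
  "P = {bd r | r. (\<forall>e\<in>D. r e \<ge> 0) \<and> sum r D \<le> 1}" (is "_ = ?Q")
proof (cases "E = {}")
  case True
  hence "D = {}" by (simp add: edge_arcs_def)
  hence "bd r = 0" for r unfolding bd_def by simp
  then show ?thesis using True \<open>D = {}\<close> by (auto simp: symmetric_edge_polytope_def)
next
  case False
  then obtain e where "e \<in> E" by blast
  moreover from this obtain i j where "e = {i, j}" using edge_card[of e] by (auto simp: card_2_iff)
  ultimately have "{i, j} \<in> E" by simp
  hence e0: "(i, j) \<in> D" by (simp add: edge_arcs_def)
  have P: "P = convex hull (arc_vec ` D)"
  proof -
    have "{Poly_Mapping.single i 1 - Poly_Mapping.single j 1 | i j. {i, j} \<in> E} = arc_vec ` D"
      by (auto simp: edge_arcs_def arc_vec_def image_iff) (blast+)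
    then show ?thesis using False by (simp add: symmetric_edge_polytope_def)
  qed
  have convex_P: "convex P" unfolding P by (rule convex_convex_hull)
  have arc_P: "arc_vec e \<in> P" if "e \<in> D" for e
    unfolding P using that by (intro hull_inc) blast
  have zero_P: "0 \<in> P"
  proof -
    have "(1/2) *\<^sub>R arc_vec (i, j) + (1/2) *\<^sub>R arc_vec (prod.swap (i, j)) \<in> P"
      by (rule convexD[OF convex_P]) (use e0 arc_P swap_in_D in auto)
    then show ?thesis unfolding arc_vec_swap by simp
  qed
  have "P \<subseteq> ?Q" unfolding P
  proof (rule hull_minimal)
    show "arc_vec ` D \<subseteq> ?Q"
    proof
      fix x assume "x \<in> arc_vec ` D"
      then obtain e where e: "e \<in> D" "x = arc_vec e" by blast
      have "x = bd (indicator {e})" using e bd_indicator_singleton by simp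
      moreover have "sum (indicator {e}) D = (1 :: real)"
        using e finite_D by (simp add: indicator_def if_distrib sum.delta cong: if_cong)
      ultimately show "x \<in> ?Q" by (auto intro!: exI[of _ "indicator {e}"])
    qed
    show "convex ?Q"
    proof (rule convexI)
      fix x y :: "nat \<Rightarrow>\<^sub>0 real" and u v :: real
      assume "x \<in> ?Q" "y \<in> ?Q" and uv: "0 \<le> u" "0 \<le> v" "u + v = 1"
      then obtain r s where r: "x = bd r" "\<And>e. e \<in> D \<Longrightarrow> 0 \<le> r e" "sum r D \<le> 1"
        and s: "y = bd s" "\<And>e. e \<in> D \<Longrightarrow> 0 \<le> s e" "sum s D \<le> 1"
        by blast
      have "u *\<^sub>R x + v *\<^sub>R y = bd (\<lambda>e. u * r e + v * s e)"
        by (simp add: r(1) s(1) bd_add bd_scale)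
      moreover have "\<forall>e\<in>D. 0 \<le> u * r e + v * s e" using r(2) s(2) uv by simp
      moreover have "(\<Sum>e\<in>D. u * r e + v * s e) \<le> 1"
      proof -
        have "(\<Sum>e\<in>D. u * r e + v * s e) = u * sum r D + v * sum s D"
          by (simp add: sum.distrib sum_distrib_left)
        also have "\<dots> \<le> u * 1 + v * 1"
          using r(3) s(3) uv by (intro add_mono mult_left_mono)
        finally show ?thesis using uv by simp
      qed
      ultimately show "u *\<^sub>R x + v *\<^sub>R y \<in> ?Q" by blast
    qed
  qed
  moreover have "?Q \<subseteq> P"
  proof
    fix x assume "x \<in> ?Q"
    then obtain r where x: "x = bd r" and r: "\<And>e. e \<in> D \<Longrightarrow> 0 \<le> r e" "sum r D \<le> 1" by blast
    define s where "s = sum r D"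
    have "s \<ge> 0" unfolding s_def using r(1) by (rule sum_nonneg)
    show "x \<in> P"
    proof (cases "s = 0")
      case True
      hence "\<forall>e\<in>D. r e = 0" using sum_nonneg_eq_0_iff[OF finite_D r(1)] by (simp add: s_def)
      then show ?thesis using zero_P by (simp add: x bd_def)
    next
      case False
      have "(\<Sum>e\<in>D. (r e / s) *\<^sub>R arc_vec e) \<in> P"
      proof (rule convex_sum[OF finite_D convex_P])
        show "(\<Sum>e\<in>D. r e / s) = 1" using False by (simp add: s_def flip: sum_divide_distrib)
      qed (use r \<open>s \<ge> 0\<close> arc_P in auto)
      hence "s *\<^sub>R (\<Sum>e\<in>D. (r e / s) *\<^sub>R arc_vec e) + (1 - s) *\<^sub>R 0 \<in> P"
        by (rule convexD[OF convex_P _ zero_P]) (use r \<open>s \<ge> 0\<close> s_def in auto)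
      moreover have "s *\<^sub>R (\<Sum>e\<in>D. (r e / s) *\<^sub>R arc_vec e) = x"
        using False by (simp add: x bd_def scaleR_sum_right)
      ultimately show ?thesis by simp
    qed
  qed
  ultimately show ?thesis by (rule equalityI)
qed

lemma dilate_symmetric_edge_polytope:
  "(\<lambda>x. real m *\<^sub>R x) ` P = {bd r | r. (\<forall>e\<in>D. r e \<ge> 0) \<and> sum r D \<le> real m}"
proof (intro equalityI subsetI)
  fix x assume "x \<in> (\<lambda>x. real m *\<^sub>R x) ` P"
  then obtain r where r: "x = real m *\<^sub>R bd r" "\<And>e. e \<in> D \<Longrightarrow> r e \<ge> 0" "sum r D \<le> 1"
    unfolding symmetric_edge_polytope_eq by blast
  have "x = bd (\<lambda>e. real m * r e)" by (simp add: r(1) bd_scale)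
  moreover have "\<forall>e\<in>D. real m * r e \<ge> 0" using r(2) by simp
  moreover have "(\<Sum>e\<in>D. real m * r e) \<le> real m"
    unfolding sum_distrib_left[symmetric] using r(3) by (rule mult_left_le) simp
  ultimately show "x \<in> {bd r | r. (\<forall>e\<in>D. r e \<ge> 0) \<and> sum r D \<le> real m}" by blast
next
  fix x assume "x \<in> {bd r | r. (\<forall>e\<in>D. r e \<ge> 0) \<and> sum r D \<le> real m}"
  then obtain r where r: "x = bd r" "\<And>e. e \<in> D \<Longrightarrow> r e \<ge> 0" "sum r D \<le> real m" by blast
  define s where "s e = r e / real m" for e
  have zero: "r e = 0" if "m = 0" "e \<in> D" for e
  proof -
    have "sum r D \<le> 0" using r(3) that(1) by simp
    moreover have "sum r D \<ge> 0" using r(2) by (rule sum_nonneg)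
    ultimately have "sum r D = 0" by simp
    then show ?thesis using sum_nonneg_eq_0_iff[OF finite_D r(2)] that by simp
  qed
  have "real m *\<^sub>R bd s = bd (\<lambda>e. real m * s e)" by (simp add: bd_scale)
  also have "\<dots> = bd r" by (rule bd_cong) (use zero in \<open>auto simp: s_def\<close>)
  finally have "x = real m *\<^sub>R bd s" using r(1) by simp
  moreover have "bd s \<in> P"
  proof -
    have "\<forall>e\<in>D. s e \<ge> 0" using r(2) by (simp add: s_def)
    moreover have "sum s D \<le> 1"
      using r(3) by (simp add: s_def divide_le_eq flip: sum_divide_distrib)
    ultimately show ?thesis unfolding symmetric_edge_polytope_eq by blast
  qed
  ultimately show "x \<in> (\<lambda>x. real m *\<^sub>R x) ` P" by (rule image_eqI)
qed

lemma polytope_dim_eq_rank: "polytope_dim P = rank"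
proof -
  let ?S = "{x - y | x y. x \<in> P \<and> y \<in> P}"
  have zero: "0 \<in> P" unfolding symmetric_edge_polytope_eq
    by (intro CollectI exI[of _ "\<lambda>_. 0"]) (simp add: bd_zero)
  have arc: "arc_vec e \<in> P" if "e \<in> D" for e
  proof -
    have "sum (indicator {e}) D = (1 :: real)"
      using that finite_D by (simp add: indicator_def if_distrib sum.delta cong: if_cong)
    then show ?thesis unfolding symmetric_edge_polytope_eq
      by (intro CollectI exI[of _ "indicator {e}"]) (simp add: bd_indicator_singleton that)
  qed
  have in_span: "x \<in> span (arc_vec ` D)" if "x \<in> P" for x
    using that bd_in_span[of D] unfolding symmetric_edge_polytope_eq by auto
  have "span ?S = span (arc_vec ` D)"
  proof (rule equalityI)
    have "?S \<subseteq> span (arc_vec ` D)" by (clarify, intro span_diff in_span)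
    then show "span ?S \<subseteq> span (arc_vec ` D)" by (rule span_minimal) (rule subspace_span)
    have "arc_vec e \<in> ?S" if "e \<in> D" for e
      using arc[OF that] zero by (intro CollectI exI[of _ "arc_vec e"] exI[of _ 0]) simp
    hence "arc_vec ` D \<subseteq> ?S" by blast
    then show "span (arc_vec ` D) \<subseteq> span ?S" by (rule span_mono)
  qed
  then show ?thesis unfolding polytope_dim_def rank_def by (rule span_eq_dim)
qed

lemma arc_lattice_zero: "0 \<in> arc_lattice"
  using indicator_in_arc_lattice[of "{}"] unfolding bd_def by simp

lemma arc_lattice_add: "x \<in> arc_lattice \<Longrightarrow> y \<in> arc_lattice \<Longrightarrow> x + y \<in> arc_lattice"
  using arc_lattice_combination[of x y 1] by simp

lemma arc_lattice_scale:
  assumes "x \<in> arc_lattice" "k \<in> \<int>"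
  shows "k *\<^sub>R x \<in> arc_lattice"
proof -
  obtain n where "k = real n \<or> k = - real n" using assms(2) by (metis Ints_cases int_cases2 of_int_minus of_int_of_nat_eq)
  then show ?thesis
    using arc_lattice_combination[OF arc_lattice_zero assms(1), of n]
      arc_lattice_uminus[OF arc_lattice_combination[OF arc_lattice_zero assms(1), of n]] by auto
qed

lemma arc_lattice_sum: "(\<And>i. i \<in> A \<Longrightarrow> g i \<in> arc_lattice) \<Longrightarrow> sum g A \<in> arc_lattice"
  by (induction A rule: infinite_finite_induct) (auto simp: arc_lattice_zero arc_lattice_add)

text \<open>
  Moving the mass of every vertex to the root of its connected component along paths changes an
  integer vector by an element of the arc lattice. What remains vanishes, because vectors in the span
  of the arcs have total mass zero on every component.
\<close>

lemma integer_points_in_span: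
  assumes x: "x \<in> span (arc_vec ` D)" "x \<in> integer_lattice"
  shows "x \<in> arc_lattice"
proof -
  define s :: "nat \<Rightarrow> nat \<Rightarrow>\<^sub>0 real" where "s i = Poly_Mapping.single i 1" for i
  define conn where "conn i j \<longleftrightarrow> s i - s j \<in> arc_lattice" for i j
  define root where "root i = (LEAST j. conn i j)" for i
  have conn_refl: "conn i i" for i by (simp add: conn_def arc_lattice_zero)
  have conn_root: "conn i (root i)" for i unfolding root_def by (rule LeastI[of "conn i" i]) (rule conn_refl)
  have conn_sym: "conn j i" if "conn i j" for i j
    using arc_lattice_uminus[of "s i - s j"] that by (simp add: conn_def)
  have conn_trans: "conn i k" if "conn i j" "conn j k" for i j k
    using arc_lattice_add[of "s i - s j" "s j - s k"] that by (simp add: conn_def)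
  have root_eq: "root i = root j" if "conn i j" for i j
  proof -
    have "conn i = conn j" using conn_sym conn_trans that by blast
    then show ?thesis by (simp add: root_def)
  qed
  define U where "U = fst ` D \<union> snd ` D"
  have U: "finite U" using finite_D by (simp add: U_def)
  have transport: "(\<Sum>i\<in>U. Poly_Mapping.lookup (arc_vec e) i *\<^sub>R g i) = g (fst e) - g (snd e)"
    if "e \<in> D" for e and g :: "nat \<Rightarrow> nat \<Rightarrow>\<^sub>0 real"
    using sum_lookup_arc_vec[OF U, of e g] that by (simp add: U_def)
  have lin: "linear (\<lambda>x. \<Sum>i\<in>U. Poly_Mapping.lookup x i *\<^sub>R g i)" for g :: "nat \<Rightarrow> nat \<Rightarrow>\<^sub>0 real"
    by (rule linearI) (simp_all add: lookup_add lookup_scaleR scaleR_add_left sum.distrib scaleR_sum_right)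
  have "(\<Sum>i\<in>U. Poly_Mapping.lookup x i *\<^sub>R s (root i)) = 0"
  proof (rule linear_eq_0_on_span[OF lin _ x(1)])
    fix y assume "y \<in> arc_vec ` D"
    then obtain e where e: "e \<in> D" "y = arc_vec e" by blast
    have "conn (fst e) (snd e)"
      using indicator_in_arc_lattice[of "{e}"] bd_indicator_singleton[OF e(1)]
      by (simp add: conn_def s_def arc_vec_def)
    then show "(\<Sum>i\<in>U. Poly_Mapping.lookup y i *\<^sub>R s (root i)) = 0"
      using transport[OF e(1)] root_eq by (simp add: e(2))
  qed
  moreover have "(\<Sum>i\<in>U. Poly_Mapping.lookup x i *\<^sub>R s i) = x"
  proof -
    have "linear (\<lambda>x. (\<Sum>i\<in>U. Poly_Mapping.lookup x i *\<^sub>R s i) - x)"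
      by (intro linear_compose_sub lin linear_ident)
    hence "(\<Sum>i\<in>U. Poly_Mapping.lookup x i *\<^sub>R s i) - x = 0"
    proof (rule linear_eq_0_on_span[OF _ _ x(1)])
      fix y assume "y \<in> arc_vec ` D"
      then obtain e where e: "e \<in> D" "y = arc_vec e" by blast
      then show "(\<Sum>i\<in>U. Poly_Mapping.lookup y i *\<^sub>R s i) - y = 0"
        using transport[OF e(1), of s] by (simp add: s_def arc_vec_def)
    qed
    then show ?thesis by simp
  qed
  ultimately have "x = (\<Sum>i\<in>U. Poly_Mapping.lookup x i *\<^sub>R (s i - s (root i)))"
    by (simp add: scaleR_diff_right sum_subtractf)
  also have "\<dots> \<in> arc_lattice"
  proof (rule arc_lattice_sum, rule arc_lattice_scale)
    show "s i - s (root i) \<in> arc_lattice" for i using conn_root by (simp add: conn_def)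
    show "Poly_Mapping.lookup x i \<in> \<int>" for i using x(2) by (simp add: integer_lattice_def)
  qed
  finally show ?thesis .
qed

text \<open>
  Integer decomposition property: an integer point in the dilate has a standard representation, and by
  \<open>face_rep_shortest\<close> this is not longer than the given real one.
\<close>

lemma lattice_points_dilate:
  "(\<lambda>x. real m *\<^sub>R x) ` P \<inter> integer_lattice =
    (\<lambda>c. bd (\<lambda>e. real (c e))) ` {c \<in> standard_reps. sum c D \<le> m}"
proof (intro equalityI subsetI)
  fix x assume "x \<in> (\<lambda>x. real m *\<^sub>R x) ` P \<inter> integer_lattice"
  then obtain r where r: "x = bd r" "\<And>e. e \<in> D \<Longrightarrow> r e \<ge> 0" "sum r D \<le> real m"
    and int: "x \<in> integer_lattice"
    unfolding dilate_symmetric_edge_polytope by blast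
  have "x \<in> span (arc_vec ` D)" unfolding r(1) by (rule bd_in_span) auto
  then obtain c where c: "c \<in> standard_reps" "bd (\<lambda>e. real (c e)) = x"
    using standard_rep_exists[OF integer_points_in_span[OF _ int]] by blast
  have "(\<Sum>e\<in>D. real (c e)) \<le> sum r D"
    by (rule face_rep_shortest[OF standard_repsD(1)[OF c(1)]]) (use r c(2) in simp_all)
  hence "real (sum c D) \<le> real m" using r(3) unfolding of_nat_sum by (rule order_trans)
  hence "sum c D \<le> m" by (simp only: of_nat_le_iff)
  then show "x \<in> (\<lambda>c. bd (\<lambda>e. real (c e))) ` {c \<in> standard_reps. sum c D \<le> m}"
    using c by (intro image_eqI[of _ _ c]) auto
next
  fix x assume "x \<in> (\<lambda>c. bd (\<lambda>e. real (c e))) ` {c \<in> standard_reps. sum c D \<le> m}"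
  then obtain c where c: "x = bd (\<lambda>e. real (c e))" "sum c D \<le> m" by blast
  have "(\<Sum>e\<in>D. real (c e)) \<le> real m" using c(2) by (simp flip: of_nat_sum)
  hence "x \<in> (\<lambda>x. real m *\<^sub>R x) ` P"
    unfolding dilate_symmetric_edge_polytope c(1)
    by (intro CollectI exI[of _ "\<lambda>e. real (c e)"]) simp
  moreover have "x \<in> integer_lattice"
    unfolding integer_lattice_def c(1) bd_def
    by (auto simp: lookup_sum_scaleR lookup_arc_vec intro!: Ints_sum Ints_mult Ints_diff)
  ultimately show "x \<in> (\<lambda>x. real m *\<^sub>R x) ` P \<inter> integer_lattice" by blast
qed

lemma card_lattice_points_dilate:
  assumes "generic v"
  shows "card ((\<lambda>x. real m *\<^sub>R x) ` P \<inter> integer_lattice) =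
    (\<Sum>j\<le>rank. h_count v j * ((m + rank - j) choose rank))"
proof -
  have "inj_on (\<lambda>c. bd (\<lambda>e. real (c e))) {c \<in> standard_reps. sum c D \<le> m}"
    by (rule inj_on_subset[OF inj_on_bd_standard_reps]) (rule Collect_restrict)
  then show ?thesis
    unfolding lattice_points_dilate card_standard_reps[OF assms, symmetric] by (rule card_image)
qed

lemma h_star_eq_h_count:
  assumes v: "generic v"
  shows "h_star P = (\<lambda>j. int (h_count v j))"
proof -
  have ehrhart: "int (card ((\<lambda>x. real m *\<^sub>R x) ` P \<inter> integer_lattice)) =
      (\<Sum>j\<le>rank. int (h_count v j) * int ((m + rank - j) choose rank))" for m
    unfolding card_lattice_points_dilate[OF v] by simp
  show ?thesis
    unfolding h_star_def Let_def polytope_dim_eq_rank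
  proof (rule the_equality)
    show "(\<forall>j>rank. int (h_count v j) = 0) \<and> (\<forall>m. int (card ((\<lambda>x. real m *\<^sub>R x) ` P \<inter> integer_lattice)) =
      (\<Sum>j\<le>rank. int (h_count v j) * int ((m + rank - j) choose rank)))"
      using ehrhart h_count_above_rank by simp
    fix h assume h: "(\<forall>j>rank. h j = 0) \<and> (\<forall>m. int (card ((\<lambda>x. real m *\<^sub>R x) ` P \<inter> integer_lattice)) =
      (\<Sum>j\<le>rank. h j * int ((m + rank - j) choose rank)))"
    show "h = (\<lambda>j. int (h_count v j))"
    proof (rule binomial_basis_unique[of rank])
      show "(\<Sum>j\<le>rank. h j * int ((m + rank - j) choose rank)) =
          (\<Sum>j\<le>rank. int (h_count v j) * int ((m + rank - j) choose rank))" for m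
        using h ehrhart[of m] by metis
    qed (use h h_count_above_rank in auto)
  qed
qed

text \<open>
  The h-star vector does not depend on the direction, so the counts for \<open>v\<close> and \<open>-v\<close> agree.
\<close>

lemma h_count_palindromic:
  assumes "generic v" "j \<le> rank"
  shows "h_count v j = h_count v (rank - j)"
proof -
  have "(\<lambda>j. int (h_count v j)) = (\<lambda>j. int (h_count (- v) j))"
    using h_star_eq_h_count[OF assms(1)] h_star_eq_h_count[OF generic_uminus[OF assms(1)]] by simp
  hence "h_count v j = h_count (- v) j" by (metis of_nat_eq_iff)
  also have "\<dots> = h_count v (rank - j)" by (rule h_count_uminus[OF assms(1) generic_uminus[OF assms(1)] assms(2)])
  finally show ?thesis .
qed

lemma gamma_vector_eq:
  assumes v: "generic v"
  shows "gamma_vector P = (\<lambda>i. if i \<le> rank div 2 then gamma_from_h rank (\<lambda>j. int (h_count v j)) i else 0)"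
proof -
  have "int (h_count v j) = int (h_count v (rank - j))" if "j \<le> rank" for j
    using h_count_palindromic[OF v that] by simp
  from gamma_expansion_palindromic[of rank "\<lambda>j. int (h_count v j)", OF this]
  show ?thesis unfolding gamma_vector_def Let_def polytope_dim_eq_rank h_star_eq_h_count[OF v]
    by (simp only: the_eq_trivial)
qed

lemma f_count_eq_h_count_sum_le:
  assumes "generic v" "l \<le> rank"
  shows "f_count l = (\<Sum>j\<le>l. h_count v j * ((rank - j) choose (l - j)))"
  unfolding f_count_eq_h_count_sum[OF assms(1)]
proof (rule sum.mono_neutral_cong_right)
  show "{..l} \<subseteq> {..rank}" using assms(2) by simp
qed simp_all

lemma f_count_le: "f_count l \<le> card D ^ l"
proof -
  have "f_count l \<le> card {H. H \<subseteq> D \<and> card H = l}" unfolding f_count_def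
    by (rule card_mono) (use finite_D face_in_D in \<open>auto intro: finite_subset[of _ "Pow D"]\<close>)
  also have "\<dots> = card D choose l" by (rule n_subsets[OF finite_D])
  also have "\<dots> \<le> card D ^ l" by (rule binomial_le_power) simp
  finally show ?thesis .
qed

lemma rank_le_card: "rank \<le> card D"
proof -
  have "rank \<le> card (arc_vec ` D)" unfolding rank_def
    by (rule dim_le_card) (use finite_D in \<open>auto intro: span_base\<close>)
  also have "\<dots> \<le> card D" by (rule card_image_le[OF finite_D])
  finally show ?thesis .
qed

lemma rank_le_vertices:
  assumes "\<Union>E \<subseteq> {1..n}"
  shows "rank \<le> n"
proof -
  let ?s = "\<lambda>i :: nat. Poly_Mapping.single i (1 :: real)"
  have "arc_vec ` D \<subseteq> span (?s ` {1..n})"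
  proof
    fix x assume "x \<in> arc_vec ` D"
    then obtain i j where ij: "{i, j} \<in> E" "x = ?s i - ?s j"
      by (auto simp: edge_arcs_def arc_vec_def)
    hence "i \<in> {1..n}" "j \<in> {1..n}" using assms by blast+
    then show "x \<in> span (?s ` {1..n})" unfolding ij(2) by (intro span_diff span_base imageI)
  qed
  hence "rank \<le> card (?s ` {1..n})" unfolding rank_def by (rule dim_le_card) simp
  also have "\<dots> \<le> card {1..n}" by (rule card_image_le) simp
  finally show ?thesis by simp
qed

theorem gamma_vector_bounds:
  assumes "l \<le> rank div 2" and n: "\<Union>E \<subseteq> {1..n}"
  shows "\<bar>gamma_vector P l\<bar> \<le> 2 ^ l * int (card D) ^ l"
    and "l > 0 \<Longrightarrow> int (f_count l) - 2 ^ (2 * l) * int n * int (card D) ^ (l - 1) \<le> gamma_vector P l"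
proof -
  obtain v where v: "generic v" using generic_exists by blast
  have g: "gamma_vector P l = gamma_from_h rank (\<lambda>j. int (h_count v j)) l"
    unfolding gamma_vector_eq[OF v] using assms(1) by simp
  note bounds = gamma_from_h_bounds[where f = f_count and h = "h_count v" and d = rank and X = "card D",
      OF f_count_eq_h_count_sum_le[OF v] f_count_le rank_le_card assms(1)]
  show "\<bar>gamma_vector P l\<bar> \<le> 2 ^ l * int (card D) ^ l"
    unfolding g by (rule bounds(1))
  assume "l > 0"
  have "2 ^ (2 * l) * int rank * int (card D) ^ (l - 1) \<le> 2 ^ (2 * l) * int n * int (card D) ^ (l - 1)"
    using rank_le_vertices[OF n] by (intro mult_right_mono mult_left_mono) auto
  moreover have "int (f_count l) - 2 ^ (2 * l) * int rank * int (card D) ^ (l - 1) \<le>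
      gamma_from_h rank (\<lambda>j. int (h_count v j)) l"
    by (rule bounds(2)[OF _ \<open>l > 0\<close>])
  ultimately show "int (f_count l) - 2 ^ (2 * l) * int n * int (card D) ^ (l - 1) \<le> gamma_vector P l"
    unfolding g by linarith
qed

end

section \<open>Induced matchings are faces\<close>

context edge_polytope
begin

text \<open>
  The potential \<open>\<phi>\<close> is \<open>1\<close> at tails and \<open>-1\<close> at heads of the matching. It drops by \<open>2\<close> along the arcs
  of the matching and by at most \<open>1\<close> along all the others. An exchange that removes arcs of the
  matching and does not increase the length would have to use arcs of the matching only.
\<close>

lemma induced_matching_face:
  assumes S: "S \<subseteq> D"
    and matching: "\<And>e f x y. e \<in> S \<Longrightarrow> f \<in> S \<Longrightarrow> e \<noteq> f \<Longrightarrow> x \<in> {fst e, snd e} \<Longrightarrow> y \<in> {fst f, snd f} \<Longrightarrow>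
      x \<noteq> y \<and> {x, y} \<notin> E"
  shows "face S"
  unfolding face_def
proof (intro conjI allI impI)
  fix u assume u: "unit_circulation u" and sub: "\<forall>e\<in>D. u e = 1 \<longrightarrow> e \<in> S"
  have bd0: "bd u = 0" using u by (simp add: unit_circulation_def)
  define \<phi> :: "nat \<Rightarrow> real" where "\<phi> v = (if v \<in> fst ` S then 1 else if v \<in> snd ` S then -1 else 0)" for v
  have loop: "fst e \<noteq> snd e" if "e \<in> S" for e using loop_free S that by blast
  have on_S: "\<phi> (fst e) - \<phi> (snd e) = 2" if "e \<in> S" for e
  proof -
    have "snd e \<notin> fst ` S"
    proof
      assume "snd e \<in> fst ` S"
      then obtain f where f: "f \<in> S" "snd e = fst f" by blast
      then show False using matching[OF that f(1), of "snd e" "fst f"] loop[OF that] by (cases "e = f") auto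
    qed
    then show ?thesis using that by (simp add: \<phi>_def)
  qed
  have off_S: "\<phi> (fst e) - \<phi> (snd e) \<le> 1" if e: "e \<in> D" "e \<notin> S" for e
  proof (rule ccontr)
    assume "\<not> \<phi> (fst e) - \<phi> (snd e) \<le> 1"
    hence "fst e \<in> fst ` S" "snd e \<in> snd ` S" by (auto simp: \<phi>_def split: if_splits)
    then obtain a b where ab: "a \<in> S" "b \<in> S" "fst e = fst a" "snd e = snd b" by blast
    have "a \<noteq> b" using ab e(2) by (metis prod.collapse)
    hence "{fst a, snd b} \<notin> E" using matching[OF ab(1,2), of "fst a" "snd b"] by simp
    moreover have "{fst e, snd e} \<in> E" using e(1) by (simp add: edge_arcs_def case_prod_beta)
    ultimately show False using ab by simp
  qed
  show "weight u \<le> 0"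
  proof (rule ccontr)
    assume "\<not> weight u \<le> 0"
    hence pos: "weight u > 0" by simp
    have "\<not> (\<Sum>e\<in>D. - u e) > 0"
    proof
      assume "(\<Sum>e\<in>D. - u e) > 0"
      moreover have "unit_circulation (\<lambda>e. - u e)"
        using u by (auto simp: unit_circulation_def bd_minus)
      ultimately have "weight (\<lambda>e. - u e) > 0" by (rule weight_length[rotated])
      then show False using pos by (simp add: sum_negf)
    qed
    hence len: "(\<Sum>e\<in>D. u e) \<ge> 0" by (simp add: sum_negf)
    \<comment> \<open>The values of \<delta> are nonpositive, but their sum is twice the number of arcs
      that the exchange saves, which is nonnegative.\<close>
    define \<delta> where "\<delta> e = u e * (2 - (\<phi> (fst e) - \<phi> (snd e)))" for e
    have "(\<Sum>e\<in>D. \<delta> e) = 2 * (\<Sum>e\<in>D. u e) - (\<Sum>e\<in>D. u e * (\<phi> (fst e) - \<phi> (snd e)))"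
      unfolding \<delta>_def sum_distrib_left sum_subtractf[symmetric]
      by (rule sum.cong[OF refl]) (simp only: right_diff_distrib mult.commute)
    hence sum_ge: "(\<Sum>e\<in>D. \<delta> e) \<ge> 0" using circulation_potential[OF bd0, of \<phi>] len by simp
    have off: "u e = 0 \<or> u e = -1" if "e \<in> D" "e \<notin> S" for e
    proof -
      have "u e \<in> {-1, 0, 1}" using u that(1) by (simp add: unit_circulation_def)
      then show ?thesis using sub that by auto
    qed
    have nonpos: "\<delta> e \<le> 0" if e: "e \<in> D" for e
    proof (cases "e \<in> S")
      case True
      then show ?thesis by (simp add: \<delta>_def on_S)
    next
      case False
      then show ?thesis using off[OF e False] off_S[OF e False] by (auto simp: \<delta>_def)
    qed
    have \<delta>_zero: "\<delta> e = 0" if "e \<in> D" for e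
    proof -
      have "(\<Sum>e\<in>D. - \<delta> e) = 0"
      proof (rule antisym)
        show "(\<Sum>e\<in>D. - \<delta> e) \<le> 0" using sum_ge by (simp add: sum_negf)
        show "0 \<le> (\<Sum>e\<in>D. - \<delta> e)" using nonpos by (intro sum_nonneg) simp
      qed
      then show ?thesis using sum_nonneg_eq_0_iff[OF finite_D, of "\<lambda>e. - \<delta> e"] nonpos that by simp
    qed
    have zero_off: "u e = 0" if "e \<in> D" "e \<notin> S" for e
    proof -
      have "u e = 0 \<or> 2 - (\<phi> (fst e) - \<phi> (snd e)) = 0"
        using \<delta>_zero[OF that(1)] unfolding \<delta>_def mult_eq_0_iff .
      then show ?thesis using off_S[OF that] by linarith
    qed
    have "u e = 0" if e: "e \<in> S" for e
    proof -
      define \<psi> :: "nat \<Rightarrow> real" where "\<psi> v = (if v = fst e then 1 else 0)" for v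
      have \<psi>: "u f * (\<psi> (fst f) - \<psi> (snd f)) = (if f = e then u e else 0)" if f: "f \<in> D" for f
      proof (cases "f \<in> S")
        case False
        then show ?thesis using zero_off[OF f False] e by (cases "f = e") simp_all
      next
        case True
        show ?thesis
        proof (cases "f = e")
          case True
          then show ?thesis using loop[OF e] by (simp add: \<psi>_def)
        next
          case False
          have "fst f \<noteq> fst e" using matching[OF True e False, of "fst f" "fst e"] by simp
          moreover have "snd f \<noteq> fst e" using matching[OF True e False, of "snd f" "fst e"] by simp
          ultimately show ?thesis using False by (simp add: \<psi>_def)
        qed
      qed
      have "0 = (\<Sum>f\<in>D. u f * (\<psi> (fst f) - \<psi> (snd f)))" by (rule circulation_potential[OF bd0, symmetric])
      also have "\<dots> = (\<Sum>f\<in>D. if f = e then u e else 0)" by (rule sum.cong[OF refl]) (rule \<psi>)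
      also have "\<dots> = u e" using e S finite_D by (auto simp: sum.delta)
      finally show ?thesis by simp
    qed
    hence "u e = 0" if "e \<in> D" for e using zero_off[OF that] by blast
    hence "weight u = 0" by simp
    then show False using pos by simp
  qed
qed (rule S)

end

text \<open>
  Union bound in disguise: a list of \<open>l\<close> elements that contains a bad pair is determined by the two
  positions, the bad pair and the other \<open>l - 2\<close> entries. The factor \<open>N\<^sup>2\<close> replaces the division.
\<close>

lemma many_lists_without_bad_pairs:
  fixes X :: "'a set" and bad :: "'a \<Rightarrow> 'a \<Rightarrow> bool"
  assumes "finite X"
  defines "N \<equiv> card X" and "Y \<equiv> card {(a, b). a \<in> X \<and> b \<in> X \<and> bad a b}"
  shows "N ^ (l + 2) \<le>
    N ^ 2 * card {xs. set xs \<subseteq> X \<and> length xs = l \<and> sorted_wrt (\<lambda>a b. \<not> bad a b) xs} + l ^ 2 * Y * N ^ l"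
proof -
  define L where "L l = {xs. set xs \<subseteq> X \<and> length xs = l}" for l
  have L: "finite (L l)" "card (L l) = N ^ l" for l
    using finite_lists_length_eq[OF assms(1)] card_lists_length_eq[OF assms(1)]
    by (simp_all add: L_def N_def)
  define Q where "Q = {(a, b). a \<in> X \<and> b \<in> X \<and> bad a b}"
  have Q: "finite Q" by (rule finite_subset[of _ "X \<times> X"]) (use assms(1) in \<open>auto simp: Q_def\<close>)
  \<comment> \<open>A new first element together with a list that contains a bad partner of it.\<close>
  define T where "T l = {(x, xs). x \<in> X \<and> xs \<in> L l \<and> (\<exists>y\<in>set xs. bad x y)}" for l
  have T: "finite (T l)" for l
    by (rule finite_subset[of _ "X \<times> L l"]) (use assms(1) L in \<open>auto simp: T_def\<close>)
  define B where "B l = {xs \<in> L l. \<not> sorted_wrt (\<lambda>a b. \<not> bad a b) xs}" for l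
  have B: "finite (B l)" for l using L by (simp add: B_def)
  have T_le: "N * card (T l) \<le> l * Y * N ^ l" for l
  proof (induction l)
    case 0
    have "T 0 = {}" by (auto simp: T_def L_def)
    then show ?case by simp
  next
    case (Suc l)
    let ?f = "\<lambda>((x, y), ys). (x, y # ys)" and ?g = "\<lambda>(y, (x, ys)). (x, y # ys)"
    have "T (Suc l) \<subseteq> ?f ` (Q \<times> L l) \<union> ?g ` (X \<times> T l)"
    proof
      fix p assume "p \<in> T (Suc l)"
      then obtain x xs where x: "p = (x, xs)" "x \<in> X" "xs \<in> L (Suc l)" "\<exists>y\<in>set xs. bad x y"
        by (auto simp: T_def)
      then obtain y ys where xs: "xs = y # ys" by (cases xs) (auto simp: L_def)
      have "y \<in> X" "ys \<in> L l" using x(3) by (auto simp: L_def xs)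
      moreover have "bad x y \<or> (\<exists>z\<in>set ys. bad x z)" using x(4) by (auto simp: xs)
      ultimately have p: "p = (x, y # ys)" "x \<in> X" "y \<in> X" "ys \<in> L l" "bad x y \<or> (\<exists>z\<in>set ys. bad x z)"
        using x(1,2) xs by simp_all
      then show "p \<in> ?f ` (Q \<times> L l) \<union> ?g ` (X \<times> T l)"
        by (force simp: Q_def T_def image_iff)
    qed
    hence "card (T (Suc l)) \<le> card (?f ` (Q \<times> L l) \<union> ?g ` (X \<times> T l))"
      by (rule card_mono[rotated]) (use Q L T assms(1) in auto)
    also have "\<dots> \<le> card (?f ` (Q \<times> L l)) + card (?g ` (X \<times> T l))" by (rule card_Un_le)
    also have "\<dots> \<le> card (Q \<times> L l) + card (X \<times> T l)"
      by (intro add_mono card_image_le) (use Q L T assms(1) in auto)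
    also have "\<dots> = Y * N ^ l + N * card (T l)"
      by (simp add: card_cartesian_product L Y_def Q_def N_def)
    also have "\<dots> \<le> Y * N ^ l + l * Y * N ^ l" using Suc.IH by simp
    finally have "N * card (T (Suc l)) \<le> N * (Y * N ^ l + l * Y * N ^ l)" by (rule mult_left_mono) simp
    then show ?case by (simp add: algebra_simps)
  qed
  have B_le: "N ^ 2 * card (B l) \<le> l ^ 2 * Y * N ^ l" for l
  proof (induction l)
    case 0
    have "B 0 = {}" by (auto simp: B_def L_def)
    then show ?case by simp
  next
    case (Suc l)
    let ?f = "\<lambda>(x, xs). x # xs"
    have "B (Suc l) \<subseteq> ?f ` (X \<times> B l \<union> T l)"
    proof
      fix zs assume "zs \<in> B (Suc l)"
      then obtain x xs where zs: "zs = x # xs" and "x \<in> X" "xs \<in> L l" "\<not> sorted_wrt (\<lambda>a b. \<not> bad a b) (x # xs)"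
        by (auto simp: B_def L_def length_Suc_conv)
      hence "(x, xs) \<in> X \<times> B l \<union> T l" by (auto simp: B_def T_def)
      then show "zs \<in> ?f ` (X \<times> B l \<union> T l)"
        by (rule rev_image_eqI) (simp add: zs)
    qed
    hence "card (B (Suc l)) \<le> card (?f ` (X \<times> B l \<union> T l))"
      by (rule card_mono[rotated]) (use B T assms(1) in auto)
    also have "\<dots> \<le> card (X \<times> B l \<union> T l)" by (rule card_image_le) (use B T assms(1) in auto)
    also have "\<dots> \<le> card (X \<times> B l) + card (T l)" by (rule card_Un_le)
    also have "card (X \<times> B l) = N * card (B l)" by (simp add: card_cartesian_product N_def)
    finally have "N ^ 2 * card (B (Suc l)) \<le> N ^ 2 * (N * card (B l) + card (T l))"
      by (rule mult_left_mono) simp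
    also have "\<dots> = N * (N ^ 2 * card (B l)) + N * (N * card (T l))"
      by (simp add: power2_eq_square algebra_simps)
    also have "\<dots> \<le> N * (l ^ 2 * Y * N ^ l) + N * (l * Y * N ^ l)"
      using Suc.IH T_le[of l] by (intro add_mono mult_left_mono) simp_all
    also have "\<dots> = (l ^ 2 + l) * Y * N ^ Suc l" by (simp add: algebra_simps)
    also have "\<dots> \<le> (Suc l) ^ 2 * Y * N ^ Suc l"
      by (intro mult_right_mono) (simp_all add: power2_eq_square)
    finally show ?case .
  qed
  let ?G = "{xs. set xs \<subseteq> X \<and> length xs = l \<and> sorted_wrt (\<lambda>a b. \<not> bad a b) xs}"
  have "L l = ?G \<union> B l" by (auto simp: B_def L_def)
  hence "N ^ l \<le> card ?G + card (B l)" using L(2)[of l] card_Un_le[of ?G "B l"] by simp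
  hence "N ^ 2 * N ^ l \<le> N ^ 2 * (card ?G + card (B l))" by (rule mult_left_mono) simp
  also have "\<dots> = N ^ 2 * card ?G + N ^ 2 * card (B l)" by (rule distrib_left)
  also have "\<dots> \<le> N ^ 2 * card ?G + l ^ 2 * Y * N ^ l" using B_le[of l] by simp
  finally have "N ^ 2 * N ^ l \<le> N ^ 2 * card ?G + l ^ 2 * Y * N ^ l" .
  moreover have "N ^ (l + 2) = N ^ 2 * N ^ l" by (simp only: power_add mult.commute)
  ultimately show ?thesis by (simp only:)
qed

lemma sorted_wrt_distinct_pair:
  assumes "sorted_wrt R xs" "a \<in> set xs" "b \<in> set xs" "a \<noteq> b"
  shows "R a b \<or> R b a"
  using assms by (induction xs) auto

lemma sorted_wrt_irreflexive_distinct: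
  assumes "sorted_wrt R xs" "\<And>a. a \<in> set xs \<Longrightarrow> \<not> R a a"
  shows "distinct xs"
  using assms by (induction xs) auto

definition adjacent_edges :: "nat set set \<Rightarrow> nat set \<Rightarrow> nat set \<Rightarrow> bool" where
  "adjacent_edges E a b \<longleftrightarrow> a \<inter> b \<noteq> {} \<or> (\<exists>x\<in>a. \<exists>y\<in>b. {x, y} \<in> E)"

definition adjacent_pairs :: "nat set set \<Rightarrow> (nat set \<times> nat set) set" where
  "adjacent_pairs E = {(a, b). a \<in> E \<and> b \<in> E \<and> adjacent_edges E a b}"

lemma adjacent_edges_sym: "adjacent_edges E a b \<longleftrightarrow> adjacent_edges E b a"
  unfolding adjacent_edges_def by (metis Int_commute insert_commute)

context edge_polytope
begin

definition arc_of :: "nat set \<Rightarrow> nat \<times> nat" where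
  "arc_of e = (SOME p. {fst p, snd p} = e)"

lemma arc_of: "e \<in> E \<Longrightarrow> {fst (arc_of e), snd (arc_of e)} = e"
proof -
  assume "e \<in> E"
  then obtain i j where "e = {i, j}" using edge_card[of e] by (auto simp: card_2_iff)
  hence "\<exists>p. {fst p, snd p} = e" by (intro exI[of _ "(i, j)"]) simp
  then show ?thesis unfolding arc_of_def by (rule someI_ex)
qed

lemma inj_on_arc_of: "inj_on arc_of E"
  by (rule inj_onI) (metis arc_of)

lemma arc_of_in_D: "e \<in> E \<Longrightarrow> arc_of e \<in> D"
  using arc_of[of e] by (simp add: edge_arcs_def case_prod_beta)

lemma finite_E: "finite E"
  using finite_imageD[OF finite_subset[OF _ finite_D] inj_on_arc_of] arc_of_in_D by blast

lemma card_D_le: "card D \<le> 2 * card E"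
proof -
  have "D \<subseteq> arc_of ` E \<union> prod.swap ` arc_of ` E"
  proof
    fix e assume e: "e \<in> D"
    hence E: "{fst e, snd e} \<in> E" by (simp add: edge_arcs_def case_prod_beta)
    from arc_of[OF E] have "arc_of {fst e, snd e} = e \<or> arc_of {fst e, snd e} = prod.swap e"
      by (auto simp: doubleton_eq_iff prod_eq_iff)
    then show "e \<in> arc_of ` E \<union> prod.swap ` arc_of ` E"
      using E by (metis UnI1 UnI2 imageI swap_swap)
  qed
  hence "card D \<le> card (arc_of ` E \<union> prod.swap ` arc_of ` E)"
    by (rule card_mono[rotated]) (use finite_E in auto)
  also have "\<dots> \<le> card (arc_of ` E) + card (prod.swap ` arc_of ` E)" by (rule card_Un_le)
  also have "\<dots> \<le> card E + card E"
    by (intro add_mono order_trans[OF card_image_le card_image_le] card_image_le) (use finite_E in auto)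
  finally show ?thesis by simp
qed

text \<open>
  A list of pairwise non-adjacent edges is an induced matching. Each face arises from at most \<open>l\<^sup>l\<close> such
  lists, because the list only uses edges of the face.
\<close>

lemma many_faces:
  assumes "l > 0"
    and sparse: "2 * l ^ 2 * card (adjacent_pairs E) \<le> card E ^ 2"
  shows "card E ^ l \<le> 2 * l ^ l * f_count l"
proof (cases "card E = 0")
  case True
  show ?thesis unfolding True using assms(1) by (simp only: zero_power le0)
next
  case False
  let ?N = "card E" and ?Y = "card (adjacent_pairs E)"
  define G where "G = {xs. set xs \<subseteq> E \<and> length xs = l \<and> sorted_wrt (\<lambda>a b. \<not> adjacent_edges E a b) xs}"
  have "?N ^ (l + 2) \<le> ?N ^ 2 * card G + l ^ 2 * ?Y * ?N ^ l"
    unfolding G_def adjacent_pairs_def by (rule many_lists_without_bad_pairs[OF finite_E])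
  hence "2 * ?N ^ (l + 2) \<le> 2 * (?N ^ 2 * card G) + 2 * l ^ 2 * ?Y * ?N ^ l" by simp
  also have "\<dots> \<le> 2 * (?N ^ 2 * card G) + ?N ^ 2 * ?N ^ l"
    by (intro add_left_mono mult_right_mono[OF sparse]) simp
  finally have "2 * ?N ^ (l + 2) \<le> 2 * (?N ^ 2 * card G) + ?N ^ 2 * ?N ^ l" .
  moreover have "?N ^ (l + 2) = ?N ^ 2 * ?N ^ l" by (simp only: power_add mult.commute)
  ultimately have "?N ^ 2 * ?N ^ l \<le> 2 * (?N ^ 2 * card G)" by linarith
  also have "\<dots> = ?N ^ 2 * (2 * card G)" by (simp only: mult.left_commute)
  finally have "?N ^ 2 = 0 \<or> ?N ^ l \<le> 2 * card G" unfolding mult_le_cancel1 by blast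
  hence G_ge: "?N ^ l \<le> 2 * card G" using False by simp
  define F where "F = {H. face H \<and> card H = l}"
  have finF: "finite F" by (rule finite_subset[OF _ finite_faces]) (auto simp: F_def)
  have "map arc_of ` G \<subseteq> (\<Union>H\<in>F. {zs. set zs \<subseteq> H \<and> length zs = l})"
  proof
    fix zs assume "zs \<in> map arc_of ` G"
    then obtain xs where xs: "zs = map arc_of xs" "set xs \<subseteq> E" "length xs = l"
      "sorted_wrt (\<lambda>a b. \<not> adjacent_edges E a b) xs" by (auto simp: G_def)
    have indep: "\<not> adjacent_edges E a b" if "a \<in> set xs" "b \<in> set xs" "a \<noteq> b" for a b
      using sorted_wrt_distinct_pair[OF xs(4) that] adjacent_edges_sym[of E a b] by blast
    have "distinct xs"
    proof (rule sorted_wrt_irreflexive_distinct[OF xs(4)])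
      fix a assume "a \<in> set xs"
      hence "a \<noteq> {}" using edge_card[of a] xs(2) by auto
      then show "\<not> \<not> adjacent_edges E a a" by (simp add: adjacent_edges_def)
    qed
    have "face (arc_of ` set xs)"
    proof (rule induced_matching_face)
      show "arc_of ` set xs \<subseteq> D" using arc_of_in_D xs(2) by blast
      fix e f x y
      assume "e \<in> arc_of ` set xs" "f \<in> arc_of ` set xs" "e \<noteq> f"
        and xy: "x \<in> {fst e, snd e}" "y \<in> {fst f, snd f}"
      then obtain a b where ab: "a \<in> set xs" "b \<in> set xs" "e = arc_of a" "f = arc_of b" "a \<noteq> b"
        by blast
      have "x \<in> a" "y \<in> b" using xy ab arc_of xs(2) by auto
      then show "x \<noteq> y \<and> {x, y} \<notin> E"
        using indep[OF ab(1,2,5)] unfolding adjacent_edges_def by blast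
    qed
    moreover have "card (arc_of ` set xs) = l"
      using card_image[OF inj_on_subset[OF inj_on_arc_of xs(2)]] distinct_card[OF \<open>distinct xs\<close>] xs(3) by simp
    ultimately have "arc_of ` set xs \<in> F" by (simp add: F_def)
    then show "zs \<in> (\<Union>H\<in>F. {zs. set zs \<subseteq> H \<and> length zs = l})" using xs by auto
  qed
  hence "card (map arc_of ` G) \<le> card (\<Union>H\<in>F. {zs. set zs \<subseteq> H \<and> length zs = l})"
  proof (rule card_mono[rotated])
    show "finite (\<Union>H\<in>F. {zs. set zs \<subseteq> H \<and> length zs = l})"
      by (rule finite_UN_I[OF finF]) (auto simp: F_def intro!: finite_lists_length_eq finite_face)
  qed
  also have "\<dots> \<le> (\<Sum>H\<in>F. card {zs. set zs \<subseteq> H \<and> length zs = l})" by (rule card_UN_le[OF finF])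
  also have "\<dots> = (\<Sum>H\<in>F. l ^ l)"
    by (rule sum.cong[OF refl]) (simp add: F_def card_lists_length_eq finite_face)
  also have "\<dots> = f_count l * l ^ l" by (simp add: F_def f_count_def)
  finally have "card (map arc_of ` G) \<le> f_count l * l ^ l" .
  moreover have "inj_on (map arc_of) G"
    by (rule inj_on_mapI, rule inj_on_subset[OF inj_on_arc_of]) (auto simp: G_def)
  ultimately have "card G \<le> f_count l * l ^ l" by (simp add: card_image)
  hence "?N ^ l \<le> 2 * (f_count l * l ^ l)" using G_ge by linarith
  then show ?thesis by (simp only: ac_simps)
qed

end

section \<open>Forests\<close>

text \<open>
  A closed trail is given by the list of its vertices; the rotated list contains the successor of every
  vertex, including the step from the last vertex back to the first one.
\<close>

definition trail_edges :: "nat list \<Rightarrow> nat set list" where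
  "trail_edges ts = map2 (\<lambda>x y. {x, y}) ts (rotate1 ts)"

definition has_closed_trail :: "nat set set \<Rightarrow> bool" where
  "has_closed_trail E \<longleftrightarrow> (\<exists>ts. ts \<noteq> [] \<and> distinct (trail_edges ts) \<and> set (trail_edges ts) \<subseteq> E)"

lemma sum_choose_mult_choose: "(\<Sum>j\<le>i. (d choose j) * ((d - j) choose (i - j))) = (d choose i) * 2 ^ i"
  if "i \<le> d" for i d :: nat
proof -
  have "(\<Sum>j\<le>i. (d choose j) * ((d - j) choose (i - j))) = (\<Sum>j\<le>i. (d choose i) * (i choose j))"
    by (rule sum.cong[OF refl]) (use choose_mult that in auto)
  also have "\<dots> = (d choose i) * 2 ^ i"
    unfolding sum_distrib_left[symmetric] choose_row_sum ..
  finally show ?thesis .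
qed

context edge_polytope
begin

definition forward :: "(nat \<times> nat) set" where
  "forward = {e \<in> D. fst e < snd e}"

lemma forward_or_swap: "e \<in> D \<Longrightarrow> e \<in> forward \<or> prod.swap e \<in> forward"
  using loop_free[of e] swap_in_D[of e] by (auto simp: forward_def)

lemma finite_forward: "finite forward"
  using finite_D by (simp add: forward_def)

text \<open>
  A pair of opposite arcs has boundary zero, hence it can be removed for free.
\<close>

lemma swap_notin_face:
  assumes "face F" "e \<in> F"
  shows "prod.swap e \<notin> F"
proof
  assume sw: "prod.swap e \<in> F"
  have e: "e \<in> D" "prod.swap e \<in> D" using face_in_D[OF assms(1)] assms(2) sw by blast+
  have ne: "prod.swap e \<noteq> e" using loop_free[OF e(1)] by (simp add: prod_eq_iff)
  define u :: "nat \<times> nat \<Rightarrow> real" where "u = indicator {e, prod.swap e}"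
  have u: "u f = indicator {e} f + indicator {prod.swap e} f" for f
    using ne by (auto simp: u_def indicator_def)
  have "bd u = arc_vec e + arc_vec (prod.swap e)"
    unfolding bd_indicator_singleton[OF e(1), symmetric] bd_indicator_singleton[OF e(2), symmetric]
    by (subst bd_add[symmetric]) (rule bd_cong, rule u)
  hence circ: "unit_circulation u"
    unfolding unit_circulation_def by (auto simp: arc_vec_swap u_def indicator_def)
  have "u e \<le> (\<Sum>f\<in>D. u f)"
    by (rule member_le_sum[OF e(1) _ finite_D]) (simp add: u_def)
  hence "(\<Sum>f\<in>D. u f) > 0" by (simp add: u_def)
  hence "weight u > 0" by (rule weight_length[OF circ])
  moreover have "\<forall>f\<in>D. u f = 1 \<longrightarrow> f \<in> F"
    using assms(2) sw by (auto simp: u_def indicator_def split: if_splits)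
  hence "weight u \<le> 0" using assms(1) circ unfolding face_def by blast
  ultimately show False by linarith
qed

text \<open>
  Support on the increasing arcs ensures that distinct arcs of the trail belong to distinct edges.
\<close>

lemma closed_trail_of_cycle:
  assumes "bd z = 0" "\<And>e. e \<in> D \<Longrightarrow> snd e < fst e \<Longrightarrow> z e = 0" "e0 \<in> D" "z e0 \<noteq> 0"
  shows "has_closed_trail E"
proof -
  let ?t = "\<lambda>e. if z e > 0 then fst e else snd e"
  let ?h = "\<lambda>e. if z e > 0 then snd e else fst e"
  obtain as where as: "as \<noteq> []" "distinct as" "set as \<subseteq> {e \<in> D. z e \<noteq> 0}"
    and rot: "map ?t (rotate1 as) = map ?h as"
    using conformal_trail[OF assms(1,3,4)] by blast
  have "rotate1 (map ?t as) = map ?h as" using rot by (simp only: rotate1_map)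
  hence "trail_edges (map ?t as) = map2 (\<lambda>x y. {x, y}) (map ?t as) (map ?h as)"
    by (simp only: trail_edges_def)
  also have "\<dots> = map (\<lambda>e. {?t e, ?h e}) as" by (induction as) auto
  also have "\<dots> = map (\<lambda>e. {fst e, snd e}) as" by (rule map_cong) auto
  finally have edges: "trail_edges (map ?t as) = map (\<lambda>e. {fst e, snd e}) as" .
  have less: "fst e < snd e" if "e \<in> set as" for e
  proof -
    have "e \<in> D" "z e \<noteq> 0" using as(3) that by auto
    then show ?thesis using assms(2)[of e] loop_free[of e] by (metis linorder_neqE_nat)
  qed
  have "inj_on (\<lambda>e. {fst e, snd e}) (set as)"
  proof (rule inj_onI)
    fix e f assume "e \<in> set as" "f \<in> set as" "{fst e, snd e} = {fst f, snd f}"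
    then show "e = f" using less[of e] less[of f] by (auto simp: doubleton_eq_iff prod_eq_iff)
  qed
  hence "distinct (trail_edges (map ?t as))" using as(2) by (simp add: edges distinct_map)
  moreover have "set (trail_edges (map ?t as)) \<subseteq> E"
  proof
    fix x assume "x \<in> set (trail_edges (map ?t as))"
    then obtain e where "e \<in> set as" "x = {fst e, snd e}" by (auto simp: edges)
    moreover from this have "e \<in> D" using as(3) by auto
    ultimately show "x \<in> E" by (simp add: edge_arcs_def case_prod_beta)
  qed
  ultimately show ?thesis using as(1) unfolding has_closed_trail_def
    by (intro exI[of _ "map ?t as"]) simp
qed

text \<open>
  Using a single orientation of each edge excludes the trivial circulations on opposite arcs. The
  definition says that the vectors of these arcs are linearly independent.
\<close>

definition acyclic_edges :: bool where
  "acyclic_edges \<longleftrightarrow>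
    (\<forall>z. bd z = 0 \<longrightarrow> (\<forall>e\<in>D. snd e < fst e \<longrightarrow> z e = 0) \<longrightarrow> (\<forall>e\<in>D. z e = 0))"

text \<open>
  A circulation on a forest has equal values on opposite arcs, so no exchange can start from a set
  of arcs without antiparallel pairs. The fan is that of a cross-polytope.
\<close>

lemma forest_face:
  assumes acyclic: "acyclic_edges"
    and F: "F \<subseteq> D" "\<And>e. e \<in> F \<Longrightarrow> prod.swap e \<notin> F"
  shows "face F"
  unfolding face_def
proof (intro conjI allI impI)
  fix u assume u: "unit_circulation u" and sub: "\<forall>e\<in>D. u e = 1 \<longrightarrow> e \<in> F"
  \<comment> \<open>The antisymmetric part of u is the net flow through the edges; acyclicity forces it to vanish.\<close>
  define y where "y e = u e - u (prod.swap e)" for e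
  have y_swap: "y (prod.swap e) = - y e" for e by (simp add: y_def)
  have bd_y: "bd y = 0" using u by (simp add: y_def[abs_def] bd_diff bd_swap unit_circulation_def)
  define z where "z e = (if fst e < snd e then y e else 0)" for e
  have "bd y = bd z + (- bd (\<lambda>e. z (prod.swap e)))"
  proof -
    have "bd y = bd (\<lambda>e. z e + - z (prod.swap e))"
    proof (rule bd_cong)
      fix e assume "e \<in> D"
      hence "fst e < snd e \<or> snd e < fst e" using loop_free[of e] by auto
      then show "y e = z e + - z (prod.swap e)" by (auto simp: z_def y_swap)
    qed
    then show ?thesis by (simp add: bd_diff)
  qed
  hence "2 *\<^sub>R bd z = 0" using bd_y by (simp add: bd_swap scaleR_2)
  hence "bd z = 0" by simp
  moreover have "\<forall>e\<in>D. snd e < fst e \<longrightarrow> z e = 0" by (simp add: z_def)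
  ultimately have z0: "\<forall>e\<in>D. z e = 0" using acyclic unfolding acyclic_edges_def by blast
  have sym: "u (prod.swap e) = u e" if e: "e \<in> D" for e
  proof -
    have "fst e < snd e \<or> snd e < fst e" using loop_free[OF e] by auto
    then show ?thesis
      using bspec[OF z0 e] bspec[OF z0 swap_in_D[OF e]] by (auto simp: z_def y_def)
  qed
  have "u e \<le> 0" if e: "e \<in> D" for e
  proof (rule ccontr)
    assume "\<not> u e \<le> 0"
    moreover have "u e \<in> {-1, 0, 1}" using u e by (simp add: unit_circulation_def)
    ultimately have "u e = 1" by auto
    hence "e \<in> F" "prod.swap e \<in> F" using sub e swap_in_D[OF e] sym[OF e] by simp_all
    then show False using F(2) by blast
  qed
  then show "weight u \<le> 0" by (intro sum_nonpos) (simp add: mult_nonneg_nonpos)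
qed (rule F(1))

lemma card_oriented_subset:
  assumes "A \<subseteq> forward" "B \<subseteq> A"
  shows "card (B \<union> prod.swap ` (A - B)) = card A"
proof -
  have A: "finite A" using finite_forward assms(1) finite_subset by blast
  have "B \<inter> prod.swap ` (A - B) = {}"
  proof (rule equals0I)
    fix e assume "e \<in> B \<inter> prod.swap ` (A - B)"
    hence "fst e < snd e" "snd e < fst e" using assms by (auto simp: forward_def)
    then show False by simp
  qed
  hence "card (B \<union> prod.swap ` (A - B)) = card B + card (prod.swap ` (A - B))"
    by (intro card_Un_disjoint) (use A assms(2) finite_subset in auto)
  also have "card (prod.swap ` (A - B)) = card (A - B)" by (rule card_image) (metis inj_onI swap_swap)
  also have "card B + card (A - B) = card A"
    using card_mono[OF A assms(2)] card_Diff_subset[OF finite_subset[OF assms(2) A] assms(2)] by simp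
  finally show ?thesis .
qed

lemma forest_rank:
  assumes acyclic: "acyclic_edges"
  shows "rank = card forward"
proof (rule antisym)
  have "arc_vec ` D \<subseteq> span (arc_vec ` forward)"
  proof
    fix x assume "x \<in> arc_vec ` D"
    then obtain e where e: "e \<in> D" "x = arc_vec e" by blast
    from forward_or_swap[OF e(1)] show "x \<in> span (arc_vec ` forward)"
    proof
      assume "prod.swap e \<in> forward"
      hence "- arc_vec (prod.swap e) \<in> span (arc_vec ` forward)" by (intro span_neg span_base imageI)
      then show ?thesis by (simp add: e(2) arc_vec_swap)
    qed (simp add: e(2) span_base)
  qed
  hence "rank \<le> card (arc_vec ` forward)" unfolding rank_def
    by (rule dim_le_card) (use finite_forward in simp)
  also have "\<dots> \<le> card forward" by (rule card_image_le[OF finite_forward])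
  finally show "rank \<le> card forward" .
  have "face forward"
    by (rule forest_face[OF acyclic]) (auto simp: forward_def)
  then show "card forward \<le> rank" by (rule card_face_le_rank)
qed

text \<open>
  A face is a set \<open>A\<close> of edges together with the set \<open>B\<close> of those that are oriented increasingly.
\<close>

lemma forest_f_count:
  assumes acyclic: "acyclic_edges"
  shows "f_count i = (rank choose i) * 2 ^ i"
proof -
  let ?S = "Sigma {A. A \<subseteq> forward \<and> card A = i} Pow"
  define up where "up F = {e \<in> forward. e \<in> F \<or> prod.swap e \<in> F}" for F
  define \<Phi> where "\<Phi> p = snd p \<union> prod.swap ` (fst p - snd p)" for p :: "(nat \<times> nat) set \<times> (nat \<times> nat) set"
  define \<Psi> where "\<Psi> F = (up F, F \<inter> forward)" for F
  have sw: "prod.swap e \<notin> forward" if "e \<in> forward" for e using that by (auto simp: forward_def)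
  have sw_image: "e \<in> prod.swap ` B \<longleftrightarrow> prod.swap e \<in> B" for e :: "nat \<times> nat" and B
    by (metis (no_types, opaque_lifting) imageE imageI swap_swap)
  have inv: "\<Phi> (\<Psi> F) = F" if F: "face F" for F
  proof (rule set_eqI)
    fix e
    have "e \<in> F \<Longrightarrow> e \<in> forward \<or> prod.swap e \<in> forward \<and> prod.swap e \<notin> F"
      using forward_or_swap[of e] swap_notin_face[OF F, of e] subsetD[OF face_in_D[OF F], of e] by blast
    then show "e \<in> \<Phi> (\<Psi> F) \<longleftrightarrow> e \<in> F"
      by (simp only: \<Phi>_def \<Psi>_def up_def fst_conv snd_conv Un_iff sw_image Diff_iff Int_iff mem_Collect_eq swap_swap) blast
  qed
  have "bij_betw \<Phi> ?S {F. face F \<and> card F = i}"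
  proof (rule bij_betwI[where g = \<Psi>])
    show "\<Phi> \<in> ?S \<rightarrow> {F. face F \<and> card F = i}"
    proof
      fix p assume "p \<in> ?S"
      then obtain A B where p: "p = (A, B)" "A \<subseteq> forward" "card A = i" "B \<subseteq> A" by blast
      have mem: "e \<in> \<Phi> p \<longleftrightarrow> e \<in> B \<or> prod.swap e \<in> A \<and> prod.swap e \<notin> B" for e
        by (simp only: \<Phi>_def p(1) fst_conv snd_conv Un_iff sw_image Diff_iff)
      have "face (\<Phi> p)"
      proof (rule forest_face[OF acyclic])
        have A: "A \<subseteq> D" using p(2) by (auto simp: forward_def)
        show "\<Phi> p \<subseteq> D"
        proof
          fix e assume "e \<in> \<Phi> p"
          hence "e \<in> D \<or> prod.swap e \<in> D" using mem[of e] A p(4) by blast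
          then show "e \<in> D" using swap_in_D[of "prod.swap e"] by auto
        qed
        show "prod.swap e \<notin> \<Phi> p" if "e \<in> \<Phi> p" for e
          using that mem[of e] mem[of "prod.swap e"] sw[of e] sw[of "prod.swap e"] p(2,4)
          unfolding swap_swap by blast
      qed
      moreover have "card (\<Phi> p) = i"
        unfolding \<Phi>_def p(1) fst_conv snd_conv card_oriented_subset[OF p(2,4)] by (rule p(3))
      ultimately show "\<Phi> p \<in> {F. face F \<and> card F = i}" by simp
    qed
    show "\<Psi> \<in> {F. face F \<and> card F = i} \<rightarrow> ?S"
    proof
      fix F assume F: "F \<in> {F. face F \<and> card F = i}"
      have sub: "up F \<subseteq> forward" "F \<inter> forward \<subseteq> up F" by (auto simp: up_def)
      have "card (\<Phi> (\<Psi> F)) = i" using inv[of F] F by simp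
      hence "card (up F) = i"
        unfolding \<Phi>_def \<Psi>_def fst_conv snd_conv card_oriented_subset[OF sub] .
      then show "\<Psi> F \<in> ?S" using sub by (simp add: \<Psi>_def)
    qed
    show "\<Psi> (\<Phi> p) = p" if "p \<in> ?S" for p
    proof -
      obtain A B where p: "p = (A, B)" "A \<subseteq> forward" "B \<subseteq> A" using \<open>p \<in> ?S\<close> by blast
      have mem: "e \<in> \<Phi> p \<longleftrightarrow> e \<in> B \<or> prod.swap e \<in> A \<and> prod.swap e \<notin> B" for e
        by (simp only: \<Phi>_def p(1) fst_conv snd_conv Un_iff sw_image Diff_iff)
      have "e \<in> up (\<Phi> p) \<longleftrightarrow> e \<in> A" for e
        using mem[of e] mem[of "prod.swap e"] sw[of e] p(2,3)
        unfolding swap_swap up_def mem_Collect_eq by blast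
      moreover have "e \<in> \<Phi> p \<inter> forward \<longleftrightarrow> e \<in> B" for e
        using mem[of e] sw[of e] p(2,3) by blast
      ultimately show ?thesis unfolding \<Psi>_def p(1) by blast
    qed
    show "\<Phi> (\<Psi> F) = F" if "F \<in> {F. face F \<and> card F = i}" for F using inv that by simp
  qed
  hence "f_count i = card ?S" unfolding f_count_def by (rule bij_betw_same_card[symmetric])
  also have "\<dots> = (\<Sum>A\<in>{A. A \<subseteq> forward \<and> card A = i}. card (Pow A))"
    by (rule card_SigmaI) (use finite_forward in \<open>auto intro: finite_subset\<close>)
  also have "\<dots> = (\<Sum>A\<in>{A. A \<subseteq> forward \<and> card A = i}. 2 ^ i)"
    by (rule sum.cong[OF refl]) (use finite_subset[OF _ finite_forward] in \<open>auto simp: card_Pow\<close>)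
  also have "\<dots> = (rank choose i) * 2 ^ i"
    by (simp add: n_subsets[OF finite_forward] forest_rank[OF acyclic])
  finally show ?thesis .
qed

text \<open>
  The face numbers of a cross-polytope determine its h-vector by inverting a triangular system.
\<close>

lemma forest_h_count:
  assumes acyclic: "acyclic_edges"
    and v: "generic v" and "j \<le> rank"
  shows "h_count v j = rank choose j"
  using \<open>j \<le> rank\<close>
proof (induction j rule: less_induct)
  case (less l)
  have split: "(\<Sum>j\<le>l. g j * ((rank - j) choose (l - j))) = g l + (\<Sum>j<l. g j * ((rank - j) choose (l - j)))"
    for g :: "nat \<Rightarrow> nat"
    by (simp add: lessThan_Suc_atMost[symmetric])
  have "(\<Sum>j\<le>l. h_count v j * ((rank - j) choose (l - j))) =
      (\<Sum>j\<le>l. (rank choose j) * ((rank - j) choose (l - j)))"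
    using f_count_eq_h_count_sum_le[OF v less.prems] forest_f_count[OF acyclic, of l]
      sum_choose_mult_choose[OF less.prems] by simp
  moreover have "(\<Sum>j<l. h_count v j * ((rank - j) choose (l - j))) =
      (\<Sum>j<l. (rank choose j) * ((rank - j) choose (l - j)))"
    by (rule sum.cong[OF refl]) (use less in auto)
  ultimately show ?case unfolding split by simp
qed

theorem forest_gamma_vector:
  assumes acyclic: "acyclic_edges"
    and "l \<ge> 1"
  shows "gamma_vector P l = 0"
proof -
  obtain v where v: "generic v" using generic_exists by blast
  define g :: "nat \<Rightarrow> int" where "g i = (if i = 0 then 1 else 0)" for i
  have pal: "int (h_count v j) = int (h_count v (rank - j))" if "j \<le> rank" for j
    using h_count_palindromic[OF v that] by simp
  have "(\<Sum>i\<le>rank div 2. monom (g i) i * [:1, 1:] ^ (rank - 2 * i)) = (\<Sum>i\<in>{0}. monom (g i) i * [:1, 1:] ^ (rank - 2 * i))"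
    by (rule sum.mono_neutral_right) (auto simp: g_def)
  also have "\<dots> = [:1, 1:] ^ rank" by (simp add: g_def)
  also have "\<dots> = (\<Sum>j\<le>rank. monom (int (h_count v j)) j)"
  proof (rule poly_eqI)
    fix j
    show "coeff ([:1, 1:] ^ rank) j = coeff (\<Sum>j\<le>rank. monom (int (h_count v j)) j) j"
      unfolding coeff_one_plus_x_power coeff_sum_monom
      using forest_h_count[OF acyclic v, of j] by (auto simp: not_le)
  qed
  finally have "(\<forall>i>rank div 2. g i = 0) \<and>
    (\<Sum>i\<le>rank div 2. monom (g i) i * [:1, 1:] ^ (rank - 2 * i)) = (\<Sum>j\<le>rank. monom (int (h_count v j)) j)"
    by (simp add: g_def)
  hence "g = gamma_vector P"
    unfolding gamma_vector_eq[OF v]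
    by (simp only: gamma_expansion_palindromic[of rank "\<lambda>j. int (h_count v j)", OF pal])
  then show ?thesis using \<open>l \<ge> 1\<close> by (metis g_def not_one_le_zero)
qed

end

section \<open>Gamma-vectors of forests and of sparse graphs\<close>

lemma edge_polytope_weights:
  assumes "E \<subseteq> possible_edges n"
  obtains w where "edge_polytope E w"
proof -
  have E: "card e = 2" "e \<subseteq> {1..n}" if "e \<in> E" for e using assms that by (auto simp: possible_edges_def)
  have "edge_arcs E \<subseteq> {1..n} \<times> {1..n}" using E(2) by (auto simp: edge_arcs_def)
  hence fin: "finite (edge_arcs E)" by (rule finite_subset) simp
  have loop: "fst e \<noteq> snd e" if "e \<in> edge_arcs E" for e
    using E(1)[of "{fst e, snd e}"] that by (auto simp: edge_arcs_def)
  interpret arc_system "edge_arcs E" by unfold_locales (fact fin, fact loop)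
  obtain w :: "nat \<times> nat \<Rightarrow> nat" where w: "\<And>u :: nat \<times> nat \<Rightarrow> real. \<forall>e\<in>edge_arcs E. u e \<in> {-1, 0, 1} \<Longrightarrow>
    ((\<exists>e\<in>edge_arcs E. u e \<noteq> 0) \<longrightarrow> (\<Sum>e\<in>edge_arcs E. real (w e) * u e) \<noteq> 0) \<and>
    ((\<Sum>e\<in>edge_arcs E. u e) > 0 \<longrightarrow> (\<Sum>e\<in>edge_arcs E. real (w e) * u e) > 0)"
    using length_dominated_separating_weights[OF fin] by blast
  have "edge_polytope E w"
  proof unfold_locales
    fix u e assume u: "unit_circulation u" "e \<in> edge_arcs E" "u e \<noteq> 0"
    have "\<forall>e\<in>edge_arcs E. u e \<in> {-1, 0, 1}" using u(1) unfolding unit_circulation_def by (rule conjunct1)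
    then show "(\<Sum>e\<in>edge_arcs E. real (w e) * u e) \<noteq> 0" using w[of u] u(2,3) by blast
  next
    fix u assume u: "unit_circulation u" "(\<Sum>e\<in>edge_arcs E. u e) > 0"
    have "\<forall>e\<in>edge_arcs E. u e \<in> {-1, 0, 1}" using u(1) unfolding unit_circulation_def by (rule conjunct1)
    then show "(\<Sum>e\<in>edge_arcs E. real (w e) * u e) > 0" using w[of u] u(2) by blast
  qed (rule E(1))
  then show ?thesis by (rule that)
qed

theorem gamma_vector_no_closed_trail:
  assumes "E \<subseteq> possible_edges n"
    and no_trail: "\<not> has_closed_trail E"
    and "l \<ge> 1"
  shows "gamma_vector (symmetric_edge_polytope E) l = 0"
proof -
  obtain w where "edge_polytope E w" using edge_polytope_weights[OF assms(1)] .
  then interpret edge_polytope E w .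
  show ?thesis
  proof (rule forest_gamma_vector[OF _ \<open>l \<ge> 1\<close>], unfold acyclic_edges_def, intro allI impI ballI, rule ccontr)
    fix z e assume "bd z = 0" "\<forall>e\<in>D. snd e < fst e \<longrightarrow> z e = 0" "e \<in> D" "z e \<noteq> 0"
    then show False using closed_trail_of_cycle[of z e] no_trail by blast
  qed
qed

text \<open>
  The sparsity hypothesis is the one of \<open>many_faces\<close> for faces with \<open>2 k\<close> arcs. The existence of such a
  face forces the dimension to be at least \<open>2 k\<close>, so that none of the entries up to \<open>k\<close> is beyond the end
  of the gamma-vector. The other hypothesis makes the error term of \<open>gamma_vector_bounds\<close> at most half
  of the guaranteed number of faces.
\<close>

theorem gamma_vector_sparse_bounds:
  assumes E: "E \<subseteq> possible_edges n" and l: "0 < l" "l \<le> k" and "E \<noteq> {}"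
    and sparse: "8 * k ^ 2 * card (adjacent_pairs E) \<le> card E ^ 2"
    and many: "4 * k ^ k * 8 ^ k * n \<le> card E"
  shows "int (card E) ^ l \<le> 4 * int k ^ k * gamma_vector (symmetric_edge_polytope E) l"
    and "gamma_vector (symmetric_edge_polytope E) l \<le> 4 ^ l * int (card E) ^ l"
proof -
  obtain w where "edge_polytope E w" using edge_polytope_weights[OF E] .
  then interpret edge_polytope E w .
  let ?N = "card E" and ?Y = "card (adjacent_pairs E)"
  have N: "?N > 0" using \<open>E \<noteq> {}\<close> finite_E by (simp add: card_gt_0_iff)
  have "2 * (2 * k) ^ 2 * ?Y \<le> ?N ^ 2" using sparse by (simp add: power_mult_distrib)
  hence "?N ^ (2 * k) \<le> 2 * (2 * k) ^ (2 * k) * f_count (2 * k)"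
    using l by (intro many_faces) auto
  moreover have "?N ^ (2 * k) > 0" using N by simp
  ultimately have "f_count (2 * k) > 0" by (cases "f_count (2 * k) = 0") auto
  hence "{H. face H \<and> card H = 2 * k} \<noteq> {}" unfolding f_count_def by (metis card.empty less_irrefl)
  hence "2 * k \<le> rank" using card_face_le_rank by fastforce
  hence l_rank: "l \<le> rank div 2" using l by linarith
  have vertices: "\<Union>E \<subseteq> {1..n}" using E by (auto simp: possible_edges_def)
  note bounds = gamma_vector_bounds[OF l_rank vertices]
  have "gamma_vector P l \<le> 2 ^ l * int (card D) ^ l" using bounds(1) by linarith
  also have "\<dots> \<le> 2 ^ l * (2 * int ?N) ^ l"
    using card_D_le by (intro mult_left_mono power_mono) auto
  also have "\<dots> = 4 ^ l * int ?N ^ l" by (simp add: power_mult_distrib flip: power_mult_distrib[of 2 2])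
  finally show "gamma_vector P l \<le> 4 ^ l * int ?N ^ l" .
  have "2 * l ^ 2 * ?Y \<le> 8 * k ^ 2 * ?Y"
    using l by (intro mult_right_mono mult_mono power_mono) auto
  hence "2 * l ^ 2 * ?Y \<le> ?N ^ 2" using sparse by linarith
  hence "?N ^ l \<le> 2 * l ^ l * f_count l" by (rule many_faces[OF l(1)])
  also have "\<dots> \<le> 2 * k ^ k * f_count l"
  proof -
    have "l ^ l \<le> k ^ l" using l(2) by (rule power_mono) simp
    also have "\<dots> \<le> k ^ k" using l by (intro power_increasing) auto
    finally show ?thesis by (intro mult_right_mono mult_left_mono) simp_all
  qed
  finally have faces: "?N ^ l \<le> 2 * k ^ k * f_count l" .
  have err: "4 * k ^ k * (2 ^ (2 * l) * n * card D ^ (l - 1)) \<le> ?N ^ l"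
  proof -
    have "(2 :: nat) ^ (2 * l) * n * card D ^ (l - 1) \<le> 4 ^ k * n * (2 ^ k * ?N ^ (l - 1))"
    proof (rule mult_mono)
      have "(2 :: nat) ^ (2 * l) = 4 ^ l" by (simp add: power_mult)
      also have "\<dots> \<le> 4 ^ k" using l(2) by (rule power_increasing) simp
      finally show "(2 :: nat) ^ (2 * l) * n \<le> 4 ^ k * n" by (rule mult_right_mono) simp
      have "card D ^ (l - 1) \<le> (2 * ?N) ^ (l - 1)" using card_D_le by (rule power_mono) simp
      also have "\<dots> = 2 ^ (l - 1) * ?N ^ (l - 1)" by (rule power_mult_distrib)
      also have "\<dots> \<le> 2 ^ k * ?N ^ (l - 1)"
        using l(2) by (intro mult_right_mono power_increasing) auto
      finally show "card D ^ (l - 1) \<le> 2 ^ k * ?N ^ (l - 1)" .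
    qed simp_all
    hence "4 * k ^ k * (2 ^ (2 * l) * n * card D ^ (l - 1)) \<le> 4 * k ^ k * (4 ^ k * n * (2 ^ k * ?N ^ (l - 1)))"
      by (rule mult_left_mono) simp
    also have "\<dots> = 4 * k ^ k * ((4 ^ k * 2 ^ k) * n) * ?N ^ (l - 1)" by (simp only: ac_simps)
    also have "(4 :: nat) ^ k * 2 ^ k = 8 ^ k" by (simp flip: power_mult_distrib)
    also have "4 * k ^ k * (8 ^ k * n) * ?N ^ (l - 1) \<le> ?N * ?N ^ (l - 1)"
      using many by (intro mult_right_mono) (simp_all add: ac_simps)
    also have "\<dots> = ?N ^ l" using l(1) by (cases l) simp_all
    finally show ?thesis .
  qed
  have "4 * int k ^ k * (int (f_count l) - 2 ^ (2 * l) * int n * int (card D) ^ (l - 1)) \<le>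
      4 * int k ^ k * gamma_vector P l"
    by (rule mult_left_mono[OF bounds(2)[OF l(1)]]) simp
  moreover have "4 * int k ^ k * (int (f_count l) - 2 ^ (2 * l) * int n * int (card D) ^ (l - 1)) =
      2 * int (2 * k ^ k * f_count l) - int (4 * k ^ k * (2 ^ (2 * l) * n * card D ^ (l - 1)))"
    by (simp add: algebra_simps)
  moreover have "int (?N ^ l) \<le> int (2 * k ^ k * f_count l)" using faces by (rule of_nat_mono)
  moreover have "int (4 * k ^ k * (2 ^ (2 * l) * n * card D ^ (l - 1))) \<le> int (?N ^ l)"
    using err by (rule of_nat_mono)
  ultimately have "int (?N ^ l) \<le> 4 * int k ^ k * gamma_vector P l" by linarith
  then show "int ?N ^ l \<le> 4 * int k ^ k * gamma_vector P l" by simp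
qed

section \<open>Random graphs\<close>

lemma finite_possible_edges: "finite (possible_edges n)"
  by (rule finite_subset[of _ "Pow {1..n}"]) (auto simp: possible_edges_def)

lemma card_possible_edges: "card (possible_edges n) = n choose 2"
  unfolding possible_edges_def by (subst n_subsets) simp_all

lemma set_erdos_renyi: "E \<in> set_pmf (erdos_renyi n p) \<Longrightarrow> E \<subseteq> possible_edges n"
  by (auto simp: erdos_renyi_def)

lemma finite_set_erdos_renyi: "finite (set_pmf (erdos_renyi n p))"
  by (rule finite_subset[of _ "Pow (possible_edges n)"]) (auto dest: set_erdos_renyi simp: finite_possible_edges)

lemma prob_contains_edges:
  assumes "0 \<le> p" "p \<le> 1" "T \<subseteq> possible_edges n"
  shows "measure_pmf.prob (erdos_renyi n p) {E. T \<subseteq> E} = p ^ card T"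
proof -
  let ?B = "\<lambda>e. if e \<in> T then {True} else UNIV"
  have vimage: "(\<lambda>f. {e \<in> possible_edges n. f e}) -` {E. T \<subseteq> E} = Pi (possible_edges n) ?B"
    using assms(3) by (auto simp: Pi_iff split: if_splits)
  have "measure_pmf.prob (erdos_renyi n p) {E. T \<subseteq> E} =
      (\<Prod>e\<in>possible_edges n. measure_pmf.prob (bernoulli_pmf p) (?B e))"
    unfolding erdos_renyi_def measure_map_pmf vimage by (rule measure_Pi_pmf_Pi[OF finite_possible_edges])
  also have "\<dots> = (\<Prod>e\<in>possible_edges n. if e \<in> T then p else 1)"
    by (rule prod.cong[OF refl]) (use assms(1,2) in \<open>simp add: measure_pmf_single\<close>)
  also have "\<dots> = p ^ card T"
    using assms(3) finite_possible_edges[of n] by (simp add: prod.If_cases Int_absorb1)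
  finally show ?thesis .
qed

lemma integrable_erdos_renyi: "integrable (measure_pmf (erdos_renyi n p)) (f :: _ \<Rightarrow> real)"
  by (rule integrable_measure_pmf_finite[OF finite_set_erdos_renyi])

lemma expectation_count_copies:
  assumes "0 \<le> p" "p \<le> 1" "finite I" "\<And>i. i \<in> I \<Longrightarrow> S i \<subseteq> possible_edges n"
  shows "measure_pmf.expectation (erdos_renyi n p) (\<lambda>E. real (card {i \<in> I. S i \<subseteq> E})) =
    (\<Sum>i\<in>I. p ^ card (S i))"
proof -
  have "real (card {i \<in> I. S i \<subseteq> E}) = (\<Sum>i\<in>I. indicator {E. S i \<subseteq> E} E)" for E
    using assms(3) by (simp add: indicator_def sum.If_cases Int_def)
  hence "measure_pmf.expectation (erdos_renyi n p) (\<lambda>E. real (card {i \<in> I. S i \<subseteq> E})) =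
      (\<Sum>i\<in>I. measure_pmf.expectation (erdos_renyi n p) (indicator {E. S i \<subseteq> E}))"
    by (simp only: Bochner_Integration.integral_sum[OF integrable_erdos_renyi])
  also have "\<dots> = (\<Sum>i\<in>I. p ^ card (S i))"
    by (rule sum.cong[OF refl]) (simp add: prob_contains_edges assms)
  finally show ?thesis .
qed

lemma markov_erdos_renyi:
  fixes f :: "nat set set \<Rightarrow> real"
  assumes "\<And>E. f E \<ge> 0" "c > 0"
  shows "measure_pmf.prob (erdos_renyi n p) {E. f E \<ge> c} \<le>
    measure_pmf.expectation (erdos_renyi n p) f / c"
  using integral_Markov_inequality_measure[OF integrable_erdos_renyi, of "{}" n p f c] assms by simp

lemma prob_mono_erdos_renyi:
  assumes "\<And>E. E \<subseteq> possible_edges n \<Longrightarrow> E \<in> A \<Longrightarrow> E \<in> B"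
  shows "measure_pmf.prob (erdos_renyi n p) A \<le> measure_pmf.prob (erdos_renyi n p) B"
  by (rule measure_pmf.finite_measure_mono_AE) (auto simp: AE_measure_pmf_iff intro!: assms dest: set_erdos_renyi)

lemma asymptotically_almost_surelyI:
  assumes "eventually (\<lambda>n. measure_pmf.prob (M n) {x. \<not> P n x} \<le> err n) sequentially"
    and "err \<longlonglongrightarrow> 0"
  shows "asymptotically_almost_surely M P"
  unfolding asymptotically_almost_surely_def
proof (rule tendsto_sandwich)
  have compl: "measure_pmf.prob (M n) {x. P n x} = 1 - measure_pmf.prob (M n) {x. \<not> P n x}" for n
    by (subst measure_pmf.prob_compl[symmetric]) (auto intro!: arg_cong[where f = "measure_pmf.prob (M n)"])
  show "eventually (\<lambda>n. 1 - err n \<le> measure_pmf.prob (M n) {x. P n x}) sequentially"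
    using assms(1) by eventually_elim (simp add: compl)
  show "(\<lambda>n. 1 - err n) \<longlonglongrightarrow> 1" using tendsto_diff[OF tendsto_const assms(2), of 1] by simp
  show "eventually (\<lambda>n. measure_pmf.prob (M n) {x. P n x} \<le> 1) sequentially" by simp
qed (rule tendsto_const)

subsection \<open>Closed trails\<close>

lemma length_trail_edges: "length (trail_edges ts) = length ts"
  by (simp add: trail_edges_def)

lemma set_subset_trail_edges: "set ts \<subseteq> \<Union> (set (trail_edges ts))"
proof
  fix x assume "x \<in> set ts"
  then obtain i where "i < length ts" "x = ts ! i" by (metis in_set_conv_nth)
  hence "{x, rotate1 ts ! i} \<in> set (trail_edges ts)"
    unfolding in_set_conv_nth length_trail_edges by (intro exI[of _ i]) (simp add: trail_edges_def)
  then show "x \<in> \<Union> (set (trail_edges ts))" by blast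
qed

text \<open>
  A closed trail with \<open>k\<close> edges is one of at most \<open>n\<^sup>k\<close> vertex lists, and it is present with probability
  \<open>p\<^sup>k\<close> since its edges are distinct, even if vertices are repeated. The bound is the sum of the
  geometric series.
\<close>

lemma prob_closed_trail_le:
  assumes "0 \<le> p" "p \<le> 1" "real n * p < 1"
  shows "measure_pmf.prob (erdos_renyi n p) {E. has_closed_trail E} \<le>
    real n * p / (1 - real n * p)"
proof -
  let ?M = "erdos_renyi n p" and ?x = "real n * p"
  define m where "m = card (possible_edges n)"
  define \<T> where "\<T> k = {ts. set ts \<subseteq> {1..n} \<and> length ts = Suc k \<and> distinct (trail_edges ts) \<and>
    set (trail_edges ts) \<subseteq> possible_edges n}" for k
  have \<T>: "finite (\<T> k)" "card (\<T> k) \<le> n ^ Suc k" for k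
  proof -
    have sub: "\<T> k \<subseteq> {ts. set ts \<subseteq> {1..n} \<and> length ts = Suc k}" by (auto simp: \<T>_def)
    have fin: "finite {ts. set ts \<subseteq> {1..n} \<and> length ts = Suc k}" by (rule finite_lists_length_eq) simp
    show "finite (\<T> k)" by (rule finite_subset[OF sub fin])
    have "card {ts. set ts \<subseteq> {1..n} \<and> length ts = Suc k} = n ^ Suc k"
      using card_lists_length_eq[of "{1..n}" "Suc k"] by (simp only: finite_atLeastAtMost card_atLeastAtMost) simp
    then show "card (\<T> k) \<le> n ^ Suc k" using card_mono[OF fin sub] by simp
  qed
  have "measure_pmf.prob ?M {E. has_closed_trail E} \<le>
      measure_pmf.prob ?M (\<Union>k\<in>{..<m}. \<Union>ts\<in>\<T> k. {E. set (trail_edges ts) \<subseteq> E})"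
  proof (rule prob_mono_erdos_renyi)
    fix E assume E: "E \<subseteq> possible_edges n"
      and "E \<in> {E. has_closed_trail E}"
    then obtain ts where ts: "ts \<noteq> []" "distinct (trail_edges ts)" "set (trail_edges ts) \<subseteq> E"
      by (auto simp: has_closed_trail_def)
    have "length ts = card (set (trail_edges ts))" using distinct_card[OF ts(2)] by (simp add: length_trail_edges)
    also have "\<dots> \<le> m" unfolding m_def by (rule card_mono[OF finite_possible_edges]) (use ts(3) E in blast)
    finally have "length ts \<le> m" .
    then obtain k where k: "length ts = Suc k" "k < m" using ts(1) by (cases "length ts") auto
    have "set ts \<subseteq> {1..n}"
      using set_subset_trail_edges[of ts] ts(3) E by (auto simp: possible_edges_def)
    hence "ts \<in> \<T> k" using ts k(1) E by (auto simp: \<T>_def)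
    then show "E \<in> (\<Union>k\<in>{..<m}. \<Union>ts\<in>\<T> k. {E. set (trail_edges ts) \<subseteq> E})"
      using k(2) ts(3) by blast
  qed
  also have "\<dots> \<le> (\<Sum>k<m. measure_pmf.prob ?M (\<Union>ts\<in>\<T> k. {E. set (trail_edges ts) \<subseteq> E}))"
    by (rule measure_pmf.finite_measure_subadditive_finite) auto
  also have "\<dots> \<le> (\<Sum>k<m. ?x ^ Suc k)"
  proof (rule sum_mono)
    fix k
    have "measure_pmf.prob ?M (\<Union>ts\<in>\<T> k. {E. set (trail_edges ts) \<subseteq> E}) \<le>
        (\<Sum>ts\<in>\<T> k. measure_pmf.prob ?M {E. set (trail_edges ts) \<subseteq> E})"
      by (rule measure_pmf.finite_measure_subadditive_finite[OF \<T>(1)]) auto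
    also have "\<dots> = (\<Sum>ts\<in>\<T> k. p ^ Suc k)"
    proof (rule sum.cong[OF refl])
      fix ts assume ts: "ts \<in> \<T> k"
      hence "card (set (trail_edges ts)) = Suc k"
        using distinct_card[of "trail_edges ts"] by (simp add: \<T>_def length_trail_edges)
      then show "measure_pmf.prob ?M {E. set (trail_edges ts) \<subseteq> E} = p ^ Suc k"
        using prob_contains_edges[OF assms(1,2), of "set (trail_edges ts)" n] ts by (simp add: \<T>_def)
    qed
    also have "\<dots> = real (card (\<T> k)) * p ^ Suc k" by simp
    also have "\<dots> \<le> real (n ^ Suc k) * p ^ Suc k"
      using \<T>(2)[of k] assms(1) by (intro mult_right_mono) (simp_all only: of_nat_le_iff zero_le_power)
    also have "\<dots> = ?x ^ Suc k" by (simp only: power_mult_distrib of_nat_power)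
    finally show "measure_pmf.prob ?M (\<Union>ts\<in>\<T> k. {E. set (trail_edges ts) \<subseteq> E}) \<le> ?x ^ Suc k" .
  qed
  also have "\<dots> = ?x * (\<Sum>k<m. ?x ^ k)" by (simp add: sum_distrib_left)
  also have "\<dots> \<le> ?x * (1 / (1 - ?x))"
  proof (rule mult_left_mono)
    have "(1 - ?x) * (\<Sum>k<m. ?x ^ k) = 1 - ?x ^ m" by (rule one_diff_power_eq[symmetric])
    also have "\<dots> \<le> 1" using assms(1) by simp
    finally show "(\<Sum>k<m. ?x ^ k) \<le> 1 / (1 - ?x)" using assms(3) by (simp add: field_simps)
  qed (use assms(1) in simp)
  finally show ?thesis by simp
qed

subsection \<open>Numbers of edges and of adjacent pairs\<close>

text \<open>
  Chebyshev's inequality. Ordered pairs of distinct edges contribute at most \<open>\<mu>\<^sup>2\<close> to the second moment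
  and the diagonal contributes \<open>\<mu>\<close>, so the variance is at most \<open>\<mu>\<close>.
\<close>

lemma prob_edge_number_deviates:
  assumes "0 < p" "p \<le> 1" "n \<ge> 2"
  defines "\<mu> \<equiv> real (n choose 2) * p"
  shows "measure_pmf.prob (erdos_renyi n p) {E. \<bar>real (card E) - \<mu>\<bar> \<ge> \<mu> / 2} \<le> 4 / \<mu>"
proof -
  let ?M = "erdos_renyi n p" and ?Q = "possible_edges n"
  let ?N = "\<lambda>E. real (card {e \<in> ?Q. {e} \<subseteq> E})"
  let ?N2 = "\<lambda>E. real (card {i \<in> ?Q \<times> ?Q. {fst i, snd i} \<subseteq> E})"
  define m where "m = card ?Q"
  have \<mu>: "\<mu> = real m * p" by (simp add: \<mu>_def m_def card_possible_edges)
  have "n choose 2 > 0" using assms(3) by simp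
  hence \<mu>_pos: "\<mu> > 0" using assms(1) by (simp add: \<mu>_def)
  have E1: "measure_pmf.expectation ?M ?N = \<mu>"
    by (subst expectation_count_copies) (use assms finite_possible_edges in \<open>auto simp: \<mu> m_def\<close>)
  have "measure_pmf.expectation ?M ?N2 = (\<Sum>i\<in>?Q \<times> ?Q. p ^ card {fst i, snd i})"
    by (rule expectation_count_copies) (use assms finite_possible_edges in auto)
  also have "\<dots> = (\<Sum>a\<in>?Q. \<Sum>b\<in>?Q. p ^ card {a, b})"
    unfolding sum.cartesian_product by (simp add: case_prod_beta)
  also have "\<dots> \<le> (\<Sum>a\<in>?Q. \<Sum>b\<in>?Q. p ^ 2 + (if a = b then p else 0))"
    by (intro sum_mono) (use assms(1) in \<open>auto simp: card_insert_if power2_eq_square\<close>)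
  also have "\<dots> = \<mu> ^ 2 + \<mu>"
    using finite_possible_edges[of n]
    by (simp add: sum.distrib \<mu> m_def power_mult_distrib power2_eq_square algebra_simps)
  finally have E2: "measure_pmf.expectation ?M ?N2 \<le> \<mu> ^ 2 + \<mu>" .
  have N2: "?N2 E = ?N E ^ 2" for E
  proof -
    have "{i \<in> ?Q \<times> ?Q. {fst i, snd i} \<subseteq> E} = {e \<in> ?Q. {e} \<subseteq> E} \<times> {e \<in> ?Q. {e} \<subseteq> E}" by auto
    then show ?thesis by (simp add: card_cartesian_product power2_eq_square)
  qed
  have "measure_pmf.prob ?M {E. \<bar>real (card E) - \<mu>\<bar> \<ge> \<mu> / 2} \<le>
      measure_pmf.prob ?M {E. (?N E - \<mu>) ^ 2 \<ge> (\<mu> / 2) ^ 2}"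
  proof (rule prob_mono_erdos_renyi)
    fix E assume E: "E \<subseteq> ?Q" "E \<in> {E. \<bar>real (card E) - \<mu>\<bar> \<ge> \<mu> / 2}"
    have "{e \<in> ?Q. {e} \<subseteq> E} = E" using E(1) by auto
    then show "E \<in> {E. (?N E - \<mu>) ^ 2 \<ge> (\<mu> / 2) ^ 2}"
      using E(2) \<mu>_pos by (simp add: abs_le_square_iff[symmetric])
  qed
  also have "\<dots> \<le> measure_pmf.expectation ?M (\<lambda>E. (?N E - \<mu>) ^ 2) / (\<mu> / 2) ^ 2"
    by (rule markov_erdos_renyi) (use \<mu>_pos in simp_all)
  also have "measure_pmf.expectation ?M (\<lambda>E. (?N E - \<mu>) ^ 2) =
      measure_pmf.expectation ?M (\<lambda>E. ?N2 E + (\<mu> ^ 2 - 2 * \<mu> * ?N E))"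
    by (simp only: N2 power2_diff) (simp only: algebra_simps)
  also have "\<dots> = measure_pmf.expectation ?M ?N2 + (\<mu> ^ 2 - 2 * \<mu> * measure_pmf.expectation ?M ?N)"
    by (simp only: Bochner_Integration.integral_add[OF integrable_erdos_renyi integrable_erdos_renyi]
      Bochner_Integration.integral_diff[OF integrable_erdos_renyi integrable_erdos_renyi]
      integral_mult_right_zero lebesgue_integral_const measure_pmf.prob_space scaleR_one)
  also have "\<dots> \<le> \<mu>" unfolding E1 using E2 by (simp add: power2_eq_square)
  finally have "measure_pmf.prob ?M {E. \<bar>real (card E) - \<mu>\<bar> \<ge> \<mu> / 2} \<le> \<mu> / (\<mu> / 2) ^ 2"
    using \<mu>_pos by (simp add: divide_right_mono)
  also have "\<dots> = 4 / \<mu>" using \<mu>_pos by (simp add: power2_eq_square)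
  finally show ?thesis .
qed

text \<open>
  Two distinct adjacent edges form a path with two edges if they share a vertex, and otherwise
  they are the first and the last edge of a path with three edges.
\<close>

lemma prob_many_adjacent_pairs:
  assumes p: "0 < p" "p \<le> 1" and "y > 0"
  shows "measure_pmf.prob (erdos_renyi n p)
      {E. real (card (adjacent_pairs E)) \<ge> y}
    \<le> (real n ^ 2 * p + real n ^ 3 * p ^ 2 + real n ^ 4 * p ^ 3) / y"
proof -
  let ?M = "erdos_renyi n p" and ?Q = "possible_edges n"
  let ?V = "{1..n}"
  define I2 where "I2 = {(i, j, k) \<in> ?V \<times> ?V \<times> ?V. i \<noteq> j \<and> j \<noteq> k \<and> i \<noteq> k}"
  define I3 where "I3 = {(i, j, k, l) \<in> ?V \<times> ?V \<times> ?V \<times> ?V. distinct [i, j, k, l]}"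
  define S2 :: "nat \<times> nat \<times> nat \<Rightarrow> nat set set" where "S2 = (\<lambda>(i, j, k). {{i, j}, {j, k}})"
  define S3 :: "nat \<times> nat \<times> nat \<times> nat \<Rightarrow> nat set set" where "S3 = (\<lambda>(i, j, k, l). {{i, j}, {j, k}, {k, l}})"
  have fin2: "finite I2" by (rule finite_subset[of _ "?V \<times> ?V \<times> ?V"]) (auto simp: I2_def)
  have fin3: "finite I3" by (rule finite_subset[of _ "?V \<times> ?V \<times> ?V \<times> ?V"]) (auto simp: I3_def)
  have "card I2 \<le> card (?V \<times> ?V \<times> ?V)" by (rule card_mono) (auto simp: I2_def)
  hence card2: "card I2 \<le> n ^ 3" by (simp add: card_cartesian_product power3_eq_cube)
  have "card I3 \<le> card (?V \<times> ?V \<times> ?V \<times> ?V)" by (rule card_mono) (auto simp: I3_def)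
  hence card3: "card I3 \<le> n ^ 4" by (simp add: card_cartesian_product power4_eq_xxxx)
  have S2: "S2 t \<subseteq> ?Q" "card (S2 t) = 2" if "t \<in> I2" for t
    using that by (auto simp: I2_def S2_def possible_edges_def doubleton_eq_iff)
  have S3: "S3 t \<subseteq> ?Q" "card (S3 t) = 3" if "t \<in> I3" for t
    using that by (auto simp: I3_def S3_def possible_edges_def doubleton_eq_iff)
  let ?f1 = "\<lambda>E. real (card {e \<in> ?Q. {e} \<subseteq> E})"
  let ?f2 = "\<lambda>E. real (card {t \<in> I2. S2 t \<subseteq> E})"
  let ?f3 = "\<lambda>E. real (card {t \<in> I3. S3 t \<subseteq> E})"
  have "measure_pmf.prob ?M {E. real (card (adjacent_pairs E)) \<ge> y} \<le>
      measure_pmf.prob ?M {E. ?f1 E + (?f2 E + ?f3 E) \<ge> y}"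
  proof (rule prob_mono_erdos_renyi)
    fix E assume E: "E \<subseteq> ?Q" and large: "E \<in> {E. real (card (adjacent_pairs E)) \<ge> y}"
    let ?A1 = "(\<lambda>e. (e, e)) ` {e \<in> ?Q. {e} \<subseteq> E}"
    let ?A2 = "(\<lambda>(i, j, k). ({i, j}, {j, k})) ` {t \<in> I2. S2 t \<subseteq> E}"
    let ?A3 = "(\<lambda>(i, j, k, l). ({i, j}, {k, l})) ` {t \<in> I3. S3 t \<subseteq> E}"
    have "(a, b) \<in> ?A1 \<union> (?A2 \<union> ?A3)" if ab: "a \<in> E" "b \<in> E" "adjacent_edges E a b" for a b
    proof -
      have a: "card a = 2" "a \<subseteq> ?V" and b: "card b = 2" "b \<subseteq> ?V"
        using ab E by (auto simp: possible_edges_def)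
      have other: "\<exists>z. z \<noteq> x \<and> e = {x, z}" if "card e = 2" "x \<in> e" for e and x :: nat
        using that by (auto simp: card_2_iff)
      consider "a = b" | "a \<noteq> b" "a \<inter> b \<noteq> {}" | "a \<inter> b = {}" by blast
      then show ?thesis
      proof cases
        case 1
        then show ?thesis using ab E by auto
      next
        case 2
        then obtain j where j: "j \<in> a" "j \<in> b" by blast
        obtain i where i: "i \<noteq> j" "a = {j, i}" using other[OF a(1) j(1)] by blast
        obtain k where k: "k \<noteq> j" "b = {j, k}" using other[OF b(1) j(2)] by blast
        have "(i, j, k) \<in> I2" using i k 2(1) a(2) b(2) by (auto simp: I2_def)
        moreover have "S2 (i, j, k) \<subseteq> E" using ab i k by (simp add: S2_def insert_commute)
        ultimately have "(i, j, k) \<in> {t \<in> I2. S2 t \<subseteq> E}" by simp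
        moreover have "(a, b) = (\<lambda>(i, j, k). ({i, j}, {j, k})) (i, j, k)"
          using i k by (simp add: insert_commute)
        ultimately have "(a, b) \<in> ?A2" by (rule rev_image_eqI)
        then show ?thesis by blast
      next
        case 3
        then obtain j k where jk: "j \<in> a" "k \<in> b" "{j, k} \<in> E"
          using ab(3) unfolding adjacent_edges_def by blast
        obtain i where i: "i \<noteq> j" "a = {j, i}" using other[OF a(1) jk(1)] by blast
        obtain l where l: "l \<noteq> k" "b = {k, l}" using other[OF b(1) jk(2)] by blast
        have "(i, j, k, l) \<in> I3" using i l 3 a(2) b(2) by (auto simp: I3_def)
        moreover have "S3 (i, j, k, l) \<subseteq> E" using ab i l jk(3) by (simp add: S3_def insert_commute)
        ultimately have "(i, j, k, l) \<in> {t \<in> I3. S3 t \<subseteq> E}" by simp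
        moreover have "(a, b) = (\<lambda>(i, j, k, l). ({i, j}, {k, l})) (i, j, k, l)"
          using i l by (simp add: insert_commute)
        ultimately have "(a, b) \<in> ?A3" by (rule rev_image_eqI)
        then show ?thesis by blast
      qed
    qed
    hence "adjacent_pairs E \<subseteq> ?A1 \<union> (?A2 \<union> ?A3)" by (auto simp only: adjacent_pairs_def)
    hence "card (adjacent_pairs E) \<le> card (?A1 \<union> (?A2 \<union> ?A3))"
      by (rule card_mono[rotated]) (use finite_possible_edges fin2 fin3 in auto)
    also have "\<dots> \<le> card ?A1 + (card ?A2 + card ?A3)"
      by (rule order_trans[OF card_Un_le add_left_mono[OF card_Un_le]])
    also have "\<dots> \<le> card {e \<in> ?Q. {e} \<subseteq> E} + (card {t \<in> I2. S2 t \<subseteq> E} + card {t \<in> I3. S3 t \<subseteq> E})"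
      by (intro add_mono card_image_le) (use finite_possible_edges fin2 fin3 in auto)
    finally have "real (card (adjacent_pairs E)) \<le> ?f1 E + (?f2 E + ?f3 E)"
      by (simp only: of_nat_add[symmetric] of_nat_le_iff)
    then show "E \<in> {E. ?f1 E + (?f2 E + ?f3 E) \<ge> y}" using large by simp
  qed
  also have "\<dots> \<le> measure_pmf.expectation ?M (\<lambda>E. ?f1 E + (?f2 E + ?f3 E)) / y"
    by (rule markov_erdos_renyi) (use \<open>y > 0\<close> in simp_all)
  also have "measure_pmf.expectation ?M (\<lambda>E. ?f1 E + (?f2 E + ?f3 E)) =
      measure_pmf.expectation ?M ?f1 + (measure_pmf.expectation ?M ?f2 + measure_pmf.expectation ?M ?f3)"
    by (simp only: Bochner_Integration.integral_add[OF integrable_erdos_renyi integrable_erdos_renyi])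
  also have "\<dots> \<le> real n ^ 2 * p + (real n ^ 3 * p ^ 2 + real n ^ 4 * p ^ 3)"
  proof (intro add_mono)
    have "measure_pmf.expectation ?M ?f1 = real (card ?Q) * p"
      by (subst expectation_count_copies) (use p finite_possible_edges in auto)
    also have "card ?Q \<le> n ^ 2" unfolding card_possible_edges by (rule binomial_le_power) simp
    hence "real (card ?Q) * p \<le> real n ^ 2 * p"
      using p(1) by (intro mult_right_mono) (simp_all flip: of_nat_power)
    finally show "measure_pmf.expectation ?M ?f1 \<le> real n ^ 2 * p" .
    have "measure_pmf.expectation ?M ?f2 = (\<Sum>t\<in>I2. p ^ card (S2 t))"
      by (rule expectation_count_copies) (use p fin2 S2 in auto)
    also have "\<dots> = real (card I2) * p ^ 2" by (simp add: S2)
    also have "\<dots> \<le> real n ^ 3 * p ^ 2"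
      using card2 by (intro mult_right_mono) (simp_all flip: of_nat_power)
    finally show "measure_pmf.expectation ?M ?f2 \<le> real n ^ 3 * p ^ 2" .
    have "measure_pmf.expectation ?M ?f3 = (\<Sum>t\<in>I3. p ^ card (S3 t))"
      by (rule expectation_count_copies) (use p fin3 S3 in auto)
    also have "\<dots> = real (card I3) * p ^ 3" by (simp add: S3)
    also have "\<dots> \<le> real n ^ 4 * p ^ 3"
      using card3 p(1) by (intro mult_right_mono) (simp_all flip: of_nat_power)
    finally show "measure_pmf.expectation ?M ?f3 \<le> real n ^ 4 * p ^ 3" .
  qed
  finally show ?thesis using \<open>y > 0\<close> by (simp add: divide_right_mono add.assoc)
qed

section \<open>The two regimes\<close>

theorem theoremB:
  fixes k :: nat and \<beta> :: real
  assumes "k > 0" and "\<beta> > 0" and "\<beta> \<noteq> 1"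
  shows "(\<beta> > 1 \<longrightarrow>
      asymptotically_almost_surely (\<lambda>n. erdos_renyi n (real n powr (- \<beta>)))
        (\<lambda>n E. \<forall>l\<ge>1. gamma_vector (symmetric_edge_polytope E) l = 0)) \<and>
    (\<beta> < 1 \<longrightarrow>
      (\<exists>c C :: real. 0 < c \<and> c < C \<and>
        asymptotically_almost_surely (\<lambda>n. erdos_renyi n (real n powr (- \<beta>)))
          (\<lambda>n E. \<forall>l. 0 < l \<and> l \<le> k \<longrightarrow>
             c * real n powr ((2 - \<beta>) * real l)
               \<le> real_of_int (gamma_vector (symmetric_edge_polytope E) l) \<and>
             real_of_int (gamma_vector (symmetric_edge_polytope E) l)
               \<le> C * real n powr ((2 - \<beta>) * real l))))"
proof (intro conjI impI)
  let ?p = "\<lambda>n. real n powr (- \<beta>)"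
  assume \<beta>: "\<beta> > 1"
  let ?x = "\<lambda>n. real n * ?p n"
  have x0: "?x \<longlonglongrightarrow> 0" using \<beta> by real_asymp
  show "asymptotically_almost_surely (\<lambda>n. erdos_renyi n (?p n))
      (\<lambda>n E. \<forall>l\<ge>1. gamma_vector (symmetric_edge_polytope E) l = 0)"
  proof (rule asymptotically_almost_surelyI)
    show "(\<lambda>n. ?x n / (1 - ?x n)) \<longlonglongrightarrow> 0"
      using tendsto_divide[OF x0 tendsto_diff[OF tendsto_const x0], of 1] by simp
    have "eventually (\<lambda>n. ?x n < 1) sequentially"
      using order_tendstoD(2)[OF x0, of 1] by simp
    moreover have "eventually (\<lambda>n. n \<ge> 1) sequentially" by (rule eventually_ge_at_top)
    ultimately show "eventually (\<lambda>n. measure_pmf.prob (erdos_renyi n (?p n))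
        {E. \<not> (\<forall>l\<ge>1. gamma_vector (symmetric_edge_polytope E) l = 0)} \<le> ?x n / (1 - ?x n)) sequentially"
    proof eventually_elim
      case (elim n)
      have p: "0 \<le> ?p n" "?p n \<le> 1"
        using elim(2) assms(2) powr_mono[of "- \<beta>" 0 "real n"] by simp_all
      have "measure_pmf.prob (erdos_renyi n (?p n))
          {E. \<not> (\<forall>l\<ge>1. gamma_vector (symmetric_edge_polytope E) l = 0)} \<le>
        measure_pmf.prob (erdos_renyi n (?p n)) {E. has_closed_trail E}"
        by (rule prob_mono_erdos_renyi) (use gamma_vector_no_closed_trail in blast)
      also have "\<dots> \<le> ?x n / (1 - ?x n)" by (rule prob_closed_trail_le[OF p elim(1)])
      finally show ?case .
    qed
  qed
next
  let ?p = "\<lambda>n. real n powr (- \<beta>)"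
  assume \<beta>: "\<beta> < 1"
  let ?m = "\<lambda>n. real n powr (2 - \<beta>)"
  \<comment> \<open>Asymptotically almost surely there are between m / 8 and m edges, where m is n to the power 2 - \<beta>. The
    constants arise from inserting these bounds into the bounds in terms of the number of edges.\<close>
  define c :: real where "c = 1 / (4 * real k ^ k * 8 ^ k)"
  define C :: real where "C = 4 ^ k"
  \<comment> \<open>At most \<epsilon> m ^ 2 adjacent pairs are sparse enough, as 8 k ^ 2 \<epsilon> m ^ 2 = (m / 8) ^ 2.\<close>
  define \<epsilon> :: real where "\<epsilon> = 1 / (512 * real k ^ 2)"
  define K :: nat where "K = 4 * k ^ k * 8 ^ k"
  have \<epsilon>: "\<epsilon> > 0" using assms(1) by (simp add: \<epsilon>_def)
  have c: "c > 0" using assms(1) by (simp add: c_def)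
  have "c < C"
  proof -
    have "1 \<le> real k ^ k" "(1 :: real) \<le> 8 ^ k" using assms(1) by (simp_all add: one_le_power)
    hence "4 * 1 * 1 \<le> 4 * real k ^ k * 8 ^ k" by (intro mult_mono) simp_all
    hence "c \<le> 1 / 4" unfolding c_def by (intro divide_left_mono) simp_all
    moreover have "(1 :: real) \<le> 4 ^ k" by (rule one_le_power) simp
    ultimately show ?thesis unfolding C_def by linarith
  qed
  let ?good = "\<lambda>n E. \<forall>l. 0 < l \<and> l \<le> k \<longrightarrow>
      c * real n powr ((2 - \<beta>) * real l) \<le> real_of_int (gamma_vector (symmetric_edge_polytope E) l) \<and>
      real_of_int (gamma_vector (symmetric_edge_polytope E) l) \<le> C * real n powr ((2 - \<beta>) * real l)"
  let ?Y = "\<lambda>E. card (adjacent_pairs E)"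
  let ?\<mu> = "\<lambda>n. real (n choose 2) * ?p n"
  let ?err = "\<lambda>n. 16 / ?m n + (1 / ?m n + 1 / real n + ?p n) / \<epsilon>"
  have "asymptotically_almost_surely (\<lambda>n. erdos_renyi n (?p n)) ?good"
  proof (rule asymptotically_almost_surelyI)
    have "(\<lambda>n. 16 / ?m n) \<longlonglongrightarrow> 0" using \<beta> by real_asymp
    moreover have "(\<lambda>n. 1 / ?m n) \<longlonglongrightarrow> 0" using \<beta> by real_asymp
    moreover have "(\<lambda>n. 1 / real n) \<longlonglongrightarrow> 0" by real_asymp
    moreover have "?p \<longlonglongrightarrow> 0" using assms(2) by real_asymp
    ultimately have "?err \<longlonglongrightarrow> 0 + (0 + 0 + 0) / \<epsilon>"
      using \<epsilon> by (intro tendsto_add tendsto_divide tendsto_const) simp_all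
    then show "?err \<longlonglongrightarrow> 0" by simp
    have "eventually (\<lambda>n. 8 * real K * real n \<le> ?m n) sequentially" using \<beta> by real_asymp
    moreover have "eventually (\<lambda>n. n \<ge> 2) sequentially" by (rule eventually_ge_at_top)
    ultimately show "eventually (\<lambda>n. measure_pmf.prob (erdos_renyi n (?p n)) {E. \<not> ?good n E} \<le> ?err n) sequentially"
    proof eventually_elim
      case (elim n)
      have n: "real n > 0" "n \<ge> 2" using elim(2) by simp_all
      have p: "0 < ?p n" "?p n \<le> 1"
        using n assms(2) powr_mono[of "- \<beta>" 0 "real n"] by simp_all
      have m: "?m n = real n ^ 2 * ?p n"
        using n(1) by (simp add: powr_diff powr_minus divide_inverse powr_numeral)
      have m_pos: "?m n > 0" using n(1) by simp
      have \<mu>: "?m n / 4 \<le> ?\<mu> n" "?\<mu> n \<le> ?m n / 2"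
      proof -
        have choose: "real (n choose 2) = real n * (real n - 1) / 2"
          using n(2) by (simp add: choose_two real_of_nat_div of_nat_diff)
        have "real n * (real n / 2) \<le> real n * (real n - 1)"
          using n by (intro mult_left_mono) simp_all
        hence "real n ^ 2 / 4 \<le> real (n choose 2)" "real (n choose 2) \<le> real n ^ 2 / 2"
          by (simp_all add: choose power2_eq_square algebra_simps)
        from mult_right_mono[OF this(1), of "?p n"] mult_right_mono[OF this(2), of "?p n"]
        show "?m n / 4 \<le> ?\<mu> n" "?\<mu> n \<le> ?m n / 2" using p(1) by (simp_all add: m)
      qed
      let ?A = "{E. \<bar>real (card E) - ?\<mu> n\<bar> \<ge> ?\<mu> n / 2}"
      let ?B = "{E. real (?Y E) \<ge> \<epsilon> * ?m n ^ 2}"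
      have "measure_pmf.prob (erdos_renyi n (?p n)) {E. \<not> ?good n E} \<le>
          measure_pmf.prob (erdos_renyi n (?p n)) (?A \<union> ?B)"
      proof (rule prob_mono_erdos_renyi)
        fix E assume E: "E \<subseteq> possible_edges n" and "E \<in> {E. \<not> ?good n E}"
        show "E \<in> ?A \<union> ?B"
        proof (rule ccontr)
          assume "E \<notin> ?A \<union> ?B"
          hence A: "\<bar>real (card E) - ?\<mu> n\<bar> < ?\<mu> n / 2" and B: "real (?Y E) < \<epsilon> * ?m n ^ 2"
            by simp_all
          have N_ge: "?m n / 8 \<le> real (card E)" and N_le: "real (card E) \<le> ?m n"
            using A \<mu> m_pos by linarith+
          have "E \<noteq> {}" using N_ge m_pos by auto
          have sparse: "8 * k ^ 2 * ?Y E \<le> card E ^ 2"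
          proof -
            have "real (8 * k ^ 2 * ?Y E) = 8 * real k ^ 2 * real (?Y E)" by simp
            also have "\<dots> \<le> 8 * real k ^ 2 * (\<epsilon> * ?m n ^ 2)"
              using B by (intro mult_left_mono) simp_all
            also have "\<dots> = (?m n / 8) ^ 2" using assms(1) by (simp add: \<epsilon>_def power_divide)
            also have "\<dots> \<le> real (card E) ^ 2" using N_ge m_pos by (intro power_mono) simp_all
            finally have "real (8 * k ^ 2 * ?Y E) \<le> real (card E ^ 2)" by simp
            then show ?thesis by (simp only: of_nat_le_iff)
          qed
          have many: "4 * k ^ k * 8 ^ k * n \<le> card E"
          proof -
            have "real (K * n) \<le> real (card E)" using elim(1) N_ge by simp
            then show ?thesis unfolding K_def by (simp only: of_nat_le_iff)
          qed
          have "?good n E"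
          proof (intro allI impI)
            fix l assume "0 < l \<and> l \<le> k"
            hence l: "0 < l" "l \<le> k" by simp_all
            let ?g = "real_of_int (gamma_vector (symmetric_edge_polytope E) l)"
            note bounds = gamma_vector_sparse_bounds[OF E l \<open>E \<noteq> {}\<close> sparse many]
            have powr: "real n powr ((2 - \<beta>) * real l) = ?m n ^ l"
              using n(1) by (simp add: powr_power mult.commute)
            have "real_of_int (int (card E) ^ l) \<le>
                real_of_int (4 * int k ^ k * gamma_vector (symmetric_edge_polytope E) l)"
              using bounds(1) by (simp only: of_int_le_iff)
            hence lower: "real (card E) ^ l \<le> 4 * real k ^ k * ?g" by simp
            have "?g \<le> real_of_int (4 ^ l * int (card E) ^ l)"
              using bounds(2) by (simp only: of_int_le_iff)
            hence upper: "?g \<le> 4 ^ l * real (card E) ^ l" by simp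
            have "c * ?m n ^ l \<le> (?m n / 8) ^ l / (4 * real k ^ k)"
            proof -
              have "(1 :: real) / 8 ^ k \<le> 1 / 8 ^ l"
                using l(2) by (intro divide_left_mono power_increasing) simp_all
              hence "?m n ^ l / (4 * real k ^ k) * (1 / 8 ^ k) \<le> ?m n ^ l / (4 * real k ^ k) * (1 / 8 ^ l)"
                by (intro mult_left_mono) simp_all
              then show ?thesis by (simp add: c_def power_divide mult.commute)
            qed
            also have "\<dots> \<le> real (card E) ^ l / (4 * real k ^ k)"
              using N_ge m_pos by (intro divide_right_mono power_mono) simp_all
            also have "\<dots> \<le> ?g" using lower assms(1) by (simp add: divide_le_eq mult.commute)
            finally have "c * ?m n ^ l \<le> ?g" .
            moreover have "?g \<le> C * ?m n ^ l"
            proof -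
              have "4 ^ l * real (card E) ^ l \<le> 4 ^ k * ?m n ^ l"
                using N_le l(2) by (intro mult_mono power_mono power_increasing) simp_all
              then show ?thesis using upper by (simp add: C_def)
            qed
            ultimately show "c * real n powr ((2 - \<beta>) * real l) \<le> ?g \<and> ?g \<le> C * real n powr ((2 - \<beta>) * real l)"
              unfolding powr by simp
          qed
          then show False using \<open>E \<in> {E. \<not> ?good n E}\<close> by blast
        qed
      qed
      also have "\<dots> \<le> measure_pmf.prob (erdos_renyi n (?p n)) ?A + measure_pmf.prob (erdos_renyi n (?p n)) ?B"
        by (rule measure_Un_le) simp_all
      also have "\<dots> \<le> 16 / ?m n + (1 / ?m n + 1 / real n + ?p n) / \<epsilon>"
      proof (rule add_mono)
        have "measure_pmf.prob (erdos_renyi n (?p n)) ?A \<le> 4 / ?\<mu> n"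
          by (rule prob_edge_number_deviates[OF p n(2)])
        also have "\<dots> \<le> 4 / (?m n / 4)" using \<mu>(1) m_pos by (intro frac_le) linarith+
        finally show "measure_pmf.prob (erdos_renyi n (?p n)) ?A \<le> 16 / ?m n" by simp
        have "measure_pmf.prob (erdos_renyi n (?p n)) ?B \<le>
            (real n ^ 2 * ?p n + real n ^ 3 * ?p n ^ 2 + real n ^ 4 * ?p n ^ 3) / (\<epsilon> * ?m n ^ 2)"
          by (rule prob_many_adjacent_pairs[OF p]) (use \<epsilon> m_pos in simp)
        also have "\<dots> = (1 / ?m n + 1 / real n + ?p n) / \<epsilon>"
          unfolding m using n(1) p(1) \<epsilon> by (simp add: field_simps power2_eq_square power3_eq_cube power4_eq_xxxx)
        finally show "measure_pmf.prob (erdos_renyi n (?p n)) ?B \<le> (1 / ?m n + 1 / real n + ?p n) / \<epsilon>" .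
      qed
      finally show ?case .
    qed
  qed
  then show "\<exists>c C :: real. 0 < c \<and> c < C \<and>
      asymptotically_almost_surely (\<lambda>n. erdos_renyi n (?p n))
        (\<lambda>n E. \<forall>l. 0 < l \<and> l \<le> k \<longrightarrow>
          c * real n powr ((2 - \<beta>) * real l) \<le> real_of_int (gamma_vector (symmetric_edge_polytope E) l) \<and>
          real_of_int (gamma_vector (symmetric_edge_polytope E) l) \<le> C * real n powr ((2 - \<beta>) * real l))"
    using c \<open>c < C\<close> by blast
qed

end
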